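(* Let $X_\bullet$ be a simplicial manifold. There exist open neighborhoods $U_n$ of $X_0\subseteq X_n$, $n\in\mathbb{N}_0$, such that the face maps of $X_\bullet$ restrict to well-defined maps between the $U_n$'s and the resulting semisimplicial manifold $U_\bullet$ satisfies the following for every $n\in\mathbb{N}$: (i) for $0\le i\le n$, the horn space $\bigwedge^n_i(U)$ is a well-defined embedded submanifold of $U_{n-1}^{\times n}$ and the horn projection $p^n_i:U_n\to\bigwedge^n_i(U)$ is a submersion; (ii) for $1\le m<n$ and $0\le i\le m$, the horn space $\bigwedge^n_{\{i,m+1,\dots,n\}}(U)$ is a well-defined embedded submanifold of $U_{n-1}^{\times m}$ and the horn projection $p^n_{\{i,m+1,\dots,n\}}:U_n\to\bigwedge^n_{\{i,m+1,\dots,n\}}(U)$ is a submersion.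
   Context: $\mathbb{N}=\{1,2,\dots\}$, $\mathbb{N}_0=\mathbb{N}\cup\{0\}$, $[n]=\{0,\dots,n\}$. A simplicial manifold is a simplicial object in smooth manifolds, with face maps $d_j$ and degeneracy maps $s_j$; a semisimplicial manifold has only face maps (a contravariant functor from the category of the ordinals $[n]$ with injective order-preserving maps). The base $X_0$ is regarded as a submanifold of $X_n$ via the (unique) iterated degeneracy embedding $(s_0)^n:X_0\hookrightarrow X_n$. For a semisimplicial manifold $U_\bullet$, $n\in\mathbb{N}$ and $I\subsetneq[n]$, the $(n,I)$-horn space is $$\bigwedge\nolimits^n_I(U)=\{(x^j)_{j\in[n]\setminus I}\in U_{n-1}^{\times([n]\setminus I)} \mid d_{j_1}(x^{j_2})=d_{j_2-1}(x^{j_1})\text{ for } j_1<j_2,\ j_1,j_2\in[n]\setminus I\},$$ with no condition if $n=1$; $\bigwedge^n_i(U):=\bigwedge^n_{\{i\}}(U)$. The horn projection is $p^n_I(x)=(d_jx)_{j\in[n]\setminus I}$, and $p^n_i:=p^n_{\{i\}}$. Submersions are not required to be surjective. *)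

theory Defs
  imports "HOL-Analysis.Analysis"
begin

section \<open>Smooth maps between open subsets of Euclidean spaces\<close>

text \<open>The dimension of a manifold varies with the simplicial degree, so charts take values in
  the library's \<^const>\<open>Euclidean_space\<close>, whose dimension is a natural number rather than a type:
  its points are the functions from nat to real that vanish at all arguments \<open>\<ge> d\<close>. In particular
  Euclidean k-space is literally the subset of Euclidean d-space (for \<open>k \<le> d\<close>) on which the
  last \<open>d - k\<close> coordinates vanish.\<close>

definition partial_deriv :: "nat \<Rightarrow> ((nat \<Rightarrow> real) \<Rightarrow> real) \<Rightarrow> (nat \<Rightarrow> real) \<Rightarrow> real" where
  "partial_deriv i f x = deriv (\<lambda>t. f (x(i := t))) (x i)"

text \<open>\<open>Ck_on k d U f\<close>: all iterated partial derivatives of \<open>f\<close> of order up to \<open>k\<close> exist and are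
  continuous on \<open>U\<close>; meant for \<open>U\<close> open in Euclidean d-space.\<close>

primrec Ck_on :: "nat \<Rightarrow> nat \<Rightarrow> (nat \<Rightarrow> real) set \<Rightarrow> ((nat \<Rightarrow> real) \<Rightarrow> real) \<Rightarrow> bool" where
  "Ck_on 0 d U f \<longleftrightarrow> continuous_map (subtopology (Euclidean_space d) U) euclideanreal f"
| "Ck_on (Suc k) d U f \<longleftrightarrow>
     continuous_map (subtopology (Euclidean_space d) U) euclideanreal f \<and>
     (\<forall>i<d. (\<forall>x\<in>U. (\<lambda>t. f (x(i := t))) field_differentiable at (x i)) \<and>
            Ck_on k d U (partial_deriv i f))"

definition smooth_between ::
  "nat \<Rightarrow> nat \<Rightarrow> (nat \<Rightarrow> real) set \<Rightarrow> ((nat \<Rightarrow> real) \<Rightarrow> (nat \<Rightarrow> real)) \<Rightarrow> bool" where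
  "smooth_between d e U F \<longleftrightarrow>
     F ` U \<subseteq> topspace (Euclidean_space e) \<and> (\<forall>j<e. \<forall>k. Ck_on k d U (\<lambda>x. F x j))"

definition surjective_derivative ::
  "nat \<Rightarrow> nat \<Rightarrow> ((nat \<Rightarrow> real) \<Rightarrow> (nat \<Rightarrow> real)) \<Rightarrow> (nat \<Rightarrow> real) \<Rightarrow> bool" where
  "surjective_derivative d e F x \<longleftrightarrow>
     (\<forall>w \<in> topspace (Euclidean_space e). \<exists>v \<in> topspace (Euclidean_space d).
        \<forall>j<e. (\<Sum>i<d. partial_deriv i (\<lambda>y. F y j) x * v i) = w j)"

section \<open>Smooth manifolds\<close>

text \<open>A chart \<open>(d, W, \<phi>)\<close> consists of a dimension, a domain and a coordinate map; the values of
  \<open>\<phi>\<close> outside \<open>W\<close> are irrelevant.\<close>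

type_synonym 'a chart = "nat \<times> 'a set \<times> ('a \<Rightarrow> nat \<Rightarrow> real)"

definition chart_on :: "'a topology \<Rightarrow> 'a chart \<Rightarrow> bool" where
  "chart_on T = (\<lambda>(d, W, \<phi>).
     openin T W \<and> openin (Euclidean_space d) (\<phi> ` W) \<and>
     homeomorphic_map (subtopology T W) (subtopology (Euclidean_space d) (\<phi> ` W)) \<phi>)"

definition compatible_charts :: "'a chart \<Rightarrow> 'a chart \<Rightarrow> bool" where
  "compatible_charts = (\<lambda>(d, W, \<phi>) (e, V, \<psi>).
     smooth_between d e (\<phi> ` (W \<inter> V)) (\<psi> \<circ> inv_into W \<phi>) \<and>
     smooth_between e d (\<psi> ` (W \<inter> V)) (\<phi> \<circ> inv_into V \<psi>))"

text \<open>The atlas is not required to be maximal, and different connected components of a manifold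
  may have different dimensions.\<close>

record 'a mfd =
  mtop :: "'a topology"
  atlas :: "'a chart set"

abbreviation points :: "'a mfd \<Rightarrow> 'a set" where
  "points M \<equiv> topspace (mtop M)"

definition smooth_manifold :: "'a mfd \<Rightarrow> bool" where
  "smooth_manifold M \<longleftrightarrow>
     Hausdorff_space (mtop M) \<and> second_countable (mtop M) \<and>
     (\<forall>c \<in> atlas M. chart_on (mtop M) c) \<and>
     (\<forall>c \<in> atlas M. \<forall>c' \<in> atlas M. compatible_charts c c') \<and>
     (\<forall>x \<in> points M. \<exists>(d, W, \<phi>) \<in> atlas M. x \<in> W)"

definition maximal_atlas :: "'a mfd \<Rightarrow> 'a chart set" where
  "maximal_atlas M = {c. chart_on (mtop M) c \<and> (\<forall>c' \<in> atlas M. compatible_charts c c')}"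

definition smooth_map :: "'a mfd \<Rightarrow> 'b mfd \<Rightarrow> ('a \<Rightarrow> 'b) \<Rightarrow> bool" where
  "smooth_map M N f \<longleftrightarrow>
     continuous_map (mtop M) (mtop N) f \<and>
     (\<forall>(d, W, \<phi>) \<in> atlas M. \<forall>(e, V, \<psi>) \<in> atlas N.
        smooth_between d e (\<phi> ` (W \<inter> f -` V)) (\<psi> \<circ> f \<circ> inv_into W \<phi>))"

definition submersion :: "'a mfd \<Rightarrow> 'b mfd \<Rightarrow> ('a \<Rightarrow> 'b) \<Rightarrow> bool" where
  "submersion M N f \<longleftrightarrow>
     smooth_map M N f \<and>
     (\<forall>(d, W, \<phi>) \<in> atlas M. \<forall>(e, V, \<psi>) \<in> atlas N. \<forall>x \<in> W \<inter> f -` V.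
        surjective_derivative d e (\<psi> \<circ> f \<circ> inv_into W \<phi>) (\<phi> x))"

definition open_submanifold :: "'a mfd \<Rightarrow> 'a set \<Rightarrow> 'a mfd" where
  "open_submanifold M U =
     \<lparr>mtop = subtopology (mtop M) U, atlas = {(d, W \<inter> U, \<phi>) | d W \<phi>. (d, W, \<phi>) \<in> atlas M}\<rparr>"

text \<open>A slice chart for \<open>S\<close> straightens \<open>S\<close> to a coordinate subspace. Since Euclidean k-space is a
  subset of Euclidean d-space, the same coordinate map also serves as a k-dimensional chart
  of \<open>S\<close>.\<close>

definition slice_chart :: "'a mfd \<Rightarrow> 'a set \<Rightarrow> nat \<Rightarrow> 'a chart \<Rightarrow> bool" where
  "slice_chart M S k = (\<lambda>(d, W, \<phi>).
     (d, W, \<phi>) \<in> maximal_atlas M \<and> k \<le> d \<and>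
     \<phi> ` (W \<inter> S) = \<phi> ` W \<inter> topspace (Euclidean_space k))"

definition embedded_submanifold :: "'a mfd \<Rightarrow> 'a set \<Rightarrow> bool" where
  "embedded_submanifold M S \<longleftrightarrow>
     S \<subseteq> points M \<and> (\<forall>x\<in>S. \<exists>k d W \<phi>. slice_chart M S k (d, W, \<phi>) \<and> x \<in> W)"

definition submanifold :: "'a mfd \<Rightarrow> 'a set \<Rightarrow> 'a mfd" where
  "submanifold M S =
     \<lparr>mtop = subtopology (mtop M) S,
      atlas = {(k, W \<inter> S, \<phi>) | k d W \<phi>. slice_chart M S k (d, W, \<phi>)}\<rparr>"

text \<open>Concatenation of the vectors \<open>y j\<close> of dimensions \<open>D j\<close>, in increasing order of
  \<open>j \<in> J\<close>: the block of \<open>j\<close> starts at position \<open>block_start J D j\<close>.\<close>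

definition block_start :: "nat set \<Rightarrow> (nat \<Rightarrow> nat) \<Rightarrow> nat \<Rightarrow> nat" where
  "block_start J D j = (\<Sum>i \<in> {i \<in> J. i < j}. D i)"

definition concat_coords ::
  "nat set \<Rightarrow> (nat \<Rightarrow> nat) \<Rightarrow> (nat \<Rightarrow> nat \<Rightarrow> real) \<Rightarrow> nat \<Rightarrow> real" where
  "concat_coords J D y = (\<lambda>k. \<Sum>j\<in>J.
     if block_start J D j \<le> k \<and> k < block_start J D j + D j
     then y j (k - block_start J D j) else 0)"

definition product_manifold :: "nat set \<Rightarrow> (nat \<Rightarrow> 'a mfd) \<Rightarrow> (nat \<Rightarrow> 'a) mfd" where
  "product_manifold J M =
     \<lparr>mtop = product_topology (\<lambda>j. mtop (M j)) J,
      atlas = {(\<Sum>j\<in>J. D j, \<Pi>\<^sub>E j\<in>J. W j, \<lambda>x. concat_coords J D (\<lambda>j. \<phi> j (x j))) | D W \<phi>.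
                 \<forall>j\<in>J. (D j, W j, \<phi> j) \<in> atlas (M j)}\<rparr>"

section \<open>Simplicial manifolds and horns\<close>

text \<open>\<open>d n j\<close> is the face map from \<open>X n\<close> to \<open>X (n - 1)\<close> (for \<open>1 \<le> n\<close>, \<open>j \<le> n\<close>), and \<open>s n j\<close> is the
  degeneracy map from \<open>X n\<close> to \<open>X (n + 1)\<close> (for \<open>j \<le> n\<close>).\<close>

locale semisimplicial_manifold =
  fixes X :: "nat \<Rightarrow> 'a mfd"
    and d :: "nat \<Rightarrow> nat \<Rightarrow> 'a \<Rightarrow> 'a"
  assumes manifold: "smooth_manifold (X n)"
    and face_smooth: "\<lbrakk>1 \<le> n; j \<le> n\<rbrakk> \<Longrightarrow> smooth_map (X n) (X (n - 1)) (d n j)"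
    and face_face: "\<lbrakk>2 \<le> n; i < j; j \<le> n; x \<in> points (X n)\<rbrakk> \<Longrightarrow>
          d (n - 1) i (d n j x) = d (n - 1) (j - 1) (d n i x)"

locale simplicial_manifold = semisimplicial_manifold X d
  for X :: "nat \<Rightarrow> 'a mfd" and d :: "nat \<Rightarrow> nat \<Rightarrow> 'a \<Rightarrow> 'a" +
  fixes s :: "nat \<Rightarrow> nat \<Rightarrow> 'a \<Rightarrow> 'a"
  assumes degen_smooth: "j \<le> n \<Longrightarrow> smooth_map (X n) (X (n + 1)) (s n j)"
    and degen_degen: "\<lbrakk>i \<le> j; j \<le> n; x \<in> points (X n)\<rbrakk> \<Longrightarrow>
          s (n + 1) i (s n j x) = s (n + 1) (j + 1) (s n i x)"
    and face_degen_less: "\<lbrakk>i < j; j \<le> n; x \<in> points (X n)\<rbrakk> \<Longrightarrow>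
          d (n + 1) i (s n j x) = s (n - 1) (j - 1) (d n i x)"
    and face_degen_same: "\<lbrakk>i = j \<or> i = j + 1; j \<le> n; x \<in> points (X n)\<rbrakk> \<Longrightarrow>
          d (n + 1) i (s n j x) = x"
    and face_degen_greater: "\<lbrakk>j + 1 < i; i \<le> n + 1; x \<in> points (X n)\<rbrakk> \<Longrightarrow>
          d (n + 1) i (s n j x) = s (n - 1) j (d n (i - 1) x)"

primrec base_embedding :: "(nat \<Rightarrow> nat \<Rightarrow> 'a \<Rightarrow> 'a) \<Rightarrow> nat \<Rightarrow> 'a \<Rightarrow> 'a" where
  "base_embedding s 0 x = x"
| "base_embedding s (Suc n) x = s n 0 (base_embedding s n x)"

definition horn_ambient :: "(nat \<Rightarrow> 'a mfd) \<Rightarrow> nat \<Rightarrow> nat set \<Rightarrow> (nat \<Rightarrow> 'a) mfd" where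
  "horn_ambient U n I = product_manifold ({0..n} - I) (\<lambda>_. U (n - 1))"

definition horn ::
  "(nat \<Rightarrow> 'a mfd) \<Rightarrow> (nat \<Rightarrow> nat \<Rightarrow> 'a \<Rightarrow> 'a) \<Rightarrow> nat \<Rightarrow> nat set \<Rightarrow> (nat \<Rightarrow> 'a) set" where
  "horn U d n I =
     {x \<in> \<Pi>\<^sub>E j \<in> {0..n} - I. points (U (n - 1)).
        n = 1 \<or> (\<forall>j1 \<in> {0..n} - I. \<forall>j2 \<in> {0..n} - I. j1 < j2 \<longrightarrow>
          d (n - 1) j1 (x j2) = d (n - 1) (j2 - 1) (x j1))}"

definition horn_projection ::
  "(nat \<Rightarrow> nat \<Rightarrow> 'a \<Rightarrow> 'a) \<Rightarrow> nat \<Rightarrow> nat set \<Rightarrow> 'a \<Rightarrow> (nat \<Rightarrow> 'a)" where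
  "horn_projection d n I x = (\<lambda>j \<in> {0..n} - I. d n j x)"

definition horn_submersive ::
  "(nat \<Rightarrow> 'a mfd) \<Rightarrow> (nat \<Rightarrow> nat \<Rightarrow> 'a \<Rightarrow> 'a) \<Rightarrow> nat \<Rightarrow> nat set \<Rightarrow> bool" where
  "horn_submersive U d n I \<longleftrightarrow>
     embedded_submanifold (horn_ambient U n I) (horn U d n I) \<and>
     submersion (U n) (submanifold (horn_ambient U n I) (horn U d n I)) (horn_projection d n I)"

end

(* Near a base point the horn projections are governed by linear algebra: the tangent spaces at the totally
   degenerate simplices form a simplicial vector space, and Moore's algorithm fills horns in simplicial vector
   spaces, so horn projections are submersive at base points; since submersivity is an open condition, they are
   submersive nearby. Put U 0 = X 0 and let U (n + 1) consist of the simplices with all faces in U n at which all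
   horn projections to horns in U n are submersive.

   Both families of horns are of the form I = {i} Un {m+1..n} with i <= m <= n, i.e. they consist of faces with
   indices in {0..m} - {i}. That the whole horn space, and not only the part near X 0, is a submanifold follows by
   induction: adding the face of largest index t to a horn requires its lower faces to match those of the given
   horn, so the larger horn space is the fiber product of the smaller one with U (n - 1) along a horn projection of
   degree n - 1, which is a submersion on all of U (n - 1). *)

theory Submission
  imports Defs "HOL-Library.Function_Algebras"
begin

text \<open>The obstacle is a circle: the size of \<open>U n\<close> is dictated by submersivity
  onto horn spaces, and a horn space is a submanifold only because of submersivity one degree below.
  \<open>submersive_at\<close> breaks it. It asks for a slice chart of the horn at the image point
  only, so it makes sense for an arbitrary subset, it is an open condition without any knowledge
  about the rest of the horn, and the neighborhoods arise from a plain recursion. At base points the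
  slice charts are supplied by the induction on fiber products. Degeneracy maps need not preserve
  the sets \<open>U n\<close>; they enter through their tangent maps at base points alone, computed
  in \<open>X\<close>. All the analysis (regular level sets, openness of submersivity, fiber
  products) rests on \<open>straighten\<close>, an inverse function theorem obtained by replacing
  one coordinate at a time, where one-variable calculus suffices.\<close>

section \<open>Euclidean spaces inside \<open>nat \<Rightarrow> real\<close> and their box
  neighborhoods\<close>

definition EE :: "nat \<Rightarrow> (nat \<Rightarrow> real) set" where
  "EE d = {x. \<forall>i\<ge>d. x i = 0}"

abbreviation eopen :: "nat \<Rightarrow> (nat \<Rightarrow> real) set \<Rightarrow> bool" where
  "eopen d U \<equiv> openin (Euclidean_space d) U"

text \<open>Passes from the abstract topology to the type class topology on functions, so that
  \<open>continuous_on\<close> and its calculus apply.\<close>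

lemma Euclidean_space_eq_top_of_set: "Euclidean_space n = top_of_set (EE n)"
  by (simp add: Euclidean_space_def EE_def euclidean_product_topology)

lemma topspace_Euclidean_space_EE [simp]: "topspace (Euclidean_space d) = EE d"
  by (simp add: topspace_Euclidean_space EE_def)

lemma EE_iff: "x \<in> EE d \<longleftrightarrow> (\<forall>i\<ge>d. x i = 0)"
  by (simp add: EE_def)

lemma EE_upd: "x \<in> EE d \<Longrightarrow> i < d \<Longrightarrow> x(i := t) \<in> EE d"
  by (auto simp: EE_iff)

lemma EE_eqI: "x \<in> EE d \<Longrightarrow> y \<in> EE d \<Longrightarrow> (\<And>i. i < d \<Longrightarrow> x i = y i) \<Longrightarrow> x = y"
  by (rule ext) (metis EE_iff linorder_not_less)

lemma open_box: "open {y::nat\<Rightarrow>real. \<forall>i<d. \<bar>y i - x i\<bar> < e}"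
proof -
  have "open {y::nat\<Rightarrow>real. \<bar>y i - x i\<bar> < e}" for i
  proof (rule open_Collect_less)
    show "continuous_on UNIV (\<lambda>y::nat\<Rightarrow>real. \<bar>y i - x i\<bar>)"
      by (rule continuous_on_rabs, rule continuous_on_diff, rule continuous_on_product_coordinates, rule continuous_on_const)
  qed (rule continuous_on_const)
  moreover have "{y::nat\<Rightarrow>real. \<forall>i<d. \<bar>y i - x i\<bar> < e} = (\<Inter>i\<in>{..<d}. {y. \<bar>y i - x i\<bar> < e})"
    by blast
  ultimately show ?thesis using open_INT[of "{..<d}" "\<lambda>i. {y. \<bar>y i - x i\<bar> < e}"] by simp
qed

lemma eopen_box: "eopen d {y \<in> EE d. \<forall>i<d. \<bar>y i - x i\<bar> < e}"
  using openin_open_Int[OF open_box, of "EE d" d x e]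
  by (simp add: Int_def Euclidean_space_eq_top_of_set)

text \<open>A basic open set of the product topology restricts finitely many coordinates. Those from
  \<open>d\<close> on vanish throughout \<open>EE d\<close>, so only the radii at
  \<open>i < d\<close> count and their minimum serves for all.\<close>

lemma eopen_iff_box:
  "eopen d U \<longleftrightarrow> U \<subseteq> EE d \<and> (\<forall>x\<in>U. \<exists>e>0. \<forall>y\<in>EE d. (\<forall>i<d. \<bar>y i - x i\<bar> < e) \<longrightarrow> y \<in> U)"
proof (intro iffI conjI ballI)
  assume U: "eopen d U"
  show "U \<subseteq> EE d" using openin_subset[OF U] by simp
  fix x assume x: "x \<in> U"
  obtain T where T: "open T" "U = EE d \<inter> T"
    using U by (auto simp: openin_open Euclidean_space_eq_top_of_set)
  have "openin (product_topology (\<lambda>i. euclidean) UNIV) T"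
    using T(1) by (simp add: open_fun_def)
  then obtain X where X: "x \<in> (\<Pi>\<^sub>E i\<in>UNIV. X i)" "\<And>i. open (X i)" "(\<Pi>\<^sub>E i\<in>UNIV. X i) \<subseteq> T"
    using product_topology_open_contains_basis[of "\<lambda>i. euclidean" UNIV T x] x T(2) by auto
  have "\<exists>e>0. ball (x i) e \<subseteq> X i" for i
    using X(1,2) open_contains_ball by (metis PiE_mem UNIV_I)
  then obtain e where e: "\<And>i. e i > 0" "\<And>i. ball (x i) (e i) \<subseteq> X i" by metis
  \<comment> \<open>The extra \<open>1\<close> keeps the set nonempty when
    \<open>d = 0\<close>.\<close>
  define m where "m = Min (insert 1 (e ` {..<d}))"
  have m: "m > 0" "\<And>i. i < d \<Longrightarrow> m \<le> e i"
    using e(1) by (auto simp: m_def)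
  show "\<exists>e>0. \<forall>y\<in>EE d. (\<forall>i<d. \<bar>y i - x i\<bar> < e) \<longrightarrow> y \<in> U"
  proof (intro exI[of _ m] conjI ballI impI m(1))
    fix y assume y: "y \<in> EE d" "\<forall>i<d. \<bar>y i - x i\<bar> < m"
    have "y i \<in> X i" for i
    proof (cases "i < d")
      case True
      then have "y i \<in> ball (x i) (e i)"
        using y(2) m(2)[OF True] True by (force simp: dist_real_def)
      then show ?thesis using e(2) by blast
    next
      case False
      then have "y i = x i" using y(1) x \<open>U \<subseteq> EE d\<close> by (force simp: EE_iff)
      then show ?thesis using X(1) by auto
    qed
    then show "y \<in> U" using X(3) T(2) y(1) by (auto simp: PiE_def)
  qed
next
  assume U: "U \<subseteq> EE d \<and> (\<forall>x\<in>U. \<exists>e>0. \<forall>y\<in>EE d. (\<forall>i<d. \<bar>y i - x i\<bar> < e) \<longrightarrow> y \<in> U)"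
  have "\<exists>T. eopen d T \<and> x \<in> T \<and> T \<subseteq> U" if x: "x \<in> U" for x
  proof -
    obtain e where e: "e > 0" "\<forall>y\<in>EE d. (\<forall>i<d. \<bar>y i - x i\<bar> < e) \<longrightarrow> y \<in> U"
      using U x by blast
    show ?thesis
      using e x U eopen_box[of d x e] by (intro exI[of _ "{y \<in> EE d. \<forall>i<d. \<bar>y i - x i\<bar> < e}"]) auto
  qed
  then show "eopen d U" by (subst openin_subopen) blast
qed

lemma eopen_subset: "eopen d U \<Longrightarrow> U \<subseteq> EE d"
  using openin_subset[of "Euclidean_space d" U] by simp

lemma continuous_on_boxD:
  assumes f: "continuous_on U (f :: (nat \<Rightarrow> real) \<Rightarrow> real)" and U: "eopen d U" and x: "x \<in> U" and r: "r > 0"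
  shows "\<exists>e>0. \<forall>y\<in>EE d. (\<forall>i<d. \<bar>y i - x i\<bar> < e) \<longrightarrow> y \<in> U \<and> \<bar>f y - f x\<bar> < r"
proof -
  have "openin (top_of_set U) (U \<inter> f -` ball (f x) r)"
    by (rule continuous_openin_preimage_gen[OF f open_ball])
  moreover have "openin (top_of_set (EE d)) U"
    using U by (simp only: Euclidean_space_eq_top_of_set)
  ultimately have "openin (top_of_set (EE d)) (U \<inter> f -` ball (f x) r)"
    by (rule openin_trans)
  then have "eopen d (U \<inter> f -` ball (f x) r)"
    by (simp only: Euclidean_space_eq_top_of_set)
  moreover have "x \<in> U \<inter> f -` ball (f x) r" using x r by simp
  ultimately obtain e where "e > 0" "\<forall>y\<in>EE d. (\<forall>i<d. \<bar>y i - x i\<bar> < e) \<longrightarrow> y \<in> U \<inter> f -` ball (f x) r"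
    by (metis eopen_iff_box)
  then show ?thesis
    by (intro exI[of _ e]) (simp add: dist_real_def abs_minus_commute)
qed

lemma continuous_on_boxI:
  assumes "\<And>x r. x \<in> U \<Longrightarrow> r > 0 \<Longrightarrow> \<exists>e>0. \<forall>y\<in>U. (\<forall>i<d. \<bar>y i - x i\<bar> < e) \<longrightarrow> \<bar>f y - f x\<bar> < r"
  shows "continuous_on U (f :: (nat \<Rightarrow> real) \<Rightarrow> real)"
  unfolding continuous_on_def
proof (intro ballI tendstoI)
  fix x and r :: real assume "x \<in> U" "r > 0"
  then obtain e where e: "e > 0" "\<forall>y\<in>U. (\<forall>i<d. \<bar>y i - x i\<bar> < e) \<longrightarrow> \<bar>f y - f x\<bar> < r"
    using assms by blast
  show "\<forall>\<^sub>F y in at x within U. dist (f y) (f x) < r"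
    unfolding eventually_at_topological
    by (rule exI[of _ "{y. \<forall>i<d. \<bar>y i - x i\<bar> < e}"]) (use e open_box in \<open>auto simp: dist_real_def\<close>)
qed

section \<open>Functions of class C-k\<close>

lemma continuous_map_Euclidean_subtopology:
  "U \<subseteq> EE d \<Longrightarrow> continuous_map (subtopology (Euclidean_space d) U) euclideanreal f \<longleftrightarrow> continuous_on U f"
  by (simp add: Euclidean_space_eq_top_of_set subtopology_subtopology Int_absorb1)

lemma Ck_on_continuous: "Ck_on k d U f \<Longrightarrow> U \<subseteq> EE d \<Longrightarrow> continuous_on U f"
  by (cases k) (auto simp: continuous_map_Euclidean_subtopology)

lemma Ck_on_subset: "Ck_on k d U f \<Longrightarrow> V \<subseteq> U \<Longrightarrow> Ck_on k d V f"
proof (induction k arbitrary: f)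
  case 0
  then show ?case by (auto intro: continuous_map_from_subtopology_mono)
next
  case (Suc k)
  then show ?case by (auto intro: continuous_map_from_subtopology_mono)
qed

lemma Ck_on_SucD: "Ck_on (Suc k) d U f \<Longrightarrow> Ck_on k d U f"
  by (induction k arbitrary: f) auto

lemma Ck_on_le: "Ck_on k d U f \<Longrightarrow> j \<le> k \<Longrightarrow> Ck_on j d U f"
  by (induction k) (auto simp: le_Suc_eq dest: Ck_on_SucD simp del: Ck_on.simps)

text \<open>Lets one-variable derivatives in a coordinate direction depend only on the values taken
  on \<open>U\<close>.\<close>

lemma eopen_line:
  assumes "eopen d U" "x \<in> U" "i < d"
  shows "\<forall>\<^sub>F t in nhds (x i). x(i := t) \<in> U"
proof -
  obtain e where e: "e > 0" "\<forall>y\<in>EE d. (\<forall>i<d. \<bar>y i - x i\<bar> < e) \<longrightarrow> y \<in> U"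
    using assms unfolding eopen_iff_box by blast
  have "x \<in> EE d" using assms eopen_subset by blast
  then have "x(i := t) \<in> U" if "dist t (x i) < e" for t
    using e that assms(3) by (auto simp: dist_real_def EE_upd)
  then show ?thesis using e(1) unfolding eventually_nhds_metric by blast
qed

lemma partial_deriv_cong:
  assumes "eopen d U" "x \<in> U" "i < d" "\<And>y. y \<in> U \<Longrightarrow> f y = g y"
  shows "partial_deriv i f x = partial_deriv i g x"
  unfolding partial_deriv_def
  by (rule deriv_cong_ev) (use eopen_line[OF assms(1-3)] assms(4) in \<open>auto elim: eventually_mono\<close>)

lemma has_field_derivative_cong_line:
  assumes "eopen d U" "x \<in> U" "i < d" "\<And>y. y \<in> U \<Longrightarrow> f y = g y"
  shows "((\<lambda>t. f (x(i := t))) has_field_derivative D) (at (x i)) \<longleftrightarrow>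
         ((\<lambda>t. g (x(i := t))) has_field_derivative D) (at (x i))"
  by (rule DERIV_cong_ev) (use eopen_line[OF assms(1-3)] assms(4) in \<open>auto elim: eventually_mono\<close>)

lemma Ck_on_cong:
  assumes "eopen d U" "\<And>y. y \<in> U \<Longrightarrow> f y = g y" "Ck_on k d U f"
  shows "Ck_on k d U g"
  using assms(2,3)
proof (induction k arbitrary: f g)
  case 0
  then show ?case
    using assms(1) eopen_subset by (auto simp: continuous_map_Euclidean_subtopology cong: continuous_on_cong)
next
  case (Suc k)
  have "continuous_on U g"
    using Suc.prems assms(1) eopen_subset[of d U] Ck_on_continuous[of "Suc k" d U f] continuous_on_cong[of U U f g] by auto
  moreover have "(\<lambda>t. g (x(i := t))) field_differentiable at (x i)" if "i < d" "x \<in> U" for i x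
    using Suc.prems that has_field_derivative_cong_line[OF assms(1) that(2,1), of f g]
    unfolding field_differentiable_def by (metis Ck_on.simps(2) field_differentiable_def)
  moreover have "Ck_on k d U (partial_deriv i g)" if "i < d" for i
    using Suc.IH[of "partial_deriv i f" "partial_deriv i g"] Suc.prems that
      partial_deriv_cong[OF assms(1) _ that, of _ f g] by auto
  ultimately show ?case
    using assms(1) eopen_subset[of d U] by (simp add: continuous_map_Euclidean_subtopology)
qed

lemma Ck_on_partial:
  assumes "Ck_on (Suc k) d U f" "x \<in> U" "i < d"
  shows "((\<lambda>t. f (x(i := t))) has_field_derivative partial_deriv i f x) (at (x i))"
  using assms by (auto simp: partial_deriv_def DERIV_deriv_iff_field_differentiable)

lemma Ck_on_partial_at:
  assumes "Ck_on (Suc k) d U f" "x(i := u) \<in> U" "i < d"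
  shows "((\<lambda>t. f (x(i := t))) has_field_derivative partial_deriv i f (x(i := u))) (at u)"
  using Ck_on_partial[OF assms] by simp

lemma partial_deriv_eqI:
  "((\<lambda>t. f (x(i := t))) has_field_derivative D) (at (x i)) \<Longrightarrow> partial_deriv i f x = D"
  unfolding partial_deriv_def by (erule DERIV_imp_deriv)

text \<open>For functions whose partial derivatives are known by formulas \<open>g i\<close>.
  Because \<open>U\<close> is open, agreement of the formulas with \<open>partial_deriv\<close> on
  \<open>U\<close> is enough to transfer their smoothness.\<close>

lemma Ck_on_SucI:
  assumes U: "eopen d U" and f: "continuous_on U f"
    and g: "\<And>i x. i < d \<Longrightarrow> x \<in> U \<Longrightarrow> ((\<lambda>t. f (x(i := t))) has_field_derivative g i x) (at (x i))"
    and gk: "\<And>i. i < d \<Longrightarrow> Ck_on k d U (g i)"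
  shows "Ck_on (Suc k) d U f"
proof -
  have "Ck_on k d U (partial_deriv i f)" if "i < d" for i
    by (rule Ck_on_cong[OF U _ gk[OF that]]) (use g[OF that] partial_deriv_eqI in metis)
  then show ?thesis
    using f g U eopen_subset[of d U]
    by (auto simp: continuous_map_Euclidean_subtopology field_differentiable_def)
qed

text \<open>Continuity and partial derivatives are both local, and the neighborhood \<open>V\<close>
  that works for \<open>f\<close> also works for its partial derivatives one order lower.\<close>

lemma Ck_on_local:
  assumes "\<And>x. x \<in> U \<Longrightarrow> \<exists>V. eopen d V \<and> x \<in> V \<and> Ck_on k d V f"
  shows "Ck_on k d U f"
proof -
  have UE: "U \<subseteq> EE d" using assms eopen_subset by blast
  have cont: "continuous_on U f" if *: "\<And>x. x \<in> U \<Longrightarrow> \<exists>V. eopen d V \<and> x \<in> V \<and> continuous_on V f" for f :: "(nat\<Rightarrow>real)\<Rightarrow>real"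
  proof (rule continuous_on_boxI[where d=d])
    fix x and r::real assume "x \<in> U" "r > 0"
    with * obtain V where "eopen d V" "x \<in> V" "continuous_on V f" by blast
    then show "\<exists>e>0. \<forall>y\<in>U. (\<forall>i<d. \<bar>y i - x i\<bar> < e) \<longrightarrow> \<bar>f y - f x\<bar> < r"
      using continuous_on_boxD[of V f d x r] \<open>r > 0\<close> UE by (meson in_mono)
  qed
  show ?thesis using assms
  proof (induction k arbitrary: f)
    case 0
    then show ?case using cont UE by (metis Ck_on.simps(1) continuous_map_Euclidean_subtopology eopen_subset)
  next
    case (Suc k)
    have "continuous_on U f" using cont Suc.prems Ck_on_continuous eopen_subset by metis
    moreover have "(\<lambda>t. f (x(i := t))) field_differentiable at (x i)" if "i < d" "x \<in> U" for i x
      using Suc.prems[OF that(2)] that(1) by auto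
    moreover have "Ck_on k d U (partial_deriv i f)" if "i < d" for i
      by (rule Suc.IH) (use Suc.prems that in \<open>force\<close>)
    ultimately show ?case using UE by (simp add: continuous_map_Euclidean_subtopology)
  qed
qed

lemma Ck_on_const [simp]: "eopen d U \<Longrightarrow> Ck_on k d U (\<lambda>x. c)"
proof (induction k arbitrary: c)
  case 0
  then show ?case by simp
next
  case (Suc k)
  then show ?case by (intro Ck_on_SucI[where g="\<lambda>i x. 0"]) auto
qed

lemma Ck_on_coord [simp]:
  assumes "eopen d U" shows "Ck_on k d U (\<lambda>x. x j)"
proof (cases k)
  case 0
  then show ?thesis using assms eopen_subset continuous_on_product_coordinates
    by (metis Ck_on.simps(1) continuous_map_Euclidean_subtopology continuous_on_subset subset_UNIV)
next
  case (Suc k')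
  have "((\<lambda>t. (x(i := t)) j) has_field_derivative (if i = j then 1 else 0)) (at (x i))" for i and x :: "nat \<Rightarrow> real"
    by auto
  then show ?thesis unfolding Suc
    by (intro Ck_on_SucI[OF assms, where g="\<lambda>i x. if i = j then 1 else 0"] continuous_on_subset[OF continuous_on_product_coordinates])
      (auto simp: assms)
qed

lemma Ck_on_add:
  assumes "eopen d U" "Ck_on k d U f" "Ck_on k d U g"
  shows "Ck_on k d U (\<lambda>x. f x + g x)"
  using assms(2,3)
proof (induction k arbitrary: f g)
  case 0
  then show ?case using assms(1) by (simp add: continuous_map_Euclidean_subtopology eopen_subset continuous_on_add)
next
  case (Suc k)
  show ?case
  proof (rule Ck_on_SucI[OF assms(1), where g="\<lambda>i x. partial_deriv i f x + partial_deriv i g x"])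
    show "continuous_on U (\<lambda>x. f x + g x)"
      by (intro continuous_on_add Ck_on_continuous[OF Suc.prems(1)] Ck_on_continuous[OF Suc.prems(2)] eopen_subset assms)
    show "((\<lambda>t. f (x(i := t)) + g (x(i := t))) has_field_derivative partial_deriv i f x + partial_deriv i g x) (at (x i))"
      if "i < d" "x \<in> U" for i x
      by (rule DERIV_add[OF Ck_on_partial[OF Suc.prems(1) that(2,1)] Ck_on_partial[OF Suc.prems(2) that(2,1)]])
    show "Ck_on k d U (\<lambda>x. partial_deriv i f x + partial_deriv i g x)" if "i < d" for i
      using Suc.IH Suc.prems that by auto
  qed
qed

lemma Ck_on_mult:
  assumes "eopen d U" "Ck_on k d U f" "Ck_on k d U g"
  shows "Ck_on k d U (\<lambda>x. f x * g x)"
  using assms(2,3)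
proof (induction k arbitrary: f g)
  case 0
  then show ?case using assms(1) by (simp add: continuous_map_Euclidean_subtopology eopen_subset continuous_on_mult)
next
  case (Suc k)
  show ?case
  proof (rule Ck_on_SucI[OF assms(1), where g="\<lambda>i x. partial_deriv i f x * g x + f x * partial_deriv i g x"])
    show "continuous_on U (\<lambda>x. f x * g x)"
      by (intro continuous_on_mult Ck_on_continuous[OF Suc.prems(1)] Ck_on_continuous[OF Suc.prems(2)] eopen_subset assms)
    show "((\<lambda>t. f (x(i := t)) * g (x(i := t))) has_field_derivative partial_deriv i f x * g x + f x * partial_deriv i g x) (at (x i))"
      if "i < d" "x \<in> U" for i x
      by (rule DERIV_cong[OF DERIV_mult[OF Ck_on_partial[OF Suc.prems(1) that(2,1)] Ck_on_partial[OF Suc.prems(2) that(2,1)]]])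
        simp
    show "Ck_on k d U (\<lambda>x. partial_deriv i f x * g x + f x * partial_deriv i g x)" if "i < d" for i
      using Suc.IH Suc.prems that Ck_on_SucD[OF Suc.prems(1)] Ck_on_SucD[OF Suc.prems(2)]
      by (intro Ck_on_add[OF assms(1)]) auto
  qed
qed

lemma Ck_on_minus:
  assumes "eopen d U" "Ck_on k d U f" shows "Ck_on k d U (\<lambda>x. - f x)"
  using Ck_on_mult[OF assms(1) Ck_on_const[OF assms(1), of k "-1"] assms(2)] by simp

lemma Ck_on_diff:
  assumes "eopen d U" "Ck_on k d U f" "Ck_on k d U g"
  shows "Ck_on k d U (\<lambda>x. f x - g x)"
  using Ck_on_add[OF assms(1,2) Ck_on_minus[OF assms(1,3)]] by simp

lemma Ck_on_sum:
  assumes "eopen d U" "\<And>j. j \<in> J \<Longrightarrow> Ck_on k d U (f j)"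
  shows "Ck_on k d U (\<lambda>x. \<Sum>j\<in>J. f j x)"
  using assms(2)
proof (induction J rule: infinite_finite_induct)
  case (insert j J)
  have "Ck_on k d U (\<lambda>x. f j x + (\<Sum>j\<in>J. f j x))"
    by (rule Ck_on_add[OF assms(1)]) (use insert in auto)
  then show ?case using insert.hyps by simp
qed (auto simp: assms(1))

text \<open>The partial derivatives of \<open>1/f\<close> are products of \<open>1/f\<close> with
  partial derivatives of \<open>f\<close>. Hence the claim at order \<open>k\<close> for the same
  \<open>f\<close> gives the claim at order \<open>k + 1\<close>.\<close>

lemma Ck_on_inverse:
  assumes "eopen d U" "Ck_on k d U f" "\<And>x. x \<in> U \<Longrightarrow> f x \<noteq> 0"
  shows "Ck_on k d U (\<lambda>x. inverse (f x))"
  using assms(2)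
proof (induction k)
  case 0
  then show ?case using assms(1,3) by (simp add: continuous_map_Euclidean_subtopology eopen_subset continuous_on_inverse)
next
  case (Suc k)
  have IH: "Ck_on k d U (\<lambda>x. inverse (f x))" using Suc Ck_on_SucD by blast
  show ?case
  proof (rule Ck_on_SucI[OF assms(1), where g="\<lambda>i x. - (inverse (f x) * partial_deriv i f x * inverse (f x))"])
    show "continuous_on U (\<lambda>x. inverse (f x))"
      using Ck_on_continuous[OF IH] assms(1) eopen_subset by blast
    show "((\<lambda>t. inverse (f (x(i := t)))) has_field_derivative - (inverse (f x) * partial_deriv i f x * inverse (f x))) (at (x i))"
      if "i < d" "x \<in> U" for i x
      by (rule DERIV_cong[OF DERIV_inverse'[OF Ck_on_partial[OF Suc.prems that(2,1)]]]) (use assms(3)[OF that(2)] in simp_all)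
    show "Ck_on k d U (\<lambda>x. - (inverse (f x) * partial_deriv i f x * inverse (f x)))" if "i < d" for i
      using Suc.prems that IH by (intro Ck_on_minus Ck_on_mult assms(1)) auto
  qed
qed

section \<open>The mean value theorem and the chain rule\<close>

text \<open>By the mean value theorem \<open>s t\<close> is a partial derivative at an intermediate
  point, which tends to \<open>x\<close>. Both ends of the increment may move, and along any filter:
  the chain rule moves the point \<open>w t\<close> with a fixed \<open>b\<close>, and the inverse
  function theorem applies it to the points \<open>H (y(i := t))\<close>, whose differentiability is
  not yet known.\<close>

lemma partial_difference_quotient:
  fixes w :: "'t \<Rightarrow> nat \<Rightarrow> real"
  assumes V: "eopen e V" and f: "Ck_on (Suc 0) e V f" and x: "x \<in> V" and m: "m < e"
    and near: "\<And>r. r > 0 \<Longrightarrow> \<forall>\<^sub>F t in F. \<forall>j<e. \<bar>w t j - x j\<bar> < r"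
    and wE: "\<forall>\<^sub>F t in F. w t \<in> EE e"
    and b: "(b \<longlongrightarrow> x m) F"
  shows "\<exists>s. (s \<longlongrightarrow> partial_deriv m f x) F \<and> (\<forall>t. f (w t) - f ((w t)(m := b t)) = s t * (w t m - b t))"
proof -
  define a where "a = partial_deriv m f x"
  \<comment> \<open>For a zero increment the quotient is replaced by its expected limit, so that
    \<open>s\<close> converges without a case distinction on the filter.\<close>
  define s where "s t = (if w t m = b t then a else (f (w t) - f ((w t)(m := b t))) / (w t m - b t))" for t
  have pc: "continuous_on V (partial_deriv m f)"
    using f m V eopen_subset[of e V] by (auto simp: continuous_map_Euclidean_subtopology)
  have "(s \<longlongrightarrow> a) F"
  proof (rule tendstoI)
    fix r :: real assume r: "r > 0"
    obtain q where q: "q > 0" "\<forall>y\<in>EE e. (\<forall>i<e. \<bar>y i - x i\<bar> < q) \<longrightarrow> y \<in> V \<and> \<bar>partial_deriv m f y - a\<bar> < r"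
      using continuous_on_boxD[OF pc V x r] a_def by auto
    have "\<forall>\<^sub>F t in F. \<bar>b t - x m\<bar> < q"
      using tendstoD[OF b q(1)] by (simp add: dist_real_def)
    then show "\<forall>\<^sub>F t in F. dist (s t) a < r"
      using near[OF q(1)] wE
    proof eventually_elim
      case (elim t)
      \<comment> \<open>A box is convex in direction \<open>m\<close>: moving coordinate
        \<open>m\<close> between \<open>w t m\<close> and \<open>b t\<close> stays within distance
        \<open>q\<close> of \<open>x\<close>.\<close>
      have inV: "(w t)(m := u) \<in> V" "\<bar>partial_deriv m f ((w t)(m := u)) - a\<bar> < r"
        if u: "min (w t m) (b t) \<le> u" "u \<le> max (w t m) (b t)" for u
      proof -
        have "(w t)(m := u) \<in> EE e"
          using elim(3) m by (rule EE_upd)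
        moreover have "\<forall>i<e. \<bar>((w t)(m := u)) i - x i\<bar> < q"
        proof (intro allI impI)
          fix i assume "i < e"
          then have "\<bar>w t i - x i\<bar> < q" "\<bar>w t m - x m\<bar> < q" using elim(2) m by auto
          then show "\<bar>((w t)(m := u)) i - x i\<bar> < q"
            using u elim(1) by auto
        qed
        ultimately show "(w t)(m := u) \<in> V" "\<bar>partial_deriv m f ((w t)(m := u)) - a\<bar> < r"
          using q(2) by auto
      qed
      have dv: "((\<lambda>u. f ((w t)(m := u))) has_field_derivative partial_deriv m f ((w t)(m := u))) (at u)"
        if u: "min (w t m) (b t) \<le> u" "u \<le> max (w t m) (b t)" for u
        by (rule Ck_on_partial_at[OF f inV(1)[OF u] m])
      have upd: "(w t)(m := w t m) = w t" by simp
      consider "w t m = b t" | "b t < w t m" | "w t m < b t" by linarith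
      then show ?case
      proof cases
        case 1 then show ?thesis using r by (simp add: s_def)
      next
        case 2
        then obtain z where z: "b t < z" "z < w t m"
          "f ((w t)(m := w t m)) - f ((w t)(m := b t)) = (w t m - b t) * partial_deriv m f ((w t)(m := z))"
          using MVT2[of "b t" "w t m" "\<lambda>u. f ((w t)(m := u))" "\<lambda>u. partial_deriv m f ((w t)(m := u))"] dv by auto
        then have "s t = partial_deriv m f ((w t)(m := z))"
          using 2 upd by (simp add: s_def)
        then show ?thesis using inV(2)[of z] z by (simp add: dist_real_def)
      next
        case 3
        then obtain z where z: "w t m < z" "z < b t"
          "f ((w t)(m := b t)) - f ((w t)(m := w t m)) = (b t - w t m) * partial_deriv m f ((w t)(m := z))"
          using MVT2[of "w t m" "b t" "\<lambda>u. f ((w t)(m := u))" "\<lambda>u. partial_deriv m f ((w t)(m := u))"] dv by auto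
        then have "s t = partial_deriv m f ((w t)(m := z))"
          using 3 upd by (simp add: s_def divide_simps) (simp add: algebra_simps)
        then show ?thesis using inV(2)[of z] z by (simp add: dist_real_def)
      qed
    qed
  qed
  moreover have "f (w t) - f ((w t)(m := b t)) = s t * (w t m - b t)" for t
  proof (cases "w t m = b t")
    case True
    then have "(w t)(m := b t) = w t" by auto
    with True show ?thesis by simp
  next
    case False then show ?thesis by (simp add: s_def)
  qed
  ultimately show ?thesis using a_def by blast
qed

text \<open>The chain rule along a curve: change the coordinates of \<open>c t\<^sub>0\<close> into those of \<open>c t\<close> one at a time.\<close>

lemma chain_rule_curve:
  fixes c :: "real \<Rightarrow> nat \<Rightarrow> real"
  assumes V: "eopen e V" and f: "Ck_on (Suc 0) e V f" and c0: "c t0 \<in> V"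
    and cE: "\<forall>\<^sub>F t in nhds t0. c t \<in> EE e"
    and c': "\<And>j. j < e \<Longrightarrow> ((\<lambda>t. c t j) has_field_derivative c' j) (at t0)"
  shows "((\<lambda>t. f (c t)) has_field_derivative (\<Sum>j<e. partial_deriv j f (c t0) * c' j)) (at t0)"
proof -
  define mix where "mix m t = (\<lambda>j. if j < m then c t j else c t0 j)" for m t
  have c0E: "c t0 \<in> EE e" using c0 V eopen_subset by blast
  have near: "\<forall>\<^sub>F t in nhds t0. \<forall>j<e. \<bar>mix m t j - c t0 j\<bar> < r" if "r > 0" for r m
  proof -
    have "\<forall>\<^sub>F t in nhds t0. \<bar>mix m t j - c t0 j\<bar> < r" if "j < e" for j
    proof -
      have "isCont (\<lambda>t. c t j) t0" using c'[OF that] DERIV_isCont by blast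
      then have "filterlim (\<lambda>t. c t j) (nhds (c t0 j)) (nhds t0)"
        using isCont_def tendsto_at_iff_tendsto_nhds by blast
      then have "\<forall>\<^sub>F t in nhds t0. \<bar>c t j - c t0 j\<bar> < r"
        using \<open>r > 0\<close> by (auto simp: tendsto_iff dist_real_def)
      then show ?thesis by (rule eventually_mono) (use \<open>r > 0\<close> in \<open>auto simp: mix_def\<close>)
    qed
    then show ?thesis using eventually_ball_finite[of "{..<e}" "\<lambda>t j. \<bar>mix m t j - c t0 j\<bar> < r" "nhds t0"] by (simp add: Ball_def)
  qed
  have "((\<lambda>t. f (mix m t)) has_field_derivative (\<Sum>j<m. partial_deriv j f (c t0) * c' j)) (at t0)" if "m \<le> e" for m
    using that
  proof (induction m)
    case 0
    then show ?case by (simp add: mix_def)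
  next
    case (Suc m)
    then have m: "m < e" by simp
    have mS: "(mix (Suc m) t)(m := c t0 m) = mix m t" "mix (Suc m) t m = c t m" for t
      by (auto simp: mix_def less_Suc_eq)
    have "\<forall>\<^sub>F t in nhds t0. mix (Suc m) t \<in> EE e"
      using cE by (rule eventually_mono) (use c0E in \<open>auto simp: mix_def EE_iff\<close>)
    then obtain g where g: "(g \<longlongrightarrow> partial_deriv m f (c t0)) (nhds t0)"
      "\<And>t. f (mix (Suc m) t) - f (mix m t) = g t * (c t m - c t0 m)"
      using partial_difference_quotient[OF V f c0 m near[of _ "Suc m"], of "\<lambda>t. c t0 m"] mS by auto
    define D where "D t = f (mix (Suc m) t) - f (mix m t)" for t
    have "(g \<longlongrightarrow> partial_deriv m f (c t0)) (at t0)"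
      using g(1) by (rule tendsto_mono[rotated]) (simp add: at_within_def)
    moreover have "((\<lambda>t. (c t m - c t0 m) / (t - t0)) \<longlongrightarrow> c' m) (at t0)"
      using c'[OF m] by (simp add: has_field_derivative_iff)
    ultimately have "((\<lambda>t. g t * ((c t m - c t0 m) / (t - t0))) \<longlongrightarrow> partial_deriv m f (c t0) * c' m) (at t0)"
      by (rule tendsto_mult)
    then have "(D has_field_derivative partial_deriv m f (c t0) * c' m) (at t0)"
      by (simp add: has_field_derivative_iff D_def g(2))
    moreover have "((\<lambda>t. f (mix m t)) has_field_derivative (\<Sum>j<m. partial_deriv j f (c t0) * c' j)) (at t0)"
      using Suc by simp
    ultimately have "((\<lambda>t. D t + f (mix m t)) has_field_derivative partial_deriv m f (c t0) * c' m + (\<Sum>j<m. partial_deriv j f (c t0) * c' j)) (at t0)"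
      by (rule DERIV_add)
    then show ?case by (simp add: D_def add.commute)
  qed
  from this[of e] have *: "((\<lambda>t. f (mix e t)) has_field_derivative (\<Sum>j<e. partial_deriv j f (c t0) * c' j)) (at t0)"
    by simp
  have "\<forall>\<^sub>F t in nhds t0. f (c t) = f (mix e t)"
    using cE
  proof eventually_elim
    case (elim t)
    \<comment> \<open>The coordinates from \<open>e\<close> on agree because both points lie in
      \<open>EE e\<close>; this is why the equality is only claimed near \<open>t0\<close>.\<close>
    have "mix e t = c t" using elim c0E by (auto simp: mix_def EE_iff)
    then show ?case by simp
  qed
  then show ?thesis using * DERIV_cong_ev[OF refl, of "\<lambda>t. f (c t)" "\<lambda>t. f (mix e t)" t0] by simp
qed

section \<open>Smooth maps\<close>

lemma smooth_between_iff:
  "smooth_between d e U F \<longleftrightarrow> F ` U \<subseteq> EE e \<and> (\<forall>j<e. \<forall>k. Ck_on k d U (\<lambda>x. F x j))"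
  by (simp add: smooth_between_def)

lemma Ck_on_components_continuous:
  assumes "eopen d U" "F ` U \<subseteq> EE e" "\<And>j. j < e \<Longrightarrow> Ck_on k d U (\<lambda>x. F x j)"
  shows "continuous_on U F"
proof (rule continuous_on_coordinatewise_then_product)
  fix j
  show "continuous_on U (\<lambda>x. F x j)"
  proof (cases "j < e")
    case True
    then show ?thesis using assms Ck_on_continuous eopen_subset by metis
  next
    case False
    then have "F x j = 0" if "x \<in> U" for x using assms(2) that by (auto simp: EE_iff)
    then show ?thesis using continuous_on_cong[of U U "\<lambda>x. F x j" "\<lambda>x. 0"] by simp
  qed
qed

lemma chain_rule_line:
  assumes U: "eopen d U" and V: "eopen e V" and f: "Ck_on (Suc 0) e V f"
    and F: "\<And>j. j < e \<Longrightarrow> Ck_on (Suc 0) d U (\<lambda>x. F x j)" "F ` U \<subseteq> V" and x: "x \<in> U" and i: "i < d"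
  shows "((\<lambda>t. f (F (x(i := t)))) has_field_derivative
    (\<Sum>j<e. partial_deriv j f (F x) * partial_deriv i (\<lambda>x. F x j) x)) (at (x i))"
proof -
  have "\<forall>\<^sub>F t in nhds (x i). F (x(i := t)) \<in> EE e"
    using eopen_line[OF U x i] by (rule eventually_mono) (use F(2) V eopen_subset in blast)
  then show ?thesis
    using chain_rule_curve[OF V f, of "\<lambda>t. F (x(i := t))" "x i" "\<lambda>j. partial_deriv i (\<lambda>x. F x j) x"]
      Ck_on_partial[OF F(1) x i] x F(2) by auto
qed

text \<open>The chain rule writes the partial derivatives of the composite with the functions
  \<open>partial_deriv j f\<close> composed with \<open>F\<close>. These are covered by the
  induction hypothesis because \<open>f\<close> is generalized.\<close>

lemma Ck_on_compose:
  assumes U: "eopen d U" and V: "eopen e V" and f: "Ck_on k e V f"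
    and F: "\<And>j. j < e \<Longrightarrow> Ck_on k d U (\<lambda>x. F x j)" "F ` U \<subseteq> V"
  shows "Ck_on k d U (\<lambda>x. f (F x))"
  using f F(1)
proof (induction k arbitrary: f)
  case 0
  have "continuous_on U F"
    by (rule Ck_on_components_continuous[OF U _ 0(2)]) (use F(2) V eopen_subset in blast)
  moreover have "continuous_on V f" using 0(1) V Ck_on_continuous eopen_subset by blast
  ultimately have "continuous_on U (\<lambda>x. f (F x))"
    using continuous_on_compose2 F(2) by blast
  then show ?case using U by (simp add: continuous_map_Euclidean_subtopology eopen_subset)
next
  case (Suc k)
  have f1: "Ck_on (Suc 0) e V f" and F1: "\<And>j. j < e \<Longrightarrow> Ck_on (Suc 0) d U (\<lambda>x. F x j)"
    using Suc.prems Ck_on_le[of "Suc k" _ _ _ "Suc 0"] by auto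
  have Fk: "\<And>j. j < e \<Longrightarrow> Ck_on k d U (\<lambda>x. F x j)" using Suc.prems(2) Ck_on_SucD by blast
  show ?case
  proof (rule Ck_on_SucI[OF U _ chain_rule_line[OF U V f1 F1 F(2)]])
    show "continuous_on U (\<lambda>x. f (F x))"
      by (rule Ck_on_continuous[OF Suc.IH[OF Ck_on_SucD[OF Suc.prems(1)] Fk] eopen_subset[OF U]])
    show "Ck_on k d U (\<lambda>x. \<Sum>j<e. partial_deriv j f (F x) * partial_deriv i (\<lambda>x. F x j) x)" if "i < d" for i
    proof (rule Ck_on_sum[OF U], rule Ck_on_mult[OF U])
      fix j assume "j \<in> {..<e}"
      then have j: "j < e" by simp
      show "Ck_on k d U (\<lambda>x. partial_deriv j f (F x))"
        using Suc.IH[of "partial_deriv j f", OF _ Fk] Suc.prems(1) j by simp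
      show "Ck_on k d U (partial_deriv i (\<lambda>x. F x j))"
        using Suc.prems(2)[OF j] that by simp
    qed
  qed
qed

section \<open>Directional derivatives\<close>

text \<open>The directional derivative in the form used by \<open>surjective_derivative\<close>:
  linear in \<open>v\<close> by its very shape, and blind to the entries of \<open>v\<close> from
  \<open>d\<close> on.\<close>

definition Dv :: "nat \<Rightarrow> ((nat \<Rightarrow> real) \<Rightarrow> real) \<Rightarrow> (nat \<Rightarrow> real) \<Rightarrow> (nat \<Rightarrow> real) \<Rightarrow> real" where
  "Dv d f x v = (\<Sum>i<d. partial_deriv i f x * v i)"

lemma Dv_cong:
  assumes "eopen d U" "x \<in> U" "\<And>y. y \<in> U \<Longrightarrow> f y = g y"
  shows "Dv d f x v = Dv d g x v"
  unfolding Dv_def using partial_deriv_cong[OF assms(1,2) _ assms(3)] by auto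

text \<open>Only directions \<open>i < k\<close> contribute, and the lines in these directions do
  not leave \<open>EE k\<close>. This makes it possible to differentiate an identity that holds on a
  slice only, such as the horn conditions.\<close>

lemma Dv_cong_subspace:
  assumes U: "eopen d U" "x \<in> U" and x: "x \<in> EE k" and w: "w \<in> EE k"
    and eq: "\<And>y. y \<in> U \<Longrightarrow> y \<in> EE k \<Longrightarrow> f y = g y"
  shows "Dv d f x w = Dv d g x w"
  unfolding Dv_def
proof (rule sum.cong[OF refl])
  fix i assume "i \<in> {..<d}"
  then have i: "i < d" by simp
  show "partial_deriv i f x * w i = partial_deriv i g x * w i"
  proof (cases "i < k")
    case False then show ?thesis using w by (simp add: EE_iff)
  next
    case True
    have "\<forall>\<^sub>F t in nhds (x i). f (x(i := t)) = g (x(i := t))"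
      using eopen_line[OF U i] by (rule eventually_mono) (rule eq[OF _ EE_upd[OF x True]])
    then have "partial_deriv i f x = partial_deriv i g x"
      unfolding partial_deriv_def by (rule deriv_cong_ev) simp
    then show ?thesis by simp
  qed
qed

lemma Dv_compose:
  assumes "eopen d U" "eopen e V" "Ck_on (Suc 0) e V f"
    "\<And>j. j < e \<Longrightarrow> Ck_on (Suc 0) d U (\<lambda>x. F x j)" "F ` U \<subseteq> V" "x \<in> U"
  shows "Dv d (\<lambda>x. f (F x)) x v = Dv e f (F x) (\<lambda>j. Dv d (\<lambda>x. F x j) x v)"
proof -
  have "Dv d (\<lambda>x. f (F x)) x v
      = (\<Sum>i<d. (\<Sum>j<e. partial_deriv j f (F x) * partial_deriv i (\<lambda>x. F x j) x) * v i)"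
    unfolding Dv_def using partial_deriv_eqI[OF chain_rule_line[OF assms]] by auto
  also have "\<dots> = (\<Sum>j<e. \<Sum>i<d. partial_deriv j f (F x) * partial_deriv i (\<lambda>x. F x j) x * v i)"
    by (subst sum.swap) (simp add: sum_distrib_right)
  also have "\<dots> = Dv e f (F x) (\<lambda>j. Dv d (\<lambda>x. F x j) x v)"
    by (simp add: Dv_def sum_distrib_left mult.assoc)
  finally show ?thesis .
qed

lemma Dv_coord:
  assumes "v \<in> EE d" shows "Dv d (\<lambda>x. x j) x v = v j"
proof -
  have "partial_deriv i (\<lambda>x. x j) x = (if i = j then 1 else 0)" for i
    by (rule partial_deriv_eqI) auto
  then have "Dv d (\<lambda>x. x j) x v = (\<Sum>i<d. if i = j then v j else 0)"
    unfolding Dv_def by (intro sum.cong) auto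
  then show ?thesis using assms by (simp add: EE_iff)
qed

lemma Dv_add: "Dv d f x (\<lambda>i. v i + w i) = Dv d f x v + Dv d f x w"
  by (simp add: Dv_def sum.distrib distrib_left)

lemma Dv_diff:
  assumes "Ck_on (Suc 0) d U f" "Ck_on (Suc 0) d U g" "x \<in> U"
  shows "Dv d (\<lambda>x. f x - g x) x v = Dv d f x v - Dv d g x v"
proof -
  have "partial_deriv i (\<lambda>x. f x - g x) x = partial_deriv i f x - partial_deriv i g x" if "i < d" for i
    by (rule partial_deriv_eqI[OF DERIV_diff[OF Ck_on_partial[OF assms(1,3) that] Ck_on_partial[OF assms(2,3) that]]])
  then show ?thesis unfolding Dv_def by (simp add: sum_subtractf[symmetric] left_diff_distrib)
qed

lemma surjective_derivative_iff:
  "surjective_derivative d e F x \<longleftrightarrow> (\<forall>w\<in>EE e. \<exists>v\<in>EE d. \<forall>j<e. Dv d (\<lambda>y. F y j) x v = w j)"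
  by (simp add: surjective_derivative_def Dv_def)

lemma smooth_between_preimage:
  assumes "eopen d U" "eopen e V" "smooth_between d e U F"
  shows "eopen d {x \<in> U. F x \<in> V}"
proof -
  have F: "F ` U \<subseteq> EE e" "continuous_on U F"
    using assms by (auto simp: smooth_between_iff simp del: Ck_on.simps intro!: Ck_on_components_continuous[of d U F e 0])
  have "openin (top_of_set (EE e)) V" using assms(2) by (simp add: Euclidean_space_eq_top_of_set)
  then have "openin (top_of_set U) (U \<inter> F -` V)"
    using continuous_openin_preimage[OF F(2), of "EE e" V] F(1) by blast
  moreover have "openin (top_of_set (EE d)) U" using assms(1) by (simp add: Euclidean_space_eq_top_of_set)
  ultimately have "openin (top_of_set (EE d)) (U \<inter> F -` V)" by (rule openin_trans)
  moreover have "U \<inter> F -` V = {x \<in> U. F x \<in> V}" by blast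
  ultimately show ?thesis by (simp add: Euclidean_space_eq_top_of_set)
qed

lemma smooth_between_compose:
  assumes "eopen d U" "eopen e V" "smooth_between d e U F" "F ` U \<subseteq> V" "smooth_between e g V G"
  shows "smooth_between d g U (\<lambda>x. G (F x))"
proof -
  have "Ck_on k d U (\<lambda>x. G (F x) j)" if "j < g" for j k
    by (rule Ck_on_compose[OF assms(1,2)]) (use assms that in \<open>auto simp: smooth_between_iff\<close>)
  moreover have "G (F x) \<in> EE g" if "x \<in> U" for x
    using assms(4,5) that unfolding smooth_between_iff by blast
  ultimately show ?thesis by (auto simp: smooth_between_iff)
qed

lemma smooth_between_subset: "smooth_between d e U F \<Longrightarrow> V \<subseteq> U \<Longrightarrow> smooth_between d e V F"
  by (auto simp: smooth_between_iff intro: Ck_on_subset[of _ _ U])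

lemma smooth_between_cong:
  assumes "eopen d U" "smooth_between d e U F" "\<And>x. x \<in> U \<Longrightarrow> F x = G x"
  shows "smooth_between d e U G"
proof -
  have "Ck_on k d U (\<lambda>x. G x j)" if "j < e" for j k
    by (rule Ck_on_cong[OF assms(1), of "\<lambda>x. F x j"]) (use assms that in \<open>auto simp: smooth_between_iff\<close>)
  moreover have "G x \<in> EE e" if "x \<in> U" for x
    using assms(2) assms(3)[OF that, symmetric] that by (auto simp: smooth_between_iff)
  ultimately show ?thesis by (auto simp: smooth_between_iff)
qed

lemma smooth_between_local:
  assumes "\<And>x. x \<in> U \<Longrightarrow> \<exists>V. eopen d V \<and> x \<in> V \<and> smooth_between d e V F"
  shows "smooth_between d e U F"
  unfolding smooth_between_iff
proof (intro conjI allI impI)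
  show "F ` U \<subseteq> EE e"
  proof
    fix y assume "y \<in> F ` U"
    then obtain x where x: "x \<in> U" "y = F x" by blast
    from assms[OF x(1)] obtain V where "x \<in> V" "smooth_between d e V F" by blast
    then show "y \<in> EE e" using x(2) by (auto simp: smooth_between_iff)
  qed
  show "Ck_on k d U (\<lambda>x. F x j)" if "j < e" for j k
  proof (rule Ck_on_local)
    fix x assume "x \<in> U"
    from assms[OF this] obtain V where "eopen d V" "x \<in> V" "smooth_between d e V F" by blast
    then show "\<exists>V. eopen d V \<and> x \<in> V \<and> Ck_on k d V (\<lambda>x. F x j)"
      using that by (intro exI[of _ V]) (simp add: smooth_between_iff)
  qed
qed

lemma smooth_between_id: "eopen d U \<Longrightarrow> smooth_between d d U (\<lambda>x. x)"
  using eopen_subset[of d U] by (auto simp: smooth_between_iff)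

section \<open>Local diffeomorphisms\<close>

definition diffeo ::
  "nat \<Rightarrow> (nat \<Rightarrow> real) set \<Rightarrow> (nat \<Rightarrow> real) set \<Rightarrow> ((nat \<Rightarrow> real) \<Rightarrow> nat \<Rightarrow> real) \<Rightarrow> ((nat \<Rightarrow> real) \<Rightarrow> nat \<Rightarrow> real) \<Rightarrow> bool" where
  "diffeo d U V G H \<longleftrightarrow>
     eopen d U \<and> eopen d V \<and> G ` U \<subseteq> V \<and> H ` V \<subseteq> U \<and> (\<forall>x\<in>U. H (G x) = x) \<and> (\<forall>y\<in>V. G (H y) = y) \<and>
     smooth_between d d U G \<and> smooth_between d d V H"

lemma diffeo_compose:
  assumes "diffeo d U V G H" "diffeo d U' V' G' H'"
  shows "diffeo d {x \<in> U. G x \<in> U'} {y \<in> V'. H' y \<in> V} (\<lambda>x. G' (G x)) (\<lambda>y. H (H' y))"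
proof -
  have o1: "eopen d {x \<in> U. G x \<in> U'}" "eopen d {y \<in> V'. H' y \<in> V}"
    using assms by (auto simp: diffeo_def intro: smooth_between_preimage)
  have s1: "smooth_between d d {x \<in> U. G x \<in> U'} (\<lambda>x. G' (G x))"
    by (rule smooth_between_compose[OF o1(1), of d U'])
      (use assms in \<open>auto simp: diffeo_def intro: smooth_between_subset[of d d U G]\<close>)
  have s2: "smooth_between d d {y \<in> V'. H' y \<in> V} (\<lambda>y. H (H' y))"
    by (rule smooth_between_compose[OF o1(2), of d V])
      (use assms in \<open>auto simp: diffeo_def intro: smooth_between_subset[of d d V' H']\<close>)
  have "G ` U \<subseteq> V" "H ` V \<subseteq> U" "\<And>x. x \<in> U \<Longrightarrow> H (G x) = x" "\<And>y. y \<in> V \<Longrightarrow> G (H y) = y"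
    "G' ` U' \<subseteq> V'" "H' ` V' \<subseteq> U'" "\<And>x. x \<in> U' \<Longrightarrow> H' (G' x) = x" "\<And>y. y \<in> V' \<Longrightarrow> G' (H' y) = y"
    using assms by (auto simp: diffeo_def)
  then show ?thesis
    unfolding diffeo_def using o1 s1 s2 by (simp add: image_subset_iff)
qed

text \<open>Meant for two maps: the sign change of one coordinate and the exchange of two
  coordinates.\<close>

lemma linear_involution_diffeo:
  assumes "\<And>y. y \<in> EE d \<Longrightarrow> T y \<in> EE d" "\<And>y. y \<in> EE d \<Longrightarrow> T (T y) = y"
    and "\<And>j. j < d \<Longrightarrow> \<exists>i c. \<forall>y. T y j = c * y i"
  shows "diffeo d (EE d) (EE d) T T"
proof -
  have o: "eopen d (EE d)" using openin_topspace[of "Euclidean_space d"] by simp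
  have "Ck_on k d (EE d) (\<lambda>y. T y j)" if j: "j < d" for j k
  proof -
    obtain i c where "\<And>y. T y j = c * y i" using assms(3)[OF j] by blast
    then show ?thesis using o by (simp add: Ck_on_mult)
  qed
  then show ?thesis using o assms by (auto simp: diffeo_def smooth_between_iff)
qed

section \<open>The inverse function theorem, one coordinate at a time\<close>

text \<open>On a box where the partial derivative is positive, \<open>g\<close> increases strictly
  along coordinate \<open>l\<close>. Monotonicity makes the map \<open>K\<close> injective, and the
  intermediate value theorem makes its image open and its inverse continuous. Implicit
  differentiation then gives the partial derivatives of the inverse.\<close>

lemma coordinate_change_pos:
  assumes U0: "eopen d U0" and g: "\<And>k. Ck_on k d U0 g" and z: "z \<in> U0" and l: "l < d"
    and pos: "partial_deriv l g z > 0"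
  shows "\<exists>U V H. z \<in> U \<and> U \<subseteq> U0 \<and> diffeo d U V (\<lambda>x. x(l := g x)) H"
proof -
  define p where "p = partial_deriv l g"
  define K where "K x = x(l := g x)" for x
  have g1: "Ck_on (Suc 0) d U0 g" by (rule g)
  have pc: "Ck_on k d U0 (partial_deriv i g)" if "i < d" for i k
    using g[of "Suc k"] that by simp
  have pcont: "continuous_on U0 p"
    using pc[OF l, of 0] Ck_on_continuous eopen_subset[OF U0] p_def by metis
  \<comment> \<open>With tolerance \<open>p z\<close> the values of \<open>p\<close> on the box stay
    positive.\<close>
  obtain e where e: "e > 0" "\<forall>y\<in>EE d. (\<forall>i<d. \<bar>y i - z i\<bar> < e) \<longrightarrow> y \<in> U0 \<and> \<bar>p y - p z\<bar> < p z"
    using continuous_on_boxD[OF pcont U0 z, of "p z"] pos p_def by auto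
  define B where "B = {y \<in> EE d. \<forall>i<d. \<bar>y i - z i\<bar> < e}"
  have Bo: "eopen d B" unfolding B_def by (rule eopen_box)
  have BU: "B \<subseteq> U0" and Bp: "\<And>x. x \<in> B \<Longrightarrow> p x > 0" using e(2) by (force simp: B_def)+
  have BE: "B \<subseteq> EE d" by (auto simp: B_def)
  have zB: "z \<in> B" using e(1) z U0 eopen_subset by (force simp: B_def)
  \<comment> \<open>Segments in direction \<open>l\<close> with end points in the box stay in the
    box, so the mean and intermediate value arguments may be applied on them.\<close>
  have between: "x(l := u) \<in> B" if "x(l := a) \<in> B" "x(l := b) \<in> B" "a \<le> u" "u \<le> b" for x a b u
  proof -
    have "x(l := u) \<in> EE d" using that(1) l by (auto simp: B_def EE_iff)
    moreover have "\<bar>(x(l := u)) i - z i\<bar> < e" if "i < d" for i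
    proof (cases "i = l")
      case True
      have "\<bar>a - z l\<bar> < e" "\<bar>b - z l\<bar> < e" using \<open>x(l := a) \<in> B\<close> \<open>x(l := b) \<in> B\<close> l by (auto simp: B_def)
      then show ?thesis using True \<open>a \<le> u\<close> \<open>u \<le> b\<close> by simp
    next
      case False
      then show ?thesis using \<open>x(l := a) \<in> B\<close> that by (auto simp: B_def)
    qed
    ultimately show ?thesis by (simp add: B_def)
  qed
  have gline: "((\<lambda>t. g (x(l := t))) has_field_derivative p (x(l := u))) (at u)" if "x(l := u) \<in> B" for x u
    unfolding p_def by (rule Ck_on_partial_at[OF g1 _ l]) (use that BU in blast)
  have mono: "g (x(l := a)) < g (x(l := b))" if "x(l := a) \<in> B" "x(l := b) \<in> B" "a < b" for x a b
    by (rule DERIV_pos_imp_increasing[OF \<open>a < b\<close>]) (use gline between[OF that(1,2)] Bp in blast)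
  have inj: "inj_on K B"
  proof (rule inj_onI)
    fix x x' assume x: "x \<in> B" "x' \<in> B" "K x = K x'"
    have eq: "x' = x(l := x' l)" using x(3) by (auto simp: K_def fun_eq_iff split: if_splits)
    have geq: "g x = g x'" using fun_cong[OF x(3), of l] by (simp add: K_def)
    have "\<not> x l < x' l" using mono[of x "x l" "x' l"] x eq geq by auto
    moreover have "\<not> x' l < x l" using mono[of x "x' l" "x l"] x eq geq by auto
    ultimately show "x = x'" using eq by (metis fun_upd_triv linorder_neqE)
  qed
  \<comment> \<open>Solvability of \<open>K (y(l := u)) = y\<close> for all \<open>y\<close> near
    \<open>K x\<close>, with \<open>u\<close> close to \<open>x l\<close>: this contains both the
    openness of the image and the continuity of the inverse.\<close>
  have local_solution: "\<exists>r>0. \<forall>y\<in>EE d. (\<forall>i<d. \<bar>y i - K x i\<bar> < r) \<longrightarrow>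
      (\<exists>u. \<bar>u - x l\<bar> < \<delta> \<and> y(l := u) \<in> B \<and> g (y(l := u)) = y l)" if x: "x \<in> B" and \<delta>: "\<delta> > 0" for x \<delta>
  proof -
    obtain e3 where e3: "e3 > 0" "\<forall>y\<in>EE d. (\<forall>i<d. \<bar>y i - x i\<bar> < e3) \<longrightarrow> y \<in> B"
      using Bo x unfolding eopen_iff_box by blast
    have xE: "x \<in> EE d" using x BE by blast
    define \<epsilon> where "\<epsilon> = min \<delta> e3 / 2"
    define a b where "a = x l - \<epsilon>" and "b = x l + \<epsilon>"
    have ab: "\<epsilon> > 0" "a < x l" "x l < b" "\<epsilon> < \<delta>" "\<epsilon> < e3" using \<delta> e3(1) by (auto simp: \<epsilon>_def a_def b_def)
    have xa: "x(l := a) \<in> B" and xb: "x(l := b) \<in> B"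
      using e3 ab xE l by (auto simp: a_def b_def EE_upd)
    have ga: "g (x(l := a)) < g x" using mono[OF xa, of "x l"] x ab by simp
    have gb: "g x < g (x(l := b))" using mono[OF _ xb, of "x l"] x ab by simp
    have gcont: "continuous_on B g"
      using Ck_on_continuous[OF g1 eopen_subset[OF U0]] BU continuous_on_subset by blast
    \<comment> \<open>Half of the smaller gap: it has to absorb two errors below \<open>r\<close>,
      that of \<open>g\<close> at the end point and that of \<open>y l\<close> against
      \<open>g x\<close>.\<close>
    define r where "r = min (g x - g (x(l := a))) (g (x(l := b)) - g x) / 2"
    have r: "r > 0" using ga gb by (simp add: r_def)
    have r2: "2 * r \<le> g x - g (x(l := a))" "2 * r \<le> g (x(l := b)) - g x" by (simp_all add: r_def)
    obtain e1 where e1: "e1 > 0" "\<forall>y\<in>EE d. (\<forall>i<d. \<bar>y i - (x(l := a)) i\<bar> < e1) \<longrightarrow> y \<in> B \<and> \<bar>g y - g (x(l := a))\<bar> < r"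
      using continuous_on_boxD[OF gcont Bo xa r] by blast
    obtain e2 where e2: "e2 > 0" "\<forall>y\<in>EE d. (\<forall>i<d. \<bar>y i - (x(l := b)) i\<bar> < e2) \<longrightarrow> y \<in> B \<and> \<bar>g y - g (x(l := b))\<bar> < r"
      using continuous_on_boxD[OF gcont Bo xb r] by blast
    show ?thesis
    proof (rule exI[of _ "min r (min e1 e2)"], intro conjI ballI impI)
      show "min r (min e1 e2) > 0" using r e1 e2 by simp
      fix y assume y: "y \<in> EE d" "\<forall>i<d. \<bar>y i - K x i\<bar> < min r (min e1 e2)"
      have yl: "\<bar>y l - g x\<bar> < r" using y(2) l by (auto simp: K_def)
      have yi: "\<bar>y i - x i\<bar> < min e1 e2" if "i < d" "i \<noteq> l" for i using y(2) that by (auto simp: K_def)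
      have ya: "y(l := a) \<in> B" "\<bar>g (y(l := a)) - g (x(l := a))\<bar> < r"
        using e1 yi EE_upd[OF y(1) l, of a] by auto
      have yb: "y(l := b) \<in> B" "\<bar>g (y(l := b)) - g (x(l := b))\<bar> < r"
        using e2 yi EE_upd[OF y(1) l, of b] by auto
      have "g (y(l := a)) \<le> y l" "y l \<le> g (y(l := b))"
        using ya(2) yb(2) yl r2 by linarith+
      moreover have "continuous_on {a..b} (\<lambda>u. g (y(l := u)))"
        by (rule DERIV_continuous_on[where D="\<lambda>u. p (y(l := u))"], rule has_field_derivative_at_within, rule gline)
          (use between[OF ya(1) yb(1)] in auto)
      ultimately obtain u where u: "a \<le> u" "u \<le> b" "g (y(l := u)) = y l"
        using IVT'[of "\<lambda>u. g (y(l := u))" a "y l" b] ab by auto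
      show "\<exists>u. \<bar>u - x l\<bar> < \<delta> \<and> y(l := u) \<in> B \<and> g (y(l := u)) = y l"
        using u between[OF ya(1) yb(1) u(1,2)] ab by (intro exI[of _ u]) (auto simp: a_def b_def)
    qed
  qed
  define V where "V = K ` B"
  define H where "H = inv_into B K"
  define h where "h y = H y l" for y
  have KE: "K x \<in> EE d" if "x \<in> B" for x using that BE l by (auto simp: K_def EE_upd)
  have HB: "H y \<in> B" and KH: "K (H y) = y" if "y \<in> V" for y
    using that by (auto simp: V_def H_def inv_into_into f_inv_into_f)
  have HK: "H (K x) = x" if "x \<in> B" for x using that inj by (simp add: H_def)
  have Hh: "H y = y(l := h y)" and gH: "g (H y) = y l" if "y \<in> V" for y
  proof -
    have "(H y)(l := g (H y)) = y" using KH[OF that] by (simp add: K_def)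
    then show "H y = y(l := h y)" "g (H y) = y l"
      by (metis fun_upd_triv fun_upd_upd h_def, metis fun_upd_same)
  qed
  have near: "\<exists>r>0. \<forall>y\<in>EE d. (\<forall>i<d. \<bar>y i - y0 i\<bar> < r) \<longrightarrow> y \<in> V \<and> \<bar>h y - h y0\<bar> < \<delta>"
    if y0: "y0 \<in> V" and "\<delta> > 0" for y0 \<delta>
  proof -
    obtain r where r: "r > 0" "\<forall>y\<in>EE d. (\<forall>i<d. \<bar>y i - y0 i\<bar> < r) \<longrightarrow>
      (\<exists>u. \<bar>u - h y0\<bar> < \<delta> \<and> y(l := u) \<in> B \<and> g (y(l := u)) = y l)"
      using local_solution[OF HB[OF y0] \<open>\<delta> > 0\<close>] KH[OF y0] h_def by auto
    have "y \<in> V \<and> \<bar>h y - h y0\<bar> < \<delta>" if y: "y \<in> EE d" "\<forall>i<d. \<bar>y i - y0 i\<bar> < r" for y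
    proof -
      obtain u where u: "\<bar>u - h y0\<bar> < \<delta>" "y(l := u) \<in> B" "g (y(l := u)) = y l"
        using r(2) y by blast
      have "K (y(l := u)) = y" using u(3) by (simp add: K_def)
      then have "y \<in> V" "H y = y(l := u)" using u(2) HK[OF u(2)] imageI[OF u(2), of K] by (simp_all add: V_def)
      then show ?thesis using u(1) by (simp add: h_def)
    qed
    then show ?thesis using r(1) by blast
  qed
  have VE: "V \<subseteq> EE d" using KE by (auto simp: V_def)
  have Vo: "eopen d V"
    unfolding eopen_iff_box using near[of _ 1] VE by (metis zero_less_one)
  have hcont: "continuous_on V h"
    using near VE by (intro continuous_on_boxI[where d=d]) (meson in_mono)
  \<comment> \<open>Implicit differentiation of \<open>g (y(l := h y)) = y l\<close>: the right side
    contributes 1 exactly in direction \<open>l\<close>, the left side contributes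
    \<open>partial_deriv i g\<close> in the other directions, and the coefficient of the derivative
    of \<open>h\<close> is \<open>p\<close>.\<close>
  define h' where "h' i y = ((if i = l then 1 else 0) - (if i = l then 0 else partial_deriv i g (H y))) * inverse (p (H y))" for i y
  have hderiv: "((\<lambda>t. h (y(i := t))) has_field_derivative h' i y) (at (y i))" if i: "i < d" and y: "y \<in> V" for i y
  proof -
    have Vev: "\<forall>\<^sub>F t in nhds (y i). y(i := t) \<in> V" by (rule eopen_line[OF Vo y i])
    have "isCont (\<lambda>t. h (y(i := t))) (y i)" 
      unfolding isCont_def
    proof (rule tendstoI)
      fix \<delta> :: real assume "\<delta> > 0"
      then obtain r where r: "r > 0" "\<forall>y'\<in>EE d. (\<forall>i<d. \<bar>y' i - y i\<bar> < r) \<longrightarrow> y' \<in> V \<and> \<bar>h y' - h y\<bar> < \<delta>"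
        using near[OF y] by blast
      have "y \<in> EE d" using y VE by blast
      then have "\<bar>h (y(i := t)) - h y\<bar> < \<delta>" if "\<bar>t - y i\<bar> < r" for t
        using r that i by (auto simp: EE_upd)
      then show "\<forall>\<^sub>F t in at (y i). dist (h (y(i := t))) (h (y(i := y i))) < \<delta>"
        using r(1) unfolding eventually_at by (auto simp: dist_real_def)
    qed
    then have hc: "((\<lambda>t. h (y(i := t))) \<longlongrightarrow> h y) (nhds (y i))"
      using tendsto_at_iff_tendsto_nhds[of "\<lambda>t. h (y(i := t))" "y i"] by (simp add: isCont_def)
    have nearH: "\<forall>\<^sub>F t in nhds (y i). \<forall>j<d. \<bar>H (y(i := t)) j - H y j\<bar> < r" if "r > 0" for r
    proof -
      have "\<forall>\<^sub>F t in nhds (y i). \<bar>h (y(i := t)) - h y\<bar> < r"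
        using tendstoD[OF hc that] by (simp add: dist_real_def)
      moreover have "\<forall>\<^sub>F t in nhds (y i). \<bar>t - y i\<bar> < r"
        using that eventually_nhds_metric[of "\<lambda>t. \<bar>t - y i\<bar> < r" "y i"] by (auto simp: dist_real_def)
      ultimately show ?thesis using Vev
      proof eventually_elim
        case (elim t)
        then show ?case using Hh[OF elim(3)] Hh[OF y] that by auto
      qed
    qed
    have HE: "\<forall>\<^sub>F t in nhds (y i). H (y(i := t)) \<in> EE d"
      using Vev by (rule eventually_mono) (use HB BE in blast)
    have hyl: "((\<lambda>t. h y) \<longlongrightarrow> H y l) (nhds (y i))" by (simp add: h_def)
    \<comment> \<open>The part of the increment of \<open>g\<close> caused by moving coordinate
      \<open>l\<close> from \<open>h y\<close> to \<open>h (y(i := t))\<close>. Its factor tends to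
      \<open>p (H y)\<close> by continuity of \<open>h\<close> alone.\<close>
    obtain s where s: "(s \<longlongrightarrow> p (H y)) (nhds (y i))"
      "\<And>t. g (H (y(i := t))) - g ((H (y(i := t)))(l := h y)) = s t * (h (y(i := t)) - h y)"
      using partial_difference_quotient[OF Bo Ck_on_subset[OF g1 BU] HB[OF y] l nearH HE hyl] p_def h_def by metis
    have s': "(s \<longlongrightarrow> p (H y)) (at (y i))"
      using s(1) by (rule tendsto_mono[rotated]) (simp add: at_within_def)
    have pne: "p (H y) \<noteq> 0" using Bp[OF HB[OF y]] by simp
    \<comment> \<open>The remaining part of the increment, caused by moving coordinate
      \<open>i\<close>; for \<open>i = l\<close> there is none.\<close>
    define Q where "Q t = (if i = l then 0 else (g ((H y)(i := t)) - g (H y)) / (t - y i))" for t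
    have Q: "(Q \<longlongrightarrow> (if i = l then 0 else partial_deriv i g (H y))) (at (y i))"
    proof (cases "i = l")
      case True then show ?thesis by (simp add: Q_def[abs_def])
    next
      case False
      have "H y i = y i" using Hh[OF y] False by (metis fun_upd_other)
      moreover have "((\<lambda>t. g ((H y)(i := t))) has_field_derivative partial_deriv i g (H y)) (at (H y i))"
        by (rule Ck_on_partial[OF g1 _ i]) (use HB[OF y] BU in blast)
      ultimately show ?thesis using False by (simp add: Q_def[abs_def] has_field_derivative_iff fun_upd_idem)
    qed
    have "((\<lambda>t. ((if i = l then 1 else 0) - Q t) * inverse (s t)) \<longlongrightarrow> h' i y) (at (y i))"
      unfolding h'_def by (intro tendsto_mult tendsto_diff tendsto_const Q tendsto_inverse s' pne)
    moreover have "\<forall>\<^sub>F t in at (y i). ((if i = l then 1 else 0) - Q t) * inverse (s t) = (h (y(i := t)) - h y) / (t - y i)"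
    proof -
      have "\<forall>\<^sub>F t in at (y i). s t \<noteq> 0" using tendsto_imp_eventually_ne[OF s' pne] .
      moreover have "\<forall>\<^sub>F t in at (y i). y(i := t) \<in> V" using Vev by (simp add: eventually_nhds_conv_at)
      moreover have "\<forall>\<^sub>F t in at (y i). t \<noteq> y i" by (rule eventually_neq_at_within)
      ultimately show ?thesis
      proof eventually_elim
        case (elim t)
        show ?case
        proof (cases "i = l")
          case True
          have "(H (y(i := t)))(l := h y) = H y" using Hh[OF elim(2)] Hh[OF y] True by (metis fun_upd_upd)
          then have "t - y l = s t * (h (y(i := t)) - h y)"
            using s(2)[of t] gH[OF elim(2)] gH[OF y] True by simp
          then have "h (y(i := t)) - h y = (t - y l) / s t" using elim by simp
          then show ?thesis using elim True by (simp add: Q_def divide_inverse)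
        next
          case False
          have "(H (y(i := t)))(l := h y) = (H y)(i := t)"
            using Hh[OF elim(2)] Hh[OF y] False by (metis fun_upd_upd fun_upd_twist)
          then have "g (H y) - g ((H y)(i := t)) = s t * (h (y(i := t)) - h y)"
            using s(2)[of t] gH[OF elim(2)] gH[OF y] False by simp
          then have "h (y(i := t)) - h y = - (g ((H y)(i := t)) - g (H y)) / s t" using elim by simp
          then show ?thesis using False by (simp add: Q_def divide_inverse del: minus_diff_eq)
        qed
      qed
    qed
    ultimately have "((\<lambda>t. (h (y(i := t)) - h y) / (t - y i)) \<longlongrightarrow> h' i y) (at (y i))"
      by (rule Lim_transform_eventually)
    then show ?thesis by (simp add: has_field_derivative_iff)
  qed
  \<comment> \<open>Bootstrapping: \<open>h'\<close> is built from \<open>H\<close> and smooth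
    functions, and \<open>H\<close> differs from the identity only in \<open>h\<close>. So order
    \<open>k\<close> for \<open>h\<close> gives order \<open>k\<close> for \<open>h'\<close>, hence
    order \<open>k + 1\<close> for \<open>h\<close>.\<close>
  have hk: "Ck_on k d V h" for k
  proof (induction k)
    case 0
    then show ?case using hcont VE by (simp add: continuous_map_Euclidean_subtopology)
  next
    case (Suc k)
    have Hk: "Ck_on k d V (\<lambda>y. H y j)" for j
    proof (cases "j = l")
      case True then show ?thesis using Suc by (simp add: h_def[abs_def])
    next
      case False
      show ?thesis by (rule Ck_on_cong[OF Vo _ Ck_on_coord[OF Vo, of k j]]) (metis False Hh fun_upd_other)
    qed
    have comp: "Ck_on k d V (\<lambda>y. q (H y))" if "Ck_on k d U0 q" for q
      by (rule Ck_on_compose[OF Vo Bo Ck_on_subset[OF that BU] Hk]) (use HB in blast)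
    show ?case
    proof (rule Ck_on_SucI[OF Vo hcont hderiv])
      show "Ck_on k d V (h' i)" if "i < d" for i
      proof -
        have "Ck_on k d V (\<lambda>y. if i = l then 0 else partial_deriv i g (H y))"
          using comp[OF pc[OF that]] Vo by (cases "i = l") auto
        moreover have "Ck_on k d V (\<lambda>y. inverse (p (H y)))"
          by (rule Ck_on_inverse[OF Vo]) (use comp[OF pc[OF l]] Bp HB p_def in fastforce)+
        ultimately show ?thesis
          unfolding h'_def[abs_def] by (intro Ck_on_mult[OF Vo] Ck_on_diff[OF Vo] Ck_on_const[OF Vo])
      qed
    qed
  qed
  have sK: "smooth_between d d B K"
    unfolding smooth_between_iff
  proof (intro conjI allI impI)
    show "K ` B \<subseteq> EE d" using KE by blast
    show "Ck_on k d B (\<lambda>x. K x j)" if "j < d" for j k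
      using Ck_on_subset[OF g BU] Bo by (cases "j = l") (auto simp: K_def)
  qed
  have sH: "smooth_between d d V H"
    unfolding smooth_between_iff
  proof (intro conjI allI impI)
    show "H ` V \<subseteq> EE d" using HB BE by blast
    show "Ck_on k d V (\<lambda>x. H x j)" if "j < d" for j k
    proof (cases "j = l")
      case True then show ?thesis using hk by (simp add: h_def[abs_def])
    next
      case False
      show ?thesis by (rule Ck_on_cong[OF Vo _ Ck_on_coord[OF Vo, of k j]]) (metis False Hh fun_upd_other)
    qed
  qed
  have "diffeo d B V K H"
    unfolding diffeo_def using Bo Vo HB HK KH sK sH by (auto simp: V_def)
  then show ?thesis using zB BU unfolding K_def[abs_def] by blast
qed

text \<open>A negative partial derivative is reduced to the positive case by passing to
  \<open>- g\<close> and composing with the reflection of coordinate \<open>l\<close>.\<close>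

lemma coordinate_change:
  assumes U0: "eopen d U0" and g: "\<And>k. Ck_on k d U0 g" and z: "z \<in> U0" and l: "l < d"
    and nz: "partial_deriv l g z \<noteq> 0"
  shows "\<exists>U V H. z \<in> U \<and> U \<subseteq> U0 \<and> diffeo d U V (\<lambda>x. x(l := g x)) H"
proof (cases "partial_deriv l g z > 0")
  case True
  then show ?thesis using coordinate_change_pos[OF U0 g z l] by blast
next
  case False
  have "partial_deriv l (\<lambda>x. - g x) z = - partial_deriv l g z"
    by (rule partial_deriv_eqI[OF DERIV_minus[OF Ck_on_partial[OF g z l]]])
  then have "partial_deriv l (\<lambda>x. - g x) z > 0" using False nz by simp
  then obtain U V H where D: "z \<in> U" "U \<subseteq> U0" "diffeo d U V (\<lambda>x. x(l := - g x)) H"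
    using coordinate_change_pos[OF U0 Ck_on_minus[OF U0 g] z l] by blast
  define R where "R y = y(l := - y l)" for y :: "nat \<Rightarrow> real"
  have "diffeo d (EE d) (EE d) R R"
  proof (rule linear_involution_diffeo)
    show "\<exists>i c. \<forall>y. R y j = c * y i" for j
      by (rule exI[of _ j], rule exI[of _ "if j = l then -1 else 1"]) (simp add: R_def)
  qed (auto simp: R_def EE_upd l)
  from diffeo_compose[OF D(3) this]
  have D': "diffeo d {x \<in> U. x(l := - g x) \<in> EE d} {y \<in> EE d. R y \<in> V} (\<lambda>x. x(l := g x)) (\<lambda>y. H (R y))"
    by (simp add: R_def)
  have "z(l := - g z) \<in> EE d" using D by (auto simp: diffeo_def smooth_between_iff)
  then have "z \<in> {x \<in> U. x(l := - g x) \<in> EE d}" "{x \<in> U. x(l := - g x) \<in> EE d} \<subseteq> U0"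
    using D(1,2) by auto
  then show ?thesis using D' by (intro exI conjI)
qed

text \<open>Straightening: one component of \<open>f\<close> at a time becomes a coordinate. After \<open>q\<close> steps the vector
  realizing the next component has to involve one of the first \<open>d - q\<close> coordinates, which is swapped
  into position \<open>d - 1 - q\<close>.\<close>

lemma straighten:
  fixes f :: "(nat \<Rightarrow> real) \<Rightarrow> nat \<Rightarrow> real"
  assumes O: "eopen d U0" and z: "z \<in> U0" and f: "\<And>j k. j < q \<Longrightarrow> Ck_on k d U0 (\<lambda>x. f x j)"
    and surj: "surjective_derivative d q f z"
  shows "q \<le> d \<and> (\<exists>U V G H. z \<in> U \<and> U \<subseteq> U0 \<and> diffeo d U V G H \<and> (\<forall>x\<in>U. \<forall>j<q. G x (d - 1 - j) = f x j))"
  using f surj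
proof (induction q)
  case 0
  have "diffeo d U0 U0 (\<lambda>x. x) (\<lambda>x. x)" using O smooth_between_id by (simp add: diffeo_def)
  then show ?case using z by blast
next
  case (Suc q)
  have "surjective_derivative d q f z"
    unfolding surjective_derivative_iff
  proof
    fix w assume "w \<in> EE q"
    then have "w \<in> EE (Suc q)" by (simp add: EE_iff)
    then show "\<exists>v\<in>EE d. \<forall>j<q. Dv d (\<lambda>y. f y j) z v = w j"
      using Suc.prems(2) unfolding surjective_derivative_iff by (meson less_SucI)
  qed
  then obtain U V G H where q: "q \<le> d" and U: "z \<in> U" "U \<subseteq> U0" and D: "diffeo d U V G H"
    and Gf: "\<And>x j. x \<in> U \<Longrightarrow> j < q \<Longrightarrow> G x (d - 1 - j) = f x j"
    using Suc.IH Suc.prems(1) by (meson less_SucI)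
  have Uo: "eopen d U" and Vo: "eopen d V" and GU: "G ` U \<subseteq> V" and HV: "H ` V \<subseteq> U"
    and HG: "\<And>x. x \<in> U \<Longrightarrow> H (G x) = x" and sG: "smooth_between d d U G" and sH: "smooth_between d d V H"
    using D by (auto simp: diffeo_def)
  \<comment> \<open>The next component of \<open>f\<close>, read in the coordinates straightened so
    far.\<close>
  define F where "F y = f (H y) q" for y
  have Fk: "Ck_on k d V F" for k
    unfolding F_def[abs_def]
    by (rule Ck_on_compose[OF Vo Uo Ck_on_subset[OF Suc.prems(1) U(2)]]) (use sH HV in \<open>auto simp: smooth_between_iff\<close>)
  have Gk: "Ck_on k d U (\<lambda>x. G x j)" if "j < d" for j k using sG that by (simp add: smooth_between_iff)
  have "(\<lambda>j. if j = q then 1 else 0) \<in> EE (Suc q)" by (simp add: EE_iff)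
  from Suc.prems(2)[unfolded surjective_derivative_iff, rule_format, OF this]
  obtain v where v: "v \<in> EE d" "\<And>j. j < Suc q \<Longrightarrow> Dv d (\<lambda>y. f y j) z v = (if j = q then 1 else 0)"
    by auto
  \<comment> \<open>The vector \<open>v\<close> moves component \<open>q\<close> and none before it.
    Its image \<open>u\<close> under the derivative of \<open>G\<close> therefore vanishes at the
    positions already filled, while the derivative of \<open>F\<close> along \<open>u\<close> is 1,
    so \<open>F\<close> depends on a position not yet filled.\<close>
  define u where "u = (\<lambda>i. Dv d (\<lambda>x. G x i) z v)"
  have u0: "u (d - 1 - j) = 0" if "j < q" for j
  proof -
    have "u (d - 1 - j) = Dv d (\<lambda>x. f x j) z v"
      unfolding u_def by (rule Dv_cong[OF Uo U(1)]) (use Gf that in auto)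
    then show ?thesis using v(2)[of j] that by simp
  qed
  have "Dv d F (G z) u = Dv d (\<lambda>x. F (G x)) z v"
    unfolding u_def by (rule Dv_compose[OF Uo Vo Fk Gk GU U(1), symmetric])
  also have "\<dots> = Dv d (\<lambda>x. f x q) z v"
    by (rule Dv_cong[OF Uo U(1)]) (simp add: F_def HG)
  also have "\<dots> = 1" using v(2)[of q] by simp
  finally have "\<exists>i<d. partial_deriv i F (G z) * u i \<noteq> 0"
    unfolding Dv_def by (metis (no_types, lifting) lessThan_iff sum.neutral zero_neq_one)
  then obtain i where i: "i < d" "partial_deriv i F (G z) \<noteq> 0" "u i \<noteq> 0" by auto
  have iq: "i < d - q"
  proof (rule ccontr)
    assume "\<not> i < d - q"
    then have "d - 1 - i < q" "i = d - 1 - (d - 1 - i)" using i(1) q by auto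
    then show False using u0[of "d - 1 - i"] i(3) by simp
  qed
  \<comment> \<open>Positions are filled from the top, so that the common zeros of \<open>q\<close>
    components become \<open>EE (d - q)\<close>, the shape required of a slice.\<close>
  define l where "l = d - 1 - q"
  have l: "l < d" "Suc q \<le> d" using iq q by (auto simp: l_def)
  \<comment> \<open>Since \<open>i < d - q\<close>, both exchanged positions are still free, and the
    components already in place are untouched.\<close>
  define T where "T y = y(i := y l, l := y i)" for y :: "nat \<Rightarrow> real"
  have TE: "T y \<in> EE d" if "y \<in> EE d" for y using that i l by (auto simp: T_def EE_iff)
  have TT: "T (T y) = y" for y by (auto simp: T_def fun_eq_iff)
  have TD: "diffeo d (EE d) (EE d) T T"
  proof (rule linear_involution_diffeo)
    show "\<exists>a c. \<forall>y. T y j = c * y a" for j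
      by (rule exI[of _ "if j = l then i else if j = i then l else j"], rule exI[of _ 1]) (simp add: T_def)
  qed (use TE TT in auto)
  define z' where "z' = T (G z)"
  define V' where "V' = {y \<in> EE d. T y \<in> V}"
  have V'o: "eopen d V'"
    unfolding V'_def by (rule smooth_between_preimage[OF _ Vo]) (use TD in \<open>auto simp: diffeo_def\<close>)
  have GE: "G x \<in> EE d" if "x \<in> U" for x using that GU Vo eopen_subset by blast
  have z'V: "z' \<in> V'" using U(1) GU GE TE TT by (auto simp: z'_def V'_def)
  have FTk: "Ck_on k d V' (\<lambda>y. F (T y))" for k
    by (rule Ck_on_compose[OF V'o Vo Fk])
      (use TD Ck_on_subset[of k d "EE d" _ V'] in \<open>auto simp: V'_def diffeo_def smooth_between_iff\<close>)
  have "partial_deriv l (\<lambda>y. F (T y)) z' = partial_deriv i F (G z)"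
  proof -
    have "T (z'(l := t)) = (G z)(i := t)" "z' l = G z i" for t by (auto simp: z'_def T_def fun_eq_iff)
    then show ?thesis unfolding partial_deriv_def by simp
  qed
  then obtain U1 V1 H1 where D1: "z' \<in> U1" "U1 \<subseteq> V'" "diffeo d U1 V1 (\<lambda>y. y(l := F (T y))) H1"
    using coordinate_change[OF V'o FTk z'V l(1)] i(2) by metis
  from diffeo_compose[OF diffeo_compose[OF D TD] D1(3)]
  obtain V2 H2 where D2: "diffeo d {x \<in> {x \<in> U. G x \<in> EE d}. T (G x) \<in> U1} V2 (\<lambda>x. (T (G x))(l := F (T (T (G x))))) H2"
    by blast
  show ?case
  proof (rule conjI[OF l(2)], rule exI[of _ "{x \<in> {x \<in> U. G x \<in> EE d}. T (G x) \<in> U1}"], rule exI[of _ V2],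
      rule exI[of _ "\<lambda>x. (T (G x))(l := F (T (T (G x))))"], rule exI[of _ H2], intro conjI D2 ballI allI impI)
    show "z \<in> {x \<in> {x \<in> U. G x \<in> EE d}. T (G x) \<in> U1}" using U(1) GE D1(1) by (simp add: z'_def)
    show "{x \<in> {x \<in> U. G x \<in> EE d}. T (G x) \<in> U1} \<subseteq> U0" using U(2) by auto
    fix x j assume x: "x \<in> {x \<in> {x \<in> U. G x \<in> EE d}. T (G x) \<in> U1}" and j: "j < Suc q"
    show "((T (G x))(l := F (T (T (G x))))) (d - 1 - j) = f x j"
    proof (cases "j = q")
      case True
      then have "d - 1 - j = l" by (simp add: l_def)
      then show ?thesis using x HG True by (simp add: TT F_def)
    next
      case False
      then have "j < q" "d - 1 - j \<noteq> l" "d - 1 - j \<noteq> i" using j iq l by (auto simp: l_def)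
      then show ?thesis using Gf[of x j] x by (simp add: T_def)
    qed
  qed
qed

text \<open>The converse of \<open>straighten\<close>, at every point of \<open>U\<close>: the
  components of \<open>f\<close> are coordinates of the diffeomorphism \<open>G\<close>, and
  coordinates can be moved independently. The pair yields openness of submersivity.\<close>

lemma straightened_surjective:
  assumes D: "diffeo d U V G H" and q: "q \<le> d" and f: "\<And>j k. j < q \<Longrightarrow> Ck_on k d U (\<lambda>x. f x j)"
    and Gf: "\<And>x j. x \<in> U \<Longrightarrow> j < q \<Longrightarrow> G x (d - 1 - j) = f x j" and x: "x \<in> U"
  shows "surjective_derivative d q f x"
  unfolding surjective_derivative_iff
proof
  fix w assume w: "w \<in> EE q"
  have Uo: "eopen d U" and Vo: "eopen d V" and GU: "G ` U \<subseteq> V" and HV: "H ` V \<subseteq> U"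
    and HG: "\<And>x. x \<in> U \<Longrightarrow> H (G x) = x" and GH: "\<And>y. y \<in> V \<Longrightarrow> G (H y) = y" and sH: "smooth_between d d V H"
    using D by (auto simp: diffeo_def)
  have Gx: "G x \<in> V" using GU x by blast
  \<comment> \<open>Component \<open>j\<close> of \<open>f\<close> is coordinate
    \<open>d - 1 - j\<close> of \<open>G\<close>, hence the reversal; the derivative of
    \<open>H\<close> carries \<open>u\<close> back to a vector \<open>v\<close> at
    \<open>x\<close>.\<close>
  define u where "u = (\<lambda>i. if i < d then w (d - 1 - i) else 0)"
  define v where "v = (\<lambda>i. if i < d then Dv d (\<lambda>y. H y i) (G x) u else 0)"
  have uE: "u \<in> EE d" by (simp add: u_def EE_iff)
  have "Dv d (\<lambda>y. f y j) x v = w j" if j: "j < q" for j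
  proof -
    have "Dv d (\<lambda>y. f y j) x v = Dv d (\<lambda>y. f y j) (H (G x)) (\<lambda>i. Dv d (\<lambda>y. H y i) (G x) u)"
      unfolding HG[OF x] by (simp add: Dv_def v_def)
    also have "\<dots> = Dv d (\<lambda>y. f (H y) j) (G x) u"
      by (rule Dv_compose[OF Vo Uo f[OF j] _ HV Gx, symmetric]) (use sH in \<open>simp add: smooth_between_iff del: Ck_on.simps\<close>)
    also have "\<dots> = Dv d (\<lambda>y. y (d - 1 - j)) (G x) u"
      by (rule Dv_cong[OF Vo Gx]) (use Gf[OF _ j] GH HV in force)
    also have "\<dots> = u (d - 1 - j)" by (rule Dv_coord[OF uE])
    also have "\<dots> = w j" using j q by (simp add: u_def)
    finally show ?thesis .
  qed
  then show "\<exists>v\<in>EE d. \<forall>j<q. Dv d (\<lambda>y. f y j) x v = w j"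
    by (intro bexI[of _ v]) (auto simp: v_def EE_iff)
qed

section \<open>Maps in charts\<close>

text \<open>Smoothness at a single point, with its neighborhood and the injectivity of both
  coordinate maps built in, so that it composes without any reference to atlases.\<close>

definition chart_smooth_at :: "'a chart \<Rightarrow> 'b chart \<Rightarrow> ('a \<Rightarrow> 'b) \<Rightarrow> 'a \<Rightarrow> bool" where
  "chart_smooth_at = (\<lambda>(d, W, \<phi>) (e, V, \<psi>) f x.
     x \<in> W \<and> f x \<in> V \<and> inj_on \<phi> W \<and> inj_on \<psi> V \<and>
     (\<exists>U. eopen d U \<and> \<phi> x \<in> U \<and> U \<subseteq> \<phi> ` (W \<inter> f -` V) \<and>
       smooth_between d e U (\<lambda>y. \<psi> (f (inv_into W \<phi> y)))))"

text \<open>The derivative in charts as a map on coordinate vectors, in place of a tangent bundle.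
  The value 0 from index \<open>e\<close> on puts the result into \<open>EE e\<close>, so that
  identities between tangent maps are equalities of functions.\<close>

definition tangent_map ::
  "'a chart \<Rightarrow> 'b chart \<Rightarrow> ('a \<Rightarrow> 'b) \<Rightarrow> 'a \<Rightarrow> (nat \<Rightarrow> real) \<Rightarrow> nat \<Rightarrow> real" where
  "tangent_map = (\<lambda>(d, W, \<phi>) (e, V, \<psi>) f x v l.
     if l < e then Dv d (\<lambda>y. \<psi> (f (inv_into W \<phi> y)) l) (\<phi> x) v else 0)"

lemma tangent_map_apply:
  "tangent_map (d, W, \<phi>) (e, V, \<psi>) f x v l =
   (if l < e then Dv d (\<lambda>y. \<psi> (f (inv_into W \<phi> y)) l) (\<phi> x) v else 0)"
  by (simp add: tangent_map_def)

lemma tangent_map_EE: "tangent_map (d, W, \<phi>) (e, V, \<psi>) f x v \<in> EE e"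
  by (simp add: tangent_map_apply EE_iff)

lemma tangent_map_add:
  "tangent_map (d, W, \<phi>) (e, V, \<psi>) f x (u + v) =
   tangent_map (d, W, \<phi>) (e, V, \<psi>) f x u + tangent_map (d, W, \<phi>) (e, V, \<psi>) f x v"
  using Dv_add[of d _ "\<phi> x" u v] by (simp add: tangent_map_apply fun_eq_iff plus_fun_def)

lemma surjective_derivative_tangent_map:
  "surjective_derivative d e (\<psi> \<circ> f \<circ> inv_into W \<phi>) (\<phi> x) \<longleftrightarrow>
   (\<forall>w\<in>EE e. \<exists>v\<in>EE d. tangent_map (d, W, \<phi>) (e, V, \<psi>) f x v = w)"
proof -
  have "(\<forall>j<e. Dv d (\<lambda>y. (\<psi> \<circ> f \<circ> inv_into W \<phi>) y j) (\<phi> x) v = w j) \<longleftrightarrow>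
    tangent_map (d, W, \<phi>) (e, V, \<psi>) f x v = w" if "w \<in> EE e" for v w
    using that by (auto simp: tangent_map_apply fun_eq_iff EE_iff)
  then show ?thesis unfolding surjective_derivative_iff by blast
qed

lemma chart_smooth_atE:
  assumes "chart_smooth_at (d, W, \<phi>) (e, V, \<psi>) f x"
  obtains U where "x \<in> W" "f x \<in> V" "inj_on \<phi> W" "inj_on \<psi> V" "eopen d U" "\<phi> x \<in> U"
    "\<And>y. y \<in> U \<Longrightarrow> inv_into W \<phi> y \<in> W \<and> f (inv_into W \<phi> y) \<in> V \<and> \<phi> (inv_into W \<phi> y) = y"
    "smooth_between d e U (\<lambda>y. \<psi> (f (inv_into W \<phi> y)))"
proof -
  obtain U where U: "x \<in> W" "f x \<in> V" "inj_on \<phi> W" "inj_on \<psi> V" "eopen d U" "\<phi> x \<in> U"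
    "U \<subseteq> \<phi> ` (W \<inter> f -` V)" "smooth_between d e U (\<lambda>y. \<psi> (f (inv_into W \<phi> y)))"
    using assms by (auto simp: chart_smooth_at_def)
  have "inv_into W \<phi> y \<in> W \<and> f (inv_into W \<phi> y) \<in> V \<and> \<phi> (inv_into W \<phi> y) = y" if "y \<in> U" for y
    using U(3,7) that by auto
  then show ?thesis using that U by blast
qed

lemma chart_smooth_atI:
  assumes "x \<in> W" "f x \<in> V" "inj_on \<phi> W" "inj_on \<psi> V" "eopen d U" "\<phi> x \<in> U"
    "\<And>y. y \<in> U \<Longrightarrow> \<exists>w\<in>W. f w \<in> V \<and> \<phi> w = y"
    "smooth_between d e U (\<lambda>y. \<psi> (f (inv_into W \<phi> y)))"
  shows "chart_smooth_at (d, W, \<phi>) (e, V, \<psi>) f x"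
proof -
  have "U \<subseteq> \<phi> ` (W \<inter> f -` V)" using assms(7) by fastforce
  then show ?thesis unfolding chart_smooth_at_def using assms(1-6,8) by auto
qed

lemma chart_smooth_at_points:
  assumes "chart_smooth_at (d, W, \<phi>) (e, V, \<psi>) f x"
  shows "x \<in> W" "f x \<in> V" "inj_on \<phi> W" "inj_on \<psi> V"
  using assms by (auto simp: chart_smooth_at_def)

text \<open>Near \<open>x\<close> the coordinate expression of the composite is the composite of the
  coordinate expressions, because the middle chart cancels. Both conclusions use this on the same
  open set \<open>N\<close>.\<close>

lemma chart_compose_aux:
  assumes f: "chart_smooth_at (d, W, \<phi>) (e, V, \<psi>) f x" and g: "chart_smooth_at (e, V, \<psi>) (h, Z, \<theta>) g (f x)"
  shows "chart_smooth_at (d, W, \<phi>) (h, Z, \<theta>) (\<lambda>x. g (f x)) x"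
    "tangent_map (d, W, \<phi>) (h, Z, \<theta>) (\<lambda>x. g (f x)) x v =
     tangent_map (e, V, \<psi>) (h, Z, \<theta>) g (f x) (tangent_map (d, W, \<phi>) (e, V, \<psi>) f x v)"
proof -
  obtain U where U: "x \<in> W" "f x \<in> V" "inj_on \<phi> W" "inj_on \<psi> V" "eopen d U" "\<phi> x \<in> U"
    "\<And>y. y \<in> U \<Longrightarrow> inv_into W \<phi> y \<in> W \<and> f (inv_into W \<phi> y) \<in> V \<and> \<phi> (inv_into W \<phi> y) = y"
    "smooth_between d e U (\<lambda>y. \<psi> (f (inv_into W \<phi> y)))"
    using chart_smooth_atE[OF f] by blast
  obtain U' where U': "g (f x) \<in> Z" "inj_on \<theta> Z" "eopen e U'" "\<psi> (f x) \<in> U'"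
    "\<And>y. y \<in> U' \<Longrightarrow> inv_into V \<psi> y \<in> V \<and> g (inv_into V \<psi> y) \<in> Z \<and> \<psi> (inv_into V \<psi> y) = y"
    "smooth_between e h U' (\<lambda>y. \<theta> (g (inv_into V \<psi> y)))"
    using chart_smooth_atE[OF g] by blast
  define rf where "rf = (\<lambda>y. \<psi> (f (inv_into W \<phi> y)))"
  define rg where "rg = (\<lambda>y. \<theta> (g (inv_into V \<psi> y)))"
  define N where "N = {y \<in> U. rf y \<in> U'}"
  have No: "eopen d N" unfolding N_def using U(5) U'(3) U(8)[folded rf_def] by (rule smooth_between_preimage)
  have xN: "\<phi> x \<in> N" using U(1,3,6) U'(4) by (simp add: N_def rf_def)
  have rfx: "rf (\<phi> x) = \<psi> (f x)" using U(1,3) by (simp add: rf_def)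
  have inv: "inv_into V \<psi> (rf y) = f (inv_into W \<phi> y)" if "y \<in> N" for y
    using U(4) U(7)[of y] that by (simp add: rf_def N_def)
  have eq: "\<theta> (g (f (inv_into W \<phi> y))) = rg (rf y)" if "y \<in> N" for y
    using inv[OF that] by (simp add: rg_def)
  have sf: "smooth_between d e N rf" by (rule smooth_between_subset[OF U(8)[folded rf_def]]) (auto simp: N_def)
  have NU': "rf ` N \<subseteq> U'" by (auto simp: N_def)
  have s: "smooth_between d h N (\<lambda>y. \<theta> (g (f (inv_into W \<phi> y))))"
    by (rule smooth_between_cong[OF No smooth_between_compose[OF No U'(3) sf NU' U'(6)[folded rg_def]]]) (simp add: eq)
  show "chart_smooth_at (d, W, \<phi>) (h, Z, \<theta>) (\<lambda>x. g (f x)) x"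
  proof (rule chart_smooth_atI[OF U(1) U'(1) U(3) U'(2) No xN _ s])
    fix y assume y: "y \<in> N"
    then have "rf y \<in> U'" "y \<in> U" by (auto simp: N_def)
    then show "\<exists>w\<in>W. g (f w) \<in> Z \<and> \<phi> w = y"
      using U(7)[of y] U'(5)[of "rf y"] inv[OF y] by (intro bexI[of _ "inv_into W \<phi> y"]) auto
  qed
  show "tangent_map (d, W, \<phi>) (h, Z, \<theta>) (\<lambda>x. g (f x)) x v =
     tangent_map (e, V, \<psi>) (h, Z, \<theta>) g (f x) (tangent_map (d, W, \<phi>) (e, V, \<psi>) f x v)"
  proof (rule ext)
    fix l
    show "tangent_map (d, W, \<phi>) (h, Z, \<theta>) (\<lambda>x. g (f x)) x v l =
     tangent_map (e, V, \<psi>) (h, Z, \<theta>) g (f x) (tangent_map (d, W, \<phi>) (e, V, \<psi>) f x v) l"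
    proof (cases "l < h")
      case True
      have "Dv d (\<lambda>y. \<theta> (g (f (inv_into W \<phi> y))) l) (\<phi> x) v = Dv d (\<lambda>y. rg (rf y) l) (\<phi> x) v"
        by (rule Dv_cong[OF No xN]) (simp add: eq)
      also have "\<dots> = Dv e (\<lambda>y. rg y l) (rf (\<phi> x)) (\<lambda>j. Dv d (\<lambda>y. rf y j) (\<phi> x) v)"
        by (rule Dv_compose[OF No U'(3) _ _ NU' xN])
          (use True sf U'(6)[folded rg_def] in \<open>simp_all add: smooth_between_iff del: Ck_on.simps\<close>)
      also have "\<dots> = tangent_map (e, V, \<psi>) (h, Z, \<theta>) g (f x) (tangent_map (d, W, \<phi>) (e, V, \<psi>) f x v) l"
        using True rfx by (simp add: tangent_map_apply rg_def rf_def) (simp add: Dv_def tangent_map_apply)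
      finally show ?thesis using True by (simp add: tangent_map_apply)
    qed (simp add: tangent_map_apply)
  qed
qed

lemmas chart_smooth_at_compose = chart_compose_aux(1)
lemmas tangent_map_compose = chart_compose_aux(2)

lemma chart_smooth_at_cong:
  assumes f: "chart_smooth_at (d, W, \<phi>) (e, V, \<psi>) f x" and eq: "\<And>w. w \<in> W \<Longrightarrow> f w = g w"
  shows "chart_smooth_at (d, W, \<phi>) (e, V, \<psi>) g x"
    "tangent_map (d, W, \<phi>) (e, V, \<psi>) f x v = tangent_map (d, W, \<phi>) (e, V, \<psi>) g x v"
proof -
  obtain U where U: "x \<in> W" "f x \<in> V" "inj_on \<phi> W" "inj_on \<psi> V" "eopen d U" "\<phi> x \<in> U"
    "\<And>y. y \<in> U \<Longrightarrow> inv_into W \<phi> y \<in> W \<and> f (inv_into W \<phi> y) \<in> V \<and> \<phi> (inv_into W \<phi> y) = y"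
    "smooth_between d e U (\<lambda>y. \<psi> (f (inv_into W \<phi> y)))"
    using chart_smooth_atE[OF f] by blast
  have s: "smooth_between d e U (\<lambda>y. \<psi> (g (inv_into W \<phi> y)))"
    by (rule smooth_between_cong[OF U(5,8)]) (use U(7) eq in auto)
  show "chart_smooth_at (d, W, \<phi>) (e, V, \<psi>) g x"
  proof (rule chart_smooth_atI[where U=U])
    show "g x \<in> V" using U(1,2) eq by metis
    show "\<exists>w\<in>W. g w \<in> V \<and> \<phi> w = y" if "y \<in> U" for y
      using U(7)[OF that] eq by metis
  qed (fact U s)+
  have "Dv d (\<lambda>y. \<psi> (f (inv_into W \<phi> y)) l) (\<phi> x) v = Dv d (\<lambda>y. \<psi> (g (inv_into W \<phi> y)) l) (\<phi> x) v" for l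
    by (rule Dv_cong[OF U(5,6)]) (use U(7) eq in auto)
  then show "tangent_map (d, W, \<phi>) (e, V, \<psi>) f x v = tangent_map (d, W, \<phi>) (e, V, \<psi>) g x v"
    by (simp add: tangent_map_apply fun_eq_iff)
qed

lemma chart_smooth_at_restrict:
  assumes f: "chart_smooth_at (d, W, \<phi>) (e, V, \<psi>) f x"
    and o: "eopen d (\<phi> ` (W \<inter> O1))" "eopen e (\<psi> ` (V \<inter> O2))" and x: "x \<in> O1" "f x \<in> O2"
  shows "chart_smooth_at (d, W \<inter> O1, \<phi>) (e, V \<inter> O2, \<psi>) f x"
proof -
  obtain U where U: "x \<in> W" "f x \<in> V" "inj_on \<phi> W" "inj_on \<psi> V" "eopen d U" "\<phi> x \<in> U"
    "\<And>y. y \<in> U \<Longrightarrow> inv_into W \<phi> y \<in> W \<and> f (inv_into W \<phi> y) \<in> V \<and> \<phi> (inv_into W \<phi> y) = y"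
    "smooth_between d e U (\<lambda>y. \<psi> (f (inv_into W \<phi> y)))"
    using chart_smooth_atE[OF f] by blast
  define N where "N = {y \<in> U. \<psi> (f (inv_into W \<phi> y)) \<in> \<psi> ` (V \<inter> O2)} \<inter> \<phi> ` (W \<inter> O1)"
  have No: "eopen d N"
    unfolding N_def by (intro openin_Int o smooth_between_preimage[OF U(5) o(2) U(8)])
  have xN: "\<phi> x \<in> N" using U x by (auto simp: N_def)
  have inv: "inv_into (W \<inter> O1) \<phi> y = inv_into W \<phi> y" "inv_into W \<phi> y \<in> O1" if "y \<in> N" for y
  proof -
    have "y \<in> \<phi> ` (W \<inter> O1)" using that unfolding N_def by (rule IntD2)
    then obtain w where w: "w \<in> W" "w \<in> O1" "y = \<phi> w" by blast
    have "inj_on \<phi> (W \<inter> O1)" using U(3) by (auto intro: inj_on_subset)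
    then show "inv_into (W \<inter> O1) \<phi> y = inv_into W \<phi> y" "inv_into W \<phi> y \<in> O1"
      using w U(3) by auto
  qed
  show ?thesis
  proof (rule chart_smooth_atI[where U=N])
    show "eopen d N" "\<phi> x \<in> N" by fact+
    show "x \<in> W \<inter> O1" "f x \<in> V \<inter> O2" "inj_on \<phi> (W \<inter> O1)" "inj_on \<psi> (V \<inter> O2)"
      using U x by (auto intro: inj_on_subset)
    show "smooth_between d e N (\<lambda>y. \<psi> (f (inv_into (W \<inter> O1) \<phi> y)))"
      by (rule smooth_between_cong[OF No smooth_between_subset[OF U(8)]]) (auto simp: inv N_def)
    fix y assume y: "y \<in> N"
    then have "\<psi> (f (inv_into W \<phi> y)) \<in> \<psi> ` (V \<inter> O2)" "y \<in> U" by (auto simp: N_def)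
    then have "f (inv_into W \<phi> y) \<in> O2" using U(4) U(7)[of y] by (auto dest: inj_onD)
    then show "\<exists>w\<in>W \<inter> O1. f w \<in> V \<inter> O2 \<and> \<phi> w = y"
      using U(7)[of y] \<open>y \<in> U\<close> inv(2)[OF y] by (intro bexI[of _ "inv_into W \<phi> y"]) auto
  qed
qed

lemma smooth_between_chart:
  assumes "\<And>x. x \<in> W \<Longrightarrow> f x \<in> V \<Longrightarrow> chart_smooth_at (d, W, \<phi>) (e, V, \<psi>) f x"
  shows "smooth_between d e (\<phi> ` (W \<inter> f -` V)) (\<psi> \<circ> f \<circ> inv_into W \<phi>)"
proof (rule smooth_between_local)
  fix y assume "y \<in> \<phi> ` (W \<inter> f -` V)"
  then obtain x where x: "x \<in> W" "f x \<in> V" "y = \<phi> x" by auto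
  show "\<exists>U. eopen d U \<and> y \<in> U \<and> smooth_between d e U (\<psi> \<circ> f \<circ> inv_into W \<phi>)"
    using chart_smooth_atE[OF assms[OF x(1,2)]] x(3) unfolding comp_def by metis
qed

lemma tangent_map_id:
  assumes "chart_smooth_at (d, W, \<phi>) (d, W, \<phi>) (\<lambda>x. x) x" "v \<in> EE d"
  shows "tangent_map (d, W, \<phi>) (d, W, \<phi>) (\<lambda>x. x) x v = v"
proof (rule ext)
  fix l
  obtain U where U: "eopen d U" "\<phi> x \<in> U" "\<And>y. y \<in> U \<Longrightarrow> \<phi> (inv_into W \<phi> y) = y"
    using chart_smooth_atE[OF assms(1)] by metis
  have "Dv d (\<lambda>y. \<phi> (inv_into W \<phi> y) l) (\<phi> x) v = Dv d (\<lambda>y. y l) (\<phi> x) v"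
    by (rule Dv_cong[OF U(1,2)]) (simp add: U(3))
  then show "tangent_map (d, W, \<phi>) (d, W, \<phi>) (\<lambda>x. x) x v l = v l"
    using Dv_coord[OF assms(2)] assms(2) by (auto simp: tangent_map_apply EE_iff)
qed

section \<open>Charts and atlases\<close>

lemma chart_onD:
  assumes "chart_on T (d, W, \<phi>)"
  shows "openin T W" "eopen d (\<phi> ` W)" "inj_on \<phi> W" "continuous_map (subtopology T W) (Euclidean_space d) \<phi>"
    "\<And>O'. openin T O' \<Longrightarrow> eopen d (\<phi> ` (W \<inter> O'))"
    "\<And>O'. eopen d O' \<Longrightarrow> openin T {x \<in> W. \<phi> x \<in> O'}"
proof -
  have W: "openin T W" and i: "eopen d (\<phi> ` W)"
    and h: "homeomorphic_map (subtopology T W) (subtopology (Euclidean_space d) (\<phi> ` W)) \<phi>"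
    using assms by (auto simp: chart_on_def)
  show "openin T W" "eopen d (\<phi> ` W)" by fact+
  have tW: "topspace (subtopology T W) = W" using openin_subset[OF W] by auto
  show "inj_on \<phi> W" using homeomorphic_imp_injective_map[OF h] tW by simp
  show c: "continuous_map (subtopology T W) (Euclidean_space d) \<phi>"
    using homeomorphic_imp_continuous_map[OF h] continuous_map_into_fulltopology by blast
  show "eopen d (\<phi> ` (W \<inter> O'))" if "openin T O'" for O'
  proof -
    have "openin (subtopology T W) (W \<inter> O')" using that W openin_Int[OF W that] by (simp add: openin_open_subtopology)
    then have "openin (subtopology (Euclidean_space d) (\<phi> ` W)) (\<phi> ` (W \<inter> O'))"
      using homeomorphic_imp_open_map[OF h] by (simp add: open_map_def)
    then show ?thesis using i openin_trans_full by blast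
  qed
  show "openin T {x \<in> W. \<phi> x \<in> O'}" if "eopen d O'" for O'
    using openin_continuous_map_preimage[OF c that] openin_trans_full W tW by metis
qed

lemma chart_onI:
  assumes "openin T W" "inj_on \<phi> W" "continuous_map (subtopology T W) (Euclidean_space d) \<phi>"
    "\<And>O'. openin T O' \<Longrightarrow> O' \<subseteq> W \<Longrightarrow> eopen d (\<phi> ` O')"
  shows "chart_on T (d, W, \<phi>)"
proof -
  have i: "eopen d (\<phi> ` W)" using assms(1,4) by blast
  have tW: "topspace (subtopology T W) = W" using openin_subset[OF assms(1)] by auto
  have "homeomorphic_map (subtopology T W) (subtopology (Euclidean_space d) (\<phi> ` W)) \<phi>"
  proof (rule bijective_open_imp_homeomorphic_map)
    show "continuous_map (subtopology T W) (subtopology (Euclidean_space d) (\<phi> ` W)) \<phi>"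
      using assms(3) tW by (auto simp: continuous_map_in_subtopology)
    show "open_map (subtopology T W) (subtopology (Euclidean_space d) (\<phi> ` W)) \<phi>"
      unfolding open_map_def using assms(1,4) i by (auto simp: openin_open_subtopology)
    show "\<phi> ` topspace (subtopology T W) = topspace (subtopology (Euclidean_space d) (\<phi> ` W))"
      using tW eopen_subset[OF i] by auto
    show "inj_on \<phi> (topspace (subtopology T W))" using tW assms(2) by simp
  qed
  then show ?thesis using assms(1) i by (simp add: chart_on_def)
qed

text \<open>The chart axioms of \<open>smooth_manifold\<close> on their own. This is what is
  established for horn ambients; the full notion returns for the neighborhoods at the end.\<close>

definition charted :: "'a mfd \<Rightarrow> bool" where
  "charted M \<longleftrightarrow> (\<forall>c \<in> atlas M. chart_on (mtop M) c) \<and>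
     (\<forall>c \<in> atlas M. \<forall>c' \<in> atlas M. compatible_charts c c') \<and>
     (\<forall>x \<in> points M. \<exists>(d, W, \<phi>) \<in> atlas M. x \<in> W)"

lemma smooth_manifold_charted: "smooth_manifold M \<Longrightarrow> charted M"
  by (simp add: smooth_manifold_def charted_def)

lemma atlas_subset_maximal: "charted M \<Longrightarrow> atlas M \<subseteq> maximal_atlas M"
  by (auto simp: charted_def maximal_atlas_def)

lemma maximal_chart_on: "c \<in> maximal_atlas M \<Longrightarrow> chart_on (mtop M) c"
  by (simp add: maximal_atlas_def)

lemma chart_at:
  assumes "charted M" "x \<in> points M"
  obtains d W \<phi> where "(d, W, \<phi>) \<in> atlas M" "x \<in> W"
  using assms unfolding charted_def by blast

lemma chart_smooth_at_smooth_between: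
  assumes c: "chart_on S (d, W, \<phi>)" and c': "chart_on T (e, V, \<psi>)" and f: "continuous_map S T f"
    and s: "smooth_between d e (\<phi> ` (W \<inter> f -` V)) (\<psi> \<circ> f \<circ> inv_into W \<phi>)" and x: "x \<in> W" "f x \<in> V"
  shows "chart_smooth_at (d, W, \<phi>) (e, V, \<psi>) f x"
proof (rule chart_smooth_atI[where U="\<phi> ` (W \<inter> f -` V)"])
  have "openin S {x \<in> topspace S. f x \<in> V}"
    using openin_continuous_map_preimage[OF f chart_onD(1)[OF c']] .
  then have "eopen d (\<phi> ` (W \<inter> {x \<in> topspace S. f x \<in> V}))" by (rule chart_onD(5)[OF c])
  moreover have "W \<inter> {x \<in> topspace S. f x \<in> V} = W \<inter> f -` V"
    using openin_subset[OF chart_onD(1)[OF c]] by auto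
  ultimately show "eopen d (\<phi> ` (W \<inter> f -` V))" by simp
  show "smooth_between d e (\<phi> ` (W \<inter> f -` V)) (\<lambda>y. \<psi> (f (inv_into W \<phi> y)))"
    using s by (simp add: comp_def)
qed (use x chart_onD(3)[OF c] chart_onD(3)[OF c'] in auto)

lemma compatible_chart_smooth:
  assumes "chart_on T (d, W, \<phi>)" "chart_on T (e, V, \<psi>)" "compatible_charts (d, W, \<phi>) (e, V, \<psi>)" "x \<in> W" "x \<in> V"
  shows "chart_smooth_at (d, W, \<phi>) (e, V, \<psi>) (\<lambda>x. x) x" "chart_smooth_at (e, V, \<psi>) (d, W, \<phi>) (\<lambda>x. x) x"
proof -
  have s: "smooth_between d e (\<phi> ` (W \<inter> V)) (\<psi> \<circ> inv_into W \<phi>)"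
    "smooth_between e d (\<psi> ` (V \<inter> W)) (\<phi> \<circ> inv_into V \<psi>)"
    using assms(3) by (auto simp: compatible_charts_def Int_commute)
  have "(\<lambda>x. x) -` A = A" for A :: "'a set" by auto
  then show "chart_smooth_at (d, W, \<phi>) (e, V, \<psi>) (\<lambda>x. x) x" "chart_smooth_at (e, V, \<psi>) (d, W, \<phi>) (\<lambda>x. x) x"
    using s assms by (auto intro!: chart_smooth_at_smooth_between[of T _ _ _ T] simp: comp_def)
qed

lemma compatible_chartsI:
  assumes "\<And>x. x \<in> W \<Longrightarrow> x \<in> V \<Longrightarrow> chart_smooth_at (d, W, \<phi>) (e, V, \<psi>) (\<lambda>x. x) x"
    "\<And>x. x \<in> W \<Longrightarrow> x \<in> V \<Longrightarrow> chart_smooth_at (e, V, \<psi>) (d, W, \<phi>) (\<lambda>x. x) x"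
  shows "compatible_charts (d, W, \<phi>) (e, V, \<psi>)"
proof -
  have *: "(\<lambda>x. x) -` A = A" for A :: "'a set" by auto
  show ?thesis
    using smooth_between_chart[of W "\<lambda>x. x" V d \<phi> e \<psi>] smooth_between_chart[of V "\<lambda>x. x" W e \<psi> d \<phi>] assms
    unfolding compatible_charts_def * by (simp add: comp_def Int_commute)
qed

text \<open>Compatibility with the atlas is transitive: around \<open>x\<close> the transition map
  factors through a chart of the atlas.\<close>

lemma maximal_charts_smooth:
  assumes M: "charted M" and c: "(d, W, \<phi>) \<in> maximal_atlas M" and c': "(e, V, \<psi>) \<in> maximal_atlas M"
    and x: "x \<in> W" "x \<in> V"
  shows "chart_smooth_at (d, W, \<phi>) (e, V, \<psi>) (\<lambda>x. x) x"
proof -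
  have "x \<in> points M" using x(1) openin_subset[OF chart_onD(1)[OF maximal_chart_on[OF c]]] by blast
  then obtain b Z \<theta> where z: "(b, Z, \<theta>) \<in> atlas M" "x \<in> Z" using chart_at[OF M] by blast
  have zc: "chart_on (mtop M) (b, Z, \<theta>)" using M z by (auto simp: charted_def)
  have "chart_smooth_at (d, W, \<phi>) (b, Z, \<theta>) (\<lambda>x. x) x"
    by (rule compatible_chart_smooth[OF maximal_chart_on[OF c] zc _ x(1) z(2)]) (use c z in \<open>auto simp: maximal_atlas_def\<close>)
  moreover have "chart_smooth_at (b, Z, \<theta>) (e, V, \<psi>) (\<lambda>x. x) x"
    by (rule compatible_chart_smooth(2)[OF maximal_chart_on[OF c'] zc _ x(2) z(2)]) (use c' z in \<open>auto simp: maximal_atlas_def\<close>)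
  ultimately show ?thesis by (rule chart_smooth_at_compose)
qed

text \<open>Reduces membership to a comparison with a single known chart around each point, since
  smooth transition maps compose.\<close>

lemma maximal_atlasI:
  assumes "charted M" "chart_on (mtop M) (d, W, \<phi>)"
    "\<And>x. x \<in> W \<Longrightarrow> \<exists>e V \<psi>. (e, V, \<psi>) \<in> maximal_atlas M \<and>
      chart_smooth_at (d, W, \<phi>) (e, V, \<psi>) (\<lambda>x. x) x \<and> chart_smooth_at (e, V, \<psi>) (d, W, \<phi>) (\<lambda>x. x) x"
  shows "(d, W, \<phi>) \<in> maximal_atlas M"
proof -
  have "compatible_charts (d, W, \<phi>) (b, Z, \<theta>)" if z: "(b, Z, \<theta>) \<in> atlas M" for b Z \<theta>
  proof -
    have zm: "(b, Z, \<theta>) \<in> maximal_atlas M" using z atlas_subset_maximal[OF assms(1)] by blast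
    have *: "chart_smooth_at (d, W, \<phi>) (b, Z, \<theta>) (\<lambda>x. x) x \<and> chart_smooth_at (b, Z, \<theta>) (d, W, \<phi>) (\<lambda>x. x) x"
      if x: "x \<in> W" "x \<in> Z" for x
    proof -
      obtain e V \<psi> where e: "(e, V, \<psi>) \<in> maximal_atlas M"
        "chart_smooth_at (d, W, \<phi>) (e, V, \<psi>) (\<lambda>x. x) x" "chart_smooth_at (e, V, \<psi>) (d, W, \<phi>) (\<lambda>x. x) x"
        using assms(3)[OF x(1)] by blast
      have xV: "x \<in> V" using chart_smooth_at_points(2)[OF e(2)] .
      show ?thesis
        using chart_smooth_at_compose[OF e(2) maximal_charts_smooth[OF assms(1) e(1) zm xV x(2)]]
          chart_smooth_at_compose[OF maximal_charts_smooth[OF assms(1) zm e(1) x(2) xV] e(3)] by simp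
    qed
    show ?thesis by (rule compatible_chartsI) (use * in auto)
  qed
  then show ?thesis using assms(2) by (auto simp: maximal_atlas_def)
qed

text \<open>\<open>smooth_map\<close> speaks of the given atlases; composing with transition maps on
  both sides extends it to the maximal ones, where slice charts live.\<close>

lemma smooth_map_chart_smooth_at:
  assumes M: "charted M" and N: "charted N" and f: "smooth_map M N f"
    and c: "(d, W, \<phi>) \<in> maximal_atlas M" and c': "(e, V, \<psi>) \<in> maximal_atlas N" and x: "x \<in> W" "f x \<in> V"
  shows "chart_smooth_at (d, W, \<phi>) (e, V, \<psi>) f x"
proof -
  have "x \<in> points M" using x(1) openin_subset[OF chart_onD(1)[OF maximal_chart_on[OF c]]] by blast
  then obtain b Z \<theta> where z: "(b, Z, \<theta>) \<in> atlas M" "x \<in> Z" using chart_at[OF M] by blast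
  have "f x \<in> points N" using x(2) openin_subset[OF chart_onD(1)[OF maximal_chart_on[OF c']]] by blast
  then obtain b' Z' \<theta>' where z': "(b', Z', \<theta>') \<in> atlas N" "f x \<in> Z'" using chart_at[OF N] by blast
  have zm: "(b, Z, \<theta>) \<in> maximal_atlas M" "(b', Z', \<theta>') \<in> maximal_atlas N"
    using z z' atlas_subset_maximal M N by blast+
  have "chart_smooth_at (b, Z, \<theta>) (b', Z', \<theta>') f x"
    using f z z' by (intro chart_smooth_at_smooth_between[OF maximal_chart_on[OF zm(1)] maximal_chart_on[OF zm(2)]])
      (auto simp: smooth_map_def)
  from chart_smooth_at_compose[OF chart_smooth_at_compose[OF maximal_charts_smooth[OF M c zm(1) x(1) z(2)] this]
      maximal_charts_smooth[OF N zm(2) c' z'(2) x(2)]]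
  show ?thesis .
qed

lemma smooth_mapI:
  assumes "continuous_map (mtop M) (mtop N) f"
    "\<And>d W \<phi> e V \<psi> x. (d, W, \<phi>) \<in> atlas M \<Longrightarrow> (e, V, \<psi>) \<in> atlas N \<Longrightarrow> x \<in> W \<Longrightarrow> f x \<in> V \<Longrightarrow>
      chart_smooth_at (d, W, \<phi>) (e, V, \<psi>) f x"
  shows "smooth_map M N f"
  unfolding smooth_map_def using assms(1) by (auto intro!: smooth_between_chart assms(2))

lemma smooth_mapI':
  assumes M: "charted M" and N: "charted N" and "continuous_map (mtop M) (mtop N) f"
    and f: "\<And>x. x \<in> points M \<Longrightarrow> \<exists>d W \<phi> e V \<psi>. (d, W, \<phi>) \<in> maximal_atlas M \<and> (e, V, \<psi>) \<in> maximal_atlas N \<and>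
      chart_smooth_at (d, W, \<phi>) (e, V, \<psi>) f x"
  shows "smooth_map M N f"
proof (rule smooth_mapI[OF assms(3)])
  fix d W \<phi> e V \<psi> x assume c: "(d, W, \<phi>) \<in> atlas M" and c': "(e, V, \<psi>) \<in> atlas N" and x: "x \<in> W" "f x \<in> V"
  have cm: "(d, W, \<phi>) \<in> maximal_atlas M" "(e, V, \<psi>) \<in> maximal_atlas N"
    using c c' atlas_subset_maximal M N by blast+
  have "x \<in> points M" using x(1) openin_subset[OF chart_onD(1)[OF maximal_chart_on[OF cm(1)]]] by blast
  then obtain b Z \<theta> b' Z' \<theta>' where z: "(b, Z, \<theta>) \<in> maximal_atlas M" "(b', Z', \<theta>') \<in> maximal_atlas N"
      "chart_smooth_at (b, Z, \<theta>) (b', Z', \<theta>') f x"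
    using f by blast
  note p = chart_smooth_at_points[OF z(3)]
  from chart_smooth_at_compose[OF chart_smooth_at_compose[OF maximal_charts_smooth[OF M cm(1) z(1) x(1) p(1)] z(3)]
      maximal_charts_smooth[OF N z(2) cm(2) p(2) x(2)]]
  show "chart_smooth_at (d, W, \<phi>) (e, V, \<psi>) f x" .
qed

lemma smooth_map_compose:
  assumes M: "charted M" and N: "charted N" and P: "charted P" and f: "smooth_map M N f" and g: "smooth_map N P g"
  shows "smooth_map M P (\<lambda>x. g (f x))"
proof (rule smooth_mapI'[OF M P])
  have cf: "continuous_map (mtop M) (mtop N) f" and cg: "continuous_map (mtop N) (mtop P) g"
    using f g by (auto simp: smooth_map_def)
  show "continuous_map (mtop M) (mtop P) (\<lambda>x. g (f x))" using continuous_map_compose[OF cf cg] by (simp add: comp_def)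
  fix x assume x: "x \<in> points M"
  have fx: "f x \<in> points N" using cf x continuous_map_image_subset_topspace by blast
  have gx: "g (f x) \<in> points P" using cg fx continuous_map_image_subset_topspace by blast
  obtain d W \<phi> where c: "(d, W, \<phi>) \<in> atlas M" "x \<in> W" using chart_at[OF M x] by blast
  obtain e V \<psi> where c': "(e, V, \<psi>) \<in> atlas N" "f x \<in> V" using chart_at[OF N fx] by blast
  obtain h Z \<theta> where c'': "(h, Z, \<theta>) \<in> atlas P" "g (f x) \<in> Z" using chart_at[OF P gx] by blast
  have m: "(d, W, \<phi>) \<in> maximal_atlas M" "(e, V, \<psi>) \<in> maximal_atlas N" "(h, Z, \<theta>) \<in> maximal_atlas P"
    using c c' c'' atlas_subset_maximal M N P by blast+
  have "chart_smooth_at (d, W, \<phi>) (h, Z, \<theta>) (\<lambda>x. g (f x)) x"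
    by (rule chart_smooth_at_compose[OF smooth_map_chart_smooth_at[OF M N f m(1,2) c(2) c'(2)]
        smooth_map_chart_smooth_at[OF N P g m(2,3) c'(2) c''(2)]])
  then show "\<exists>d W \<phi> e V \<psi>. (d, W, \<phi>) \<in> maximal_atlas M \<and> (e, V, \<psi>) \<in> maximal_atlas P \<and>
      chart_smooth_at (d, W, \<phi>) (e, V, \<psi>) (\<lambda>x. g (f x)) x"
    using m by blast
qed

lemma smooth_map_points: "smooth_map M N f \<Longrightarrow> x \<in> points M \<Longrightarrow> f x \<in> points N"
  using continuous_map_image_subset_topspace[of "mtop M" "mtop N" f] by (auto simp: smooth_map_def)

lemma tangent_map_inverse:
  assumes M: "charted M" and c: "(d, W, \<phi>) \<in> maximal_atlas M" and c': "(e, V, \<psi>) \<in> maximal_atlas M"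
    and x: "x \<in> W" "x \<in> V" and v: "v \<in> EE d"
  shows "tangent_map (e, V, \<psi>) (d, W, \<phi>) (\<lambda>x. x) x (tangent_map (d, W, \<phi>) (e, V, \<psi>) (\<lambda>x. x) x v) = v"
  using tangent_map_compose[OF maximal_charts_smooth[OF M c c' x] maximal_charts_smooth[OF M c' c x(2,1)], of v]
    tangent_map_id[OF maximal_charts_smooth[OF M c c x(1,1)] v] by simp

section \<open>Open submanifolds\<close>

lemma chart_on_restrict:
  assumes c: "chart_on T (d, W, \<phi>)" and U: "openin T U"
  shows "chart_on T (d, W \<inter> U, \<phi>)"
proof (rule chart_onI)
  show "openin T (W \<inter> U)" using chart_onD(1)[OF c] U by blast
  show "inj_on \<phi> (W \<inter> U)" using chart_onD(3)[OF c] by (rule inj_on_subset) simp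
  show "continuous_map (subtopology T (W \<inter> U)) (Euclidean_space d) \<phi>"
    using chart_onD(4)[OF c] by (rule continuous_map_from_subtopology_mono) simp
  show "eopen d (\<phi> ` O')" if "openin T O'" "O' \<subseteq> W \<inter> U" for O'
    using chart_onD(5)[OF c that(1)] that(2) by (simp add: Int_absorb1)
qed

lemma chart_on_subtopology:
  assumes "chart_on T (d, W, \<phi>)" "W \<subseteq> U" "openin T U"
  shows "chart_on (subtopology T U) (d, W, \<phi>)"
  using assms openin_subset[of T W]
  by (auto simp: chart_on_def openin_open_subtopology subtopology_subtopology Int_absorb1 Int_commute)

lemma maximal_atlas_restrict:
  assumes M: "charted M" and c: "(d, W, \<phi>) \<in> maximal_atlas M" and U: "openin (mtop M) U"
  shows "(d, W \<inter> U, \<phi>) \<in> maximal_atlas M"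
proof (rule maximal_atlasI[OF M chart_on_restrict[OF maximal_chart_on[OF c] U]])
  fix x assume x: "x \<in> W \<inter> U"
  note cc = maximal_charts_smooth[OF M c c, of x]
  have W: "\<And>O'. openin (mtop M) O' \<Longrightarrow> eopen d (\<phi> ` (W \<inter> O'))" using chart_onD(5)[OF maximal_chart_on[OF c]] .
  have Wo: "openin (mtop M) W" using chart_onD(1)[OF maximal_chart_on[OF c]] .
  show "\<exists>e V \<psi>. (e, V, \<psi>) \<in> maximal_atlas M \<and>
      chart_smooth_at (d, W \<inter> U, \<phi>) (e, V, \<psi>) (\<lambda>x. x) x \<and> chart_smooth_at (e, V, \<psi>) (d, W \<inter> U, \<phi>) (\<lambda>x. x) x"
    using chart_smooth_at_restrict[OF cc W[OF U] W[OF Wo]] chart_smooth_at_restrict[OF cc W[OF Wo] W[OF U]] c x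
    by (intro exI[of _ d] exI[of _ W] exI[of _ \<phi>]) auto
qed

lemma open_submanifold_simps [simp]:
  "mtop (open_submanifold M U) = subtopology (mtop M) U"
  "atlas (open_submanifold M U) = {(d, W \<inter> U, \<phi>) | d W \<phi>. (d, W, \<phi>) \<in> atlas M}"
  by (simp_all add: open_submanifold_def)

lemma charted_open_submanifold:
  assumes M: "charted M" and U: "openin (mtop M) U"
  shows "charted (open_submanifold M U)"
  unfolding charted_def
proof (intro conjI ballI)
  fix c assume "c \<in> atlas (open_submanifold M U)"
  then obtain d W \<phi> where c: "(d, W, \<phi>) \<in> maximal_atlas M" "c = (d, W \<inter> U, \<phi>)"
    using atlas_subset_maximal[OF M] by auto
  show "chart_on (mtop (open_submanifold M U)) c"
    using chart_on_subtopology[OF chart_on_restrict[OF maximal_chart_on[OF c(1)] U] _ U] c(2) by simp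
  fix c' assume "c' \<in> atlas (open_submanifold M U)"
  then obtain e V \<psi> where c': "(e, V, \<psi>) \<in> maximal_atlas M" "c' = (e, V \<inter> U, \<psi>)"
    using atlas_subset_maximal[OF M] by auto
  show "compatible_charts c c'"
    unfolding c(2) c'(2) by (rule compatible_chartsI) (auto intro: maximal_charts_smooth[OF M] maximal_atlas_restrict[OF M _ U] c c')
next
  fix x assume "x \<in> points (open_submanifold M U)"
  then have x: "x \<in> points M" "x \<in> U" by auto
  then obtain d W \<phi> where c: "(d, W, \<phi>) \<in> atlas M" "x \<in> W" using chart_at[OF M] by blast
  then have "(d, W \<inter> U, \<phi>) \<in> atlas (open_submanifold M U)" by auto
  then show "\<exists>(d, W, \<phi>)\<in>atlas (open_submanifold M U). x \<in> W" using x c(2) by (intro bexI[of _ "(d, W \<inter> U, \<phi>)"]) auto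
qed

text \<open>Lets charts chosen inside an open subset be used for maps of the whole manifold that do
  not preserve the subset.\<close>

lemma open_submanifold_maximal_atlas:
  assumes M: "charted M" and U: "openin (mtop M) U" and c: "(d, W, \<phi>) \<in> maximal_atlas (open_submanifold M U)"
  shows "(d, W, \<phi>) \<in> maximal_atlas M"
proof (rule maximal_atlasI[OF M])
  have cU: "chart_on (subtopology (mtop M) U) (d, W, \<phi>)" using maximal_chart_on[OF c] by simp
  have WU: "W \<subseteq> U" using openin_subset[OF chart_onD(1)[OF cU]] by auto
  then show "chart_on (mtop M) (d, W, \<phi>)"
    using cU U openin_trans_full[of "mtop M" U W]
    by (auto simp: chart_on_def subtopology_subtopology Int_absorb1 Int_commute)
  fix x assume x: "x \<in> W"
  note MU = charted_open_submanifold[OF M U]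
  have "x \<in> points M" using x WU openin_subset[OF U] by blast
  then obtain b Z \<theta> where z: "(b, Z, \<theta>) \<in> atlas M" "x \<in> Z" using chart_at[OF M] by blast
  have z1: "(b, Z \<inter> U, \<theta>) \<in> maximal_atlas (open_submanifold M U)"
    using z(1) atlas_subset_maximal[OF MU] by auto
  have z2: "(b, Z \<inter> U, \<theta>) \<in> maximal_atlas M"
    using maximal_atlas_restrict[OF M _ U] z(1) atlas_subset_maximal[OF M] by blast
  show "\<exists>e V \<psi>. (e, V, \<psi>) \<in> maximal_atlas M \<and>
      chart_smooth_at (d, W, \<phi>) (e, V, \<psi>) (\<lambda>x. x) x \<and> chart_smooth_at (e, V, \<psi>) (d, W, \<phi>) (\<lambda>x. x) x"
    using z2 maximal_charts_smooth[OF MU c z1 x] maximal_charts_smooth[OF MU z1 c _ x] z(2) x WU by blast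
qed

lemma smooth_map_open_submanifold:
  assumes M: "charted M" and N: "charted N" and U: "openin (mtop M) U" and V: "openin (mtop N) V"
    and f: "smooth_map M N f" and fU: "f ` U \<subseteq> V"
  shows "smooth_map (open_submanifold M U) (open_submanifold N V) f"
proof (rule smooth_mapI)
  have "continuous_map (mtop M) (mtop N) f" using f by (simp add: smooth_map_def)
  then show "continuous_map (mtop (open_submanifold M U)) (mtop (open_submanifold N V)) f"
    using fU by (auto simp: continuous_map_in_subtopology continuous_map_from_subtopology)
  fix d W \<phi> e Z \<psi> x
  assume "(d, W, \<phi>) \<in> atlas (open_submanifold M U)" "(e, Z, \<psi>) \<in> atlas (open_submanifold N V)" "x \<in> W" "f x \<in> Z"
  then show "chart_smooth_at (d, W, \<phi>) (e, Z, \<psi>) f x"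
    using open_submanifold_maximal_atlas[OF M U] open_submanifold_maximal_atlas[OF N V]
      atlas_subset_maximal[OF charted_open_submanifold[OF M U]] atlas_subset_maximal[OF charted_open_submanifold[OF N V]]
    by (intro smooth_map_chart_smooth_at[OF M N f]) blast+
qed

lemma smooth_manifold_open_submanifold:
  assumes M: "smooth_manifold M" and U: "openin (mtop M) U"
  shows "smooth_manifold (open_submanifold M U)"
  using charted_open_submanifold[OF smooth_manifold_charted[OF M] U] M
    Hausdorff_space_subtopology second_countable_subtopology
  by (auto simp: smooth_manifold_def charted_def)

section \<open>Concatenation of coordinates\<close>

text \<open>Inverse to \<open>concat_coords\<close>: block \<open>j\<close> moved back to start at
  index 0.\<close>

definition block :: "nat set \<Rightarrow> (nat \<Rightarrow> nat) \<Rightarrow> nat \<Rightarrow> (nat \<Rightarrow> real) \<Rightarrow> nat \<Rightarrow> real" where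
  "block J D j y = (\<lambda>k. if k < D j then y (block_start J D j + k) else 0)"

lemma block_EE: "block J D j y \<in> EE (D j)"
  by (simp add: block_def EE_iff)

lemma block_start_add_le:
  assumes "finite J" "i \<in> J" "i < j"
  shows "block_start J D i + D i \<le> block_start J D j"
proof -
  have "block_start J D i + D i = sum D (insert i {i' \<in> J. i' < i})"
    using assms by (simp add: block_start_def)
  also have "\<dots> \<le> block_start J D j"
    unfolding block_start_def by (rule sum_mono2) (use assms in auto)
  finally show ?thesis .
qed

lemma block_end_le:
  assumes "finite J" "j \<in> J"
  shows "block_start J D j + D j \<le> sum D J"
proof -
  have "block_start J D j + D j = sum D (insert j {i' \<in> J. i' < j})"
    using assms by (simp add: block_start_def)
  also have "\<dots> \<le> sum D J" by (rule sum_mono2) (use assms in auto)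
  finally show ?thesis .
qed

text \<open>Adding an index \<open>b\<close> larger than all others leaves the earlier blocks where
  they are and lets the new one start at \<open>sum D A\<close>.\<close>

lemma block_exists:
  assumes "finite J" "k < sum D J"
  shows "\<exists>j\<in>J. block_start J D j \<le> k \<and> k < block_start J D j + D j"
  using assms
proof (induction J rule: finite_linorder_max_induct)
  case empty
  then show ?case by simp
next
  case (insert b A)
  have bA: "b \<notin> A" using insert.hyps by blast
  have sb: "block_start (insert b A) D b = sum D A"
    unfolding block_start_def using insert.hyps by (intro sum.cong) auto
  have sj: "block_start (insert b A) D j = block_start A D j" if "j \<in> A" for j
    unfolding block_start_def using insert.hyps that by (intro sum.cong) auto
  show ?case
  proof (cases "k < sum D A")
    case True
    then show ?thesis using insert.IH sj by fastforce
  next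
    case False
    then show ?thesis using sb insert.prems bA insert.hyps(1) by simp
  qed
qed

lemma concat_coords_block:
  assumes "finite J" "j \<in> J" "k < D j"
  shows "concat_coords J D y (block_start J D j + k) = y j k"
proof -
  have "concat_coords J D y (block_start J D j + k) = (\<Sum>i\<in>J. if i = j then y j k else 0)"
    unfolding concat_coords_def
  proof (rule sum.cong[OF refl])
    fix i assume i: "i \<in> J"
    consider "i = j" | "i < j" | "j < i" by linarith
    then show "(if block_start J D i \<le> block_start J D j + k \<and> block_start J D j + k < block_start J D i + D i
        then y i (block_start J D j + k - block_start J D i) else 0) = (if i = j then y j k else 0)"
    proof cases
      case 1 then show ?thesis using assms by simp
    next
      case 2 then show ?thesis using block_start_add_le[OF assms(1) i, of j D] by simp
    next
      case 3 then show ?thesis using block_start_add_le[OF assms(1,2), of i D] assms(3) by simp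
    qed
  qed
  then show ?thesis using assms by simp
qed

lemma concat_coords_EE:
  assumes "finite J" shows "concat_coords J D y \<in> EE (sum D J)"
  unfolding EE_iff concat_coords_def
proof (intro allI impI sum.neutral ballI)
  fix k j assume "k \<ge> sum D J" "j \<in> J"
  then show "(if block_start J D j \<le> k \<and> k < block_start J D j + D j then y j (k - block_start J D j) else 0) = 0"
    using block_end_le[OF assms, of j D] by simp
qed

lemma block_concat:
  assumes "finite J" "j \<in> J" "y j \<in> EE (D j)"
  shows "block J D j (concat_coords J D y) = y j"
  using concat_coords_block[OF assms(1,2)] assms(3) by (auto simp: block_def EE_iff fun_eq_iff)

lemma concat_block:
  assumes "finite J" "x \<in> EE (sum D J)"
  shows "concat_coords J D (\<lambda>j. block J D j x) = x"
proof (rule EE_eqI[OF concat_coords_EE[OF assms(1)] assms(2)])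
  fix k assume "k < sum D J"
  then obtain j where "j \<in> J" "block_start J D j \<le> k" "k < block_start J D j + D j"
    using block_exists[OF assms(1)] by blast
  then show "concat_coords J D (\<lambda>j. block J D j x) k = x k"
    using concat_coords_block[OF assms(1), of j "k - block_start J D j" D "\<lambda>j. block J D j x"]
    by (simp add: block_def)
qed

lemma block_inject:
  assumes "finite J" "x \<in> EE (sum D J)" "y \<in> EE (sum D J)" "\<And>j. j \<in> J \<Longrightarrow> block J D j x = block J D j y"
  shows "x = y"
proof -
  have "concat_coords J D (\<lambda>j. block J D j x) = concat_coords J D (\<lambda>j. block J D j y)"
    unfolding concat_coords_def using assms(4) by (intro ext sum.cong) auto
  then show ?thesis using concat_block assms(1-3) by metis
qed

lemma smooth_block: "eopen e U \<Longrightarrow> smooth_between e (D j) U (block J D j)"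
  by (auto simp: smooth_between_iff block_EE) (simp add: block_def)

section \<open>Products of manifolds\<close>

abbreviation product_chart ::
  "nat set \<Rightarrow> (nat \<Rightarrow> nat) \<Rightarrow> (nat \<Rightarrow> 'a set) \<Rightarrow> (nat \<Rightarrow> 'a \<Rightarrow> nat \<Rightarrow> real) \<Rightarrow> (nat \<Rightarrow> 'a) chart" where
  "product_chart J D W \<phi> \<equiv> (\<Sum>j\<in>J. D j, \<Pi>\<^sub>E j\<in>J. W j, \<lambda>x. concat_coords J D (\<lambda>j. \<phi> j (x j)))"

lemma product_manifold_simps [simp]:
  "mtop (product_manifold J M) = product_topology (\<lambda>j. mtop (M j)) J"
  "atlas (product_manifold J M) = {product_chart J D W \<phi> | D W \<phi>. \<forall>j\<in>J. (D j, W j, \<phi> j) \<in> atlas (M j)}"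
  by (simp_all add: product_manifold_def)

lemma chart_image_EE: "chart_on T (d, W, \<phi>) \<Longrightarrow> x \<in> W \<Longrightarrow> \<phi> x \<in> EE d"
  using chart_onD(2)[of T d W \<phi>] eopen_subset by blast

text \<open>One chart per factor, over bare topologies: the properties of a single product chart
  come before any atlas.\<close>

locale chart_family =
  fixes J :: "nat set" and T :: "nat \<Rightarrow> 'a topology" and D :: "nat \<Rightarrow> nat" and W :: "nat \<Rightarrow> 'a set"
    and \<phi> :: "nat \<Rightarrow> 'a \<Rightarrow> nat \<Rightarrow> real"
  assumes fin: "finite J" and charts: "\<And>j. j \<in> J \<Longrightarrow> chart_on (T j) (D j, W j, \<phi> j)"
begin

abbreviation "PW \<equiv> \<Pi>\<^sub>E j\<in>J. W j"
abbreviation "PC \<equiv> \<lambda>x. concat_coords J D (\<lambda>j. \<phi> j (x j))"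

lemma block_PC:
  assumes "x \<in> PW" "j \<in> J" shows "block J D j (PC x) = \<phi> j (x j)"
  by (rule block_concat[OF fin assms(2)]) (use chart_image_EE[OF charts] assms in \<open>auto simp: PiE_iff\<close>)

lemma inj_PC: "inj_on PC PW"
proof (rule inj_onI)
  fix x y assume x: "x \<in> PW" "y \<in> PW" "PC x = PC y"
  show "x = y"
  proof (rule PiE_ext[OF x(1,2)])
    fix j assume j: "j \<in> J"
    have "\<phi> j (x j) = \<phi> j (y j)" using block_PC[OF x(1) j] block_PC[OF x(2) j] x(3) by simp
    then show "x j = y j" using chart_onD(3)[OF charts[OF j]] x j by (auto simp: inj_on_def PiE_iff)
  qed
qed

lemma continuous_map_component_PW:
  assumes "j \<in> J" shows "continuous_map (subtopology (product_topology T J) PW) (subtopology (T j) (W j)) (\<lambda>x. x j)"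
  using assms by (auto simp: continuous_map_in_subtopology PiE_iff intro!: continuous_map_from_subtopology continuous_map_product_projection)

lemma openin_PW: "openin (product_topology T J) PW"
  using chart_onD(1)[OF charts] fin by (simp add: openin_PiE)

text \<open>A product box corresponds to conditions on the separate blocks, and there are only
  finitely many of them.\<close>

lemma PC_image_open:
  assumes O: "openin (product_topology T J) O'" "O' \<subseteq> PW"
  shows "eopen (sum D J) (PC ` O')"
proof (subst openin_subopen, intro ballI)
  fix y assume "y \<in> PC ` O'"
  then obtain x where x: "x \<in> O'" "y = PC x" by blast
  obtain X where X: "x \<in> Pi\<^sub>E J X" "\<And>j. openin (T j) (X j)" "Pi\<^sub>E J X \<subseteq> O'"
    using product_topology_open_contains_basis[OF O(1) x(1)] by blast
  \<comment> \<open>The factor \<open>EE (sum D J)\<close> keeps the intersection inside Euclidean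
    space also for empty \<open>J\<close>.\<close>
  define N where "N = EE (sum D J) \<inter> (\<Inter>j\<in>J. {y \<in> EE (sum D J). block J D j y \<in> \<phi> j ` (W j \<inter> X j)})"
  have E: "eopen (sum D J) (EE (sum D J))" using openin_topspace[of "Euclidean_space (sum D J)"] by simp
  have "eopen (sum D J) {y \<in> EE (sum D J). block J D j y \<in> \<phi> j ` (W j \<inter> X j)}" if "j \<in> J" for j
    using smooth_between_preimage[OF E chart_onD(5)[OF charts[OF that] X(2)[of j]] smooth_block[OF E, of D j J]] .
  then have "eopen (sum D J) N"
    using openin_INT[OF fin, of "Euclidean_space (sum D J)" "\<lambda>j. {y \<in> EE (sum D J). block J D j y \<in> \<phi> j ` (W j \<inter> X j)}"]
    by (simp add: N_def Int_commute)
  moreover have "y \<in> N"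
    using x O(2) X(1) block_PC concat_coords_EE[OF fin] by (auto simp: N_def PiE_iff subset_iff)
  moreover have "N \<subseteq> PC ` O'"
  proof
    fix y assume y: "y \<in> N"
    then have "\<forall>j\<in>J. \<exists>w. w \<in> W j \<inter> X j \<and> \<phi> j w = block J D j y" by (force simp: N_def)
    then obtain w where w: "\<And>j. j \<in> J \<Longrightarrow> w j \<in> W j \<inter> X j \<and> \<phi> j (w j) = block J D j y" by metis
    define x' where "x' = restrict w J"
    have x': "x' \<in> PW" "x' \<in> Pi\<^sub>E J X" using w by (auto simp: x'_def)
    have "PC x' = y"
    proof (rule block_inject[OF fin concat_coords_EE[OF fin]])
      show "y \<in> EE (sum D J)" using y by (auto simp: N_def)
      show "block J D j (PC x') = block J D j y" if "j \<in> J" for j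
        using block_PC[OF x'(1) that] w[OF that] that by (simp add: x'_def)
    qed
    then show "y \<in> PC ` O'" using x'(2) X(3) by blast
  qed
  ultimately show "\<exists>T. eopen (sum D J) T \<and> y \<in> T \<and> T \<subseteq> PC ` O'" by blast
qed

lemma chart_on_product: "chart_on (product_topology T J) (product_chart J D W \<phi>)"
proof (rule chart_onI[OF openin_PW inj_PC _ PC_image_open])
  let ?P = "subtopology (product_topology T J) PW"
  have comp: "continuous_map ?P euclideanreal (\<lambda>x. \<phi> j (x j) k)" if "j \<in> J" for j k
  proof -
    have "continuous_map ?P (Euclidean_space (D j)) (\<phi> j \<circ> (\<lambda>x. x j))"
      by (rule continuous_map_compose[OF continuous_map_component_PW[OF that] chart_onD(4)[OF charts[OF that]]])
    then show ?thesis
      by (simp add: Euclidean_space_def continuous_map_in_subtopology continuous_map_componentwise_UNIV)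
  qed
  have "continuous_map ?P euclideanreal (\<lambda>x. PC x k)" for k
    unfolding concat_coords_def
  proof (rule continuous_map_sum[OF fin])
    fix j assume "j \<in> J"
    then show "continuous_map ?P euclideanreal (\<lambda>x. if block_start J D j \<le> k \<and> k < block_start J D j + D j
        then \<phi> j (x j) (k - block_start J D j) else 0)"
      using comp by (cases "block_start J D j \<le> k \<and> k < block_start J D j + D j") auto
  qed
  moreover have "PC x \<in> EE (sum D J)" for x by (rule concat_coords_EE[OF fin])
  ultimately show "continuous_map ?P (Euclidean_space (sum D J)) PC"
    by (auto simp: Euclidean_space_def continuous_map_in_subtopology continuous_map_componentwise_UNIV EE_def)
qed

text \<open>In product coordinates a projection is the linear map \<open>block J D j\<close>, so it
  is its own derivative.\<close>

lemma projection_in_charts: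
  assumes x: "x \<in> PW" and j: "j \<in> J"
  shows "chart_smooth_at (product_chart J D W \<phi>) (D j, W j, \<phi> j) (\<lambda>x. x j) x"
    "v \<in> EE (sum D J) \<Longrightarrow> tangent_map (product_chart J D W \<phi>) (D j, W j, \<phi> j) (\<lambda>x. x j) x v = block J D j v"
proof -
  define U where "U = PC ` PW"
  have Uo: "eopen (sum D J) U" using PC_image_open[OF openin_PW] by (simp add: U_def)
  have xU: "PC x \<in> U" using x by (simp add: U_def)
  have rep: "\<phi> j (inv_into PW PC y j) = block J D j y" if "y \<in> U" for y
  proof -
    obtain w where w: "w \<in> PW" "y = PC w" using \<open>y \<in> U\<close> by (auto simp: U_def)
    have "inv_into PW PC y = w" unfolding w(2) by (rule inv_into_f_f[OF inj_PC w(1)])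
    then show ?thesis using block_PC[OF w(1) j] w(2) by simp
  qed
  show "chart_smooth_at (product_chart J D W \<phi>) (D j, W j, \<phi> j) (\<lambda>x. x j) x"
  proof (rule chart_smooth_atI[where U=U])
    show "x \<in> PW" "inj_on PC PW" "eopen (sum D J) U" "PC x \<in> U" by (fact x inj_PC Uo xU)+
    show "smooth_between (sum D J) (D j) U (\<lambda>y. \<phi> j (inv_into PW PC y j))"
      by (rule smooth_between_cong[OF Uo smooth_block[OF Uo]]) (simp add: rep)
  qed (use x j chart_onD(3)[OF charts[OF j]] in \<open>auto simp: U_def PiE_iff\<close>)
  assume v: "v \<in> EE (sum D J)"
  show "tangent_map (product_chart J D W \<phi>) (D j, W j, \<phi> j) (\<lambda>x. x j) x v = block J D j v"
  proof (rule ext)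
    fix l
    have "Dv (sum D J) (\<lambda>y. \<phi> j (inv_into PW PC y j) l) (PC x) v = Dv (sum D J) (\<lambda>y. y (block_start J D j + l)) (PC x) v" if "l < D j"
      by (rule Dv_cong[OF Uo xU]) (simp add: rep block_def that)
    then show "tangent_map (product_chart J D W \<phi>) (D j, W j, \<phi> j) (\<lambda>x. x j) x v l = block J D j v l"
      using Dv_coord[OF v] by (simp add: tangent_map_apply block_def)
  qed
qed

text \<open>Every product coordinate comes from a single \<open>f j\<close>, so a common
  neighborhood for the finitely many factors suffices. An element of \<open>J\<close> provides the
  facts about the source chart.\<close>

lemma tuple_in_charts:
  assumes J: "J \<noteq> {}"
    and f: "\<And>j. j \<in> J \<Longrightarrow> chart_smooth_at (d, Z, \<theta>) (D j, W j, \<phi> j) (f j) x"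
  shows "chart_smooth_at (d, Z, \<theta>) (product_chart J D W \<phi>) (\<lambda>x. \<lambda>j\<in>J. f j x) x"
proof -
  have "\<forall>j\<in>J. \<exists>U. eopen d U \<and> \<theta> x \<in> U \<and>
    (\<forall>y\<in>U. inv_into Z \<theta> y \<in> Z \<and> f j (inv_into Z \<theta> y) \<in> W j \<and> \<theta> (inv_into Z \<theta> y) = y) \<and>
    smooth_between d (D j) U (\<lambda>y. \<phi> j (f j (inv_into Z \<theta> y)))"
    using chart_smooth_atE[OF f] by metis
  then obtain U where U: "\<And>j. j \<in> J \<Longrightarrow> eopen d (U j)" "\<And>j. j \<in> J \<Longrightarrow> \<theta> x \<in> U j"
    "\<And>j y. j \<in> J \<Longrightarrow> y \<in> U j \<Longrightarrow> inv_into Z \<theta> y \<in> Z \<and> f j (inv_into Z \<theta> y) \<in> W j \<and> \<theta> (inv_into Z \<theta> y) = y"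
    "\<And>j. j \<in> J \<Longrightarrow> smooth_between d (D j) (U j) (\<lambda>y. \<phi> j (f j (inv_into Z \<theta> y)))"
    by metis
  obtain j0 where j0: "j0 \<in> J" using J by blast
  define N where "N = (\<Inter>j\<in>J. U j)"
  have No: "eopen d N" unfolding N_def using fin J U(1) by (intro openin_INT2) auto
  show ?thesis
  proof (rule chart_smooth_atI[where U=N])
    show "eopen d N" by fact
    show "\<theta> x \<in> N" using U(2) by (simp add: N_def)
    show "x \<in> Z" "inj_on \<theta> Z" using chart_smooth_at_points[OF f[OF j0]] by auto
    show "(\<lambda>j\<in>J. f j x) \<in> PW" using chart_smooth_at_points(2)[OF f] by auto
    show "inj_on PC PW" by (rule inj_PC)
    show "\<exists>w\<in>Z. (\<lambda>j\<in>J. f j w) \<in> PW \<and> \<theta> w = y" if "y \<in> N" for y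
      using U(3) that j0 by (intro bexI[of _ "inv_into Z \<theta> y"]) (auto simp: N_def)
    show "smooth_between d (sum D J) N (\<lambda>y. PC (\<lambda>j\<in>J. f j (inv_into Z \<theta> y)))"
      unfolding smooth_between_iff
    proof (intro conjI allI impI)
      show "(\<lambda>y. PC (\<lambda>j\<in>J. f j (inv_into Z \<theta> y))) ` N \<subseteq> EE (sum D J)" using concat_coords_EE[OF fin] by blast
      fix l k
      show "Ck_on k d N (\<lambda>y. PC (\<lambda>j\<in>J. f j (inv_into Z \<theta> y)) l)"
        unfolding concat_coords_def
      proof (rule Ck_on_sum[OF No])
        fix j assume j: "j \<in> J"
        have "Ck_on k d N (\<lambda>y. \<phi> j (f j (inv_into Z \<theta> y)) i)" if "i < D j" for i
          by (rule Ck_on_subset[of k d "U j"]) (use U(4)[OF j] that j in \<open>auto simp: N_def smooth_between_iff\<close>)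
        then show "Ck_on k d N (\<lambda>y. if block_start J D j \<le> l \<and> l < block_start J D j + D j
            then \<phi> j ((\<lambda>j\<in>J. f j (inv_into Z \<theta> y)) j) (l - block_start J D j) else 0)"
          using j No by (cases "block_start J D j \<le> l \<and> l < block_start J D j + D j") auto
      qed
    qed
  qed
qed

end

lemma product_chart_family:
  assumes "finite J" "\<forall>j\<in>J. charted (M j)" "\<forall>j\<in>J. (D j, W j, \<phi> j) \<in> atlas (M j)"
  shows "chart_family J (\<lambda>j. mtop (M j)) D W \<phi>"
  using assms by unfold_locales (auto simp: charted_def)

lemma product_chart_at:
  assumes fin: "finite J" and M: "\<forall>j\<in>J. charted (M j)" and x: "x \<in> (\<Pi>\<^sub>E j\<in>J. points (M j))"
  obtains D W \<phi> where "\<forall>j\<in>J. (D j, W j, \<phi> j) \<in> atlas (M j)" "x \<in> Pi\<^sub>E J W"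
proof -
  have "\<forall>j\<in>J. \<exists>c. c \<in> atlas (M j) \<and> x j \<in> fst (snd c)"
    using M x unfolding charted_def by (fastforce simp: PiE_iff)
  then obtain c where c: "\<And>j. j \<in> J \<Longrightarrow> c j \<in> atlas (M j) \<and> x j \<in> fst (snd (c j))" by metis
  show ?thesis
    by (rule that[of "\<lambda>j. fst (c j)" "\<lambda>j. fst (snd (c j))" "\<lambda>j. snd (snd (c j))"])
      (use c x in \<open>auto simp: PiE_iff\<close>)
qed

text \<open>A transition map of the product is the tuple of the transition maps of the factors, each
  preceded by a projection.\<close>

lemma charted_product_manifold:
  assumes fin: "finite J" and J: "J \<noteq> {}" and M: "\<forall>j\<in>J. charted (M j)"
  shows "charted (product_manifold J M)"
  unfolding charted_def
proof (intro conjI ballI)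
  fix c assume "c \<in> atlas (product_manifold J M)"
  then obtain D W \<phi> where c: "c = product_chart J D W \<phi>" "\<forall>j\<in>J. (D j, W j, \<phi> j) \<in> atlas (M j)" by auto
  interpret c: chart_family J "\<lambda>j. mtop (M j)" D W \<phi> using product_chart_family[OF fin M c(2)] by blast
  show "chart_on (mtop (product_manifold J M)) c" using c.chart_on_product c(1) by simp
  fix c' assume "c' \<in> atlas (product_manifold J M)"
  then obtain D' W' \<phi>' where c': "c' = product_chart J D' W' \<phi>'" "\<forall>j\<in>J. (D' j, W' j, \<phi>' j) \<in> atlas (M j)" by auto
  interpret c': chart_family J "\<lambda>j. mtop (M j)" D' W' \<phi>' using product_chart_family[OF fin M c'(2)] by blast
  have cm: "(D j, W j, \<phi> j) \<in> maximal_atlas (M j)" "(D' j, W' j, \<phi>' j) \<in> maximal_atlas (M j)" if "j \<in> J" for j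
    using c(2) c'(2) atlas_subset_maximal[OF bspec[OF M that]] that by blast+
  have id: "(\<lambda>j\<in>J. w j) = w" if "w \<in> Pi\<^sub>E J W \<or> w \<in> Pi\<^sub>E J W'" for w using that by (auto simp: PiE_def extensional_restrict)
  show "compatible_charts c c'"
    unfolding c(1) c'(1)
  proof (rule compatible_chartsI)
    fix x assume x: "x \<in> Pi\<^sub>E J W" "x \<in> Pi\<^sub>E J W'"
    have "chart_smooth_at (product_chart J D W \<phi>) (D' j, W' j, \<phi>' j) (\<lambda>x. x j) x" if j: "j \<in> J" for j
      using chart_smooth_at_compose[OF c.projection_in_charts(1)[OF x(1) j] maximal_charts_smooth[OF bspec[OF M j] cm(1,2)[OF j]]]
        x j by (auto simp: PiE_iff)
    from c'.tuple_in_charts[OF J this]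
    show "chart_smooth_at (product_chart J D W \<phi>) (product_chart J D' W' \<phi>') (\<lambda>x. x) x"
      by (rule chart_smooth_at_cong(1)) (use id in auto)
    have "chart_smooth_at (product_chart J D' W' \<phi>') (D j, W j, \<phi> j) (\<lambda>x. x j) x" if j: "j \<in> J" for j
      using chart_smooth_at_compose[OF c'.projection_in_charts(1)[OF x(2) j] maximal_charts_smooth[OF bspec[OF M j] cm(2,1)[OF j]]]
        x j by (auto simp: PiE_iff)
    from c.tuple_in_charts[OF J this]
    show "chart_smooth_at (product_chart J D' W' \<phi>') (product_chart J D W \<phi>) (\<lambda>x. x) x"
      by (rule chart_smooth_at_cong(1)) (use id in auto)
  qed
next
  fix x assume "x \<in> points (product_manifold J M)"
  then have "x \<in> (\<Pi>\<^sub>E j\<in>J. points (M j))" by simp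
  then obtain D W \<phi> where c: "\<forall>j\<in>J. (D j, W j, \<phi> j) \<in> atlas (M j)" "x \<in> Pi\<^sub>E J W"
    by (rule product_chart_at[OF fin M])
  then have "product_chart J D W \<phi> \<in> atlas (product_manifold J M)" by auto
  then show "\<exists>(d, W, \<phi>)\<in>atlas (product_manifold J M). x \<in> W" using c(2) by blast
qed

lemma product_chart_maximal:
  assumes "finite J" "J \<noteq> {}" "\<forall>j\<in>J. charted (M j)" "\<forall>j\<in>J. (D j, W j, \<phi> j) \<in> atlas (M j)"
  shows "product_chart J D W \<phi> \<in> maximal_atlas (product_manifold J M)"
proof -
  have "product_chart J D W \<phi> \<in> atlas (product_manifold J M)" using assms(4) by auto
  then show ?thesis using atlas_subset_maximal[OF charted_product_manifold[OF assms(1-3)]] by blast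
qed

lemma smooth_map_projection:
  assumes fin: "finite J" and M: "\<forall>j\<in>J. charted (M j)" and j: "j \<in> J"
  shows "smooth_map (product_manifold J M) (M j) (\<lambda>x. x j)"
proof (rule smooth_mapI')
  show "charted (product_manifold J M)" using charted_product_manifold[OF fin _ M] j by blast
  show "charted (M j)" by (rule bspec[OF M j])
  show "continuous_map (mtop (product_manifold J M)) (mtop (M j)) (\<lambda>x. x j)"
    using continuous_map_product_projection[OF j, of "\<lambda>j. mtop (M j)"] by simp
  fix x assume "x \<in> points (product_manifold J M)"
  then have "x \<in> (\<Pi>\<^sub>E j\<in>J. points (M j))" by simp
  then obtain D W \<phi> where c: "\<forall>j\<in>J. (D j, W j, \<phi> j) \<in> atlas (M j)" "x \<in> Pi\<^sub>E J W"
    by (rule product_chart_at[OF fin M])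
  interpret c: chart_family J "\<lambda>j. mtop (M j)" D W \<phi> using product_chart_family[OF fin M c(1)] by blast
  have "product_chart J D W \<phi> \<in> maximal_atlas (product_manifold J M)"
    using product_chart_maximal[OF fin _ M c(1)] j by blast
  moreover have "(D j, W j, \<phi> j) \<in> maximal_atlas (M j)" using c(1) j atlas_subset_maximal[OF bspec[OF M j]] by blast
  ultimately show "\<exists>d W \<phi> e V \<psi>. (d, W, \<phi>) \<in> maximal_atlas (product_manifold J M) \<and> (e, V, \<psi>) \<in> maximal_atlas (M j) \<and>
      chart_smooth_at (d, W, \<phi>) (e, V, \<psi>) (\<lambda>x. x j) x"
    using c.projection_in_charts(1)[OF c(2) j] by blast
qed

lemma smooth_map_tuple:
  assumes fin: "finite J" and J: "J \<noteq> {}" and M: "\<forall>j\<in>J. charted (M j)" and N: "charted N"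
    and f: "\<And>j. j \<in> J \<Longrightarrow> smooth_map N (M j) (f j)"
  shows "smooth_map N (product_manifold J M) (\<lambda>x. \<lambda>j\<in>J. f j x)"
proof (rule smooth_mapI'[OF N charted_product_manifold[OF fin J M]])
  show "continuous_map (mtop N) (mtop (product_manifold J M)) (\<lambda>x. \<lambda>j\<in>J. f j x)"
    using f by (auto simp: smooth_map_def continuous_map_componentwise)
  fix x assume x: "x \<in> points N"
  then have "(\<lambda>j\<in>J. f j x) \<in> (\<Pi>\<^sub>E j\<in>J. points (M j))"
    using f continuous_map_image_subset_topspace by (fastforce simp: smooth_map_def)
  then obtain D W \<phi> where c: "\<forall>j\<in>J. (D j, W j, \<phi> j) \<in> atlas (M j)" "(\<lambda>j\<in>J. f j x) \<in> Pi\<^sub>E J W"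
    using product_chart_at[OF fin M] by blast
  interpret c: chart_family J "\<lambda>j. mtop (M j)" D W \<phi> using product_chart_family[OF fin M c(1)] by blast
  obtain d Z \<theta> where z: "(d, Z, \<theta>) \<in> atlas N" "x \<in> Z" using chart_at[OF N x] by blast
  have zm: "(d, Z, \<theta>) \<in> maximal_atlas N" using z atlas_subset_maximal[OF N] by blast
  have "chart_smooth_at (d, Z, \<theta>) (D j, W j, \<phi> j) (f j) x" if j: "j \<in> J" for j
    by (rule smooth_map_chart_smooth_at[OF N bspec[OF M j] f[OF j] zm _ z(2)])
      (use c j atlas_subset_maximal[OF bspec[OF M j]] in \<open>auto simp: PiE_iff\<close>)
  from c.tuple_in_charts[OF J this]
  have "chart_smooth_at (d, Z, \<theta>) (product_chart J D W \<phi>) (\<lambda>x. \<lambda>j\<in>J. f j x) x" by blast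
  moreover have "product_chart J D W \<phi> \<in> maximal_atlas (product_manifold J M)"
    by (rule product_chart_maximal[OF fin J M c(1)])
  ultimately show "\<exists>d W \<phi> e V \<psi>. (d, W, \<phi>) \<in> maximal_atlas N \<and> (e, V, \<psi>) \<in> maximal_atlas (product_manifold J M) \<and>
      chart_smooth_at (d, W, \<phi>) (e, V, \<psi>) (\<lambda>x. \<lambda>j\<in>J. f j x) x"
    using zm by blast
qed

text \<open>The tangent space of a product is the product of the tangent spaces, in the form of
  uniqueness and existence of a vector with given components, and in an arbitrary chart. In a
  product chart the components are the blocks; the tangent map of the transition to another chart is
  invertible.\<close>

lemma product_tangent:
  assumes fin: "finite J" and J: "J \<noteq> {}" and M: "\<forall>j\<in>J. charted (M j)"
    and c: "\<forall>j\<in>J. (D j, W j, \<phi> j) \<in> atlas (M j)" and x: "x \<in> Pi\<^sub>E J W"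
    and z: "(d, Z, \<theta>) \<in> maximal_atlas (product_manifold J M)" "x \<in> Z"
  shows "\<And>v w. v \<in> EE d \<Longrightarrow> w \<in> EE d \<Longrightarrow>
      (\<And>j. j \<in> J \<Longrightarrow> tangent_map (d, Z, \<theta>) (D j, W j, \<phi> j) (\<lambda>x. x j) x v = tangent_map (d, Z, \<theta>) (D j, W j, \<phi> j) (\<lambda>x. x j) x w) \<Longrightarrow> v = w"
    "\<And>u. (\<And>j. j \<in> J \<Longrightarrow> u j \<in> EE (D j)) \<Longrightarrow>
      \<exists>v\<in>EE d. \<forall>j\<in>J. tangent_map (d, Z, \<theta>) (D j, W j, \<phi> j) (\<lambda>x. x j) x v = u j"
proof -
  let ?P = "product_manifold J M"
  let ?C = "product_chart J D W \<phi>"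
  interpret c: chart_family J "\<lambda>j. mtop (M j)" D W \<phi> using product_chart_family[OF fin M c] by blast
  note P = charted_product_manifold[OF fin J M]
  have C: "?C \<in> maximal_atlas ?P" by (rule product_chart_maximal[OF fin J M c])
  note zC = maximal_charts_smooth[OF P z(1) C z(2) x] and Cz = maximal_charts_smooth[OF P C z(1) x z(2)]
  have tm: "tangent_map (d, Z, \<theta>) (D j, W j, \<phi> j) (\<lambda>x. x j) x v = block J D j (tangent_map (d, Z, \<theta>) ?C (\<lambda>x. x) x v)"
    if j: "j \<in> J" for j v
    using tangent_map_compose[where f="\<lambda>x. x" and g="\<lambda>x. x j", OF zC c.projection_in_charts(1)[OF x j], of v] c.projection_in_charts(2)[OF x j tangent_map_EE]
    by simp
  show "v = w" if v: "v \<in> EE d" "w \<in> EE d"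
    "\<And>j. j \<in> J \<Longrightarrow> tangent_map (d, Z, \<theta>) (D j, W j, \<phi> j) (\<lambda>x. x j) x v = tangent_map (d, Z, \<theta>) (D j, W j, \<phi> j) (\<lambda>x. x j) x w" for v w
  proof -
    have "tangent_map (d, Z, \<theta>) ?C (\<lambda>x. x) x v = tangent_map (d, Z, \<theta>) ?C (\<lambda>x. x) x w"
    proof (rule block_inject[OF fin tangent_map_EE tangent_map_EE])
      fix j assume j: "j \<in> J"
      show "block J D j (tangent_map (d, Z, \<theta>) ?C (\<lambda>x. x) x v) = block J D j (tangent_map (d, Z, \<theta>) ?C (\<lambda>x. x) x w)"
        using v(3)[OF j] unfolding tm[OF j] .
    qed
    then have "tangent_map ?C (d, Z, \<theta>) (\<lambda>x. x) x (tangent_map (d, Z, \<theta>) ?C (\<lambda>x. x) x v) =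
        tangent_map ?C (d, Z, \<theta>) (\<lambda>x. x) x (tangent_map (d, Z, \<theta>) ?C (\<lambda>x. x) x w)"
      by (rule arg_cong)
    then show ?thesis
      unfolding tangent_map_inverse[OF P z(1) C z(2) x v(1)] tangent_map_inverse[OF P z(1) C z(2) x v(2)] .
  qed
  show "\<exists>v\<in>EE d. \<forall>j\<in>J. tangent_map (d, Z, \<theta>) (D j, W j, \<phi> j) (\<lambda>x. x j) x v = u j"
    if u: "\<And>j. j \<in> J \<Longrightarrow> u j \<in> EE (D j)" for u
  proof -
    define v where "v = tangent_map ?C (d, Z, \<theta>) (\<lambda>x. x) x (concat_coords J D u)"
    have "tangent_map (d, Z, \<theta>) ?C (\<lambda>x. x) x v = concat_coords J D u"
      unfolding v_def by (rule tangent_map_inverse[OF P C z(1) x z(2) concat_coords_EE[OF fin]])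
    then show ?thesis
      using tm block_concat[OF fin] u by (intro bexI[of _ v]) (simp_all add: v_def tangent_map_EE)
  qed
qed

section \<open>Embedded submanifolds and submersions\<close>

lemma slice_chart_iff:
  "slice_chart M S k (d, W, \<phi>) \<longleftrightarrow>
   (d, W, \<phi>) \<in> maximal_atlas M \<and> k \<le> d \<and> \<phi> ` (W \<inter> S) = \<phi> ` W \<inter> EE k"
  by (simp add: slice_chart_def)

lemma slice_chart_mem:
  assumes "slice_chart M S k (d, W, \<phi>)" "x \<in> W"
  shows "x \<in> S \<longleftrightarrow> \<phi> x \<in> EE k"
proof -
  have inj: "inj_on \<phi> W" using assms(1) chart_onD(3)[OF maximal_chart_on] by (auto simp: slice_chart_iff)
  have eq: "\<phi> ` (W \<inter> S) = \<phi> ` W \<inter> EE k" using assms(1) by (simp add: slice_chart_iff)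
  show ?thesis
  proof
    assume "x \<in> S"
    then have "\<phi> x \<in> \<phi> ` (W \<inter> S)" using assms(2) by blast
    then show "\<phi> x \<in> EE k" unfolding eq by blast
  next
    assume "\<phi> x \<in> EE k"
    then have "\<phi> x \<in> \<phi> ` (W \<inter> S)" unfolding eq using assms(2) by blast
    then obtain y where "y \<in> W" "y \<in> S" "\<phi> x = \<phi> y" by blast
    then show "x \<in> S" using inj assms(2) by (metis inj_onD)
  qed
qed

lemma embedded_points:
  assumes M: "charted M" shows "embedded_submanifold M (points M)"
  unfolding embedded_submanifold_def
proof (intro conjI ballI subset_refl)
  fix x assume "x \<in> points M"
  then obtain d W \<phi> where c: "(d, W, \<phi>) \<in> atlas M" "x \<in> W" using chart_at[OF M] by blast
  have cm: "(d, W, \<phi>) \<in> maximal_atlas M" using c(1) atlas_subset_maximal[OF M] by blast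
  note co = maximal_chart_on[OF cm]
  have "W \<inter> points M = W" using openin_subset[OF chart_onD(1)[OF co]] by blast
  moreover have "\<phi> ` W \<inter> EE d = \<phi> ` W" using eopen_subset[OF chart_onD(2)[OF co]] by blast
  ultimately have "slice_chart M (points M) d (d, W, \<phi>)" using cm by (simp add: slice_chart_iff)
  then show "\<exists>k d W \<phi>. slice_chart M (points M) k (d, W, \<phi>) \<and> x \<in> W" using c(2) by blast
qed

text \<open>The regular value theorem: straightening turns the \<open>q\<close> equations into the
  last coordinates of a new chart, in which \<open>S\<close> is the subspace
  \<open>EE (d - q)\<close>. The new chart belongs to the maximal atlas because its transition maps
  to the old one are \<open>G\<close> and \<open>H\<close>.\<close>

lemma slice_chart_of_equations:
  assumes M: "charted M" and c: "(d, W, \<phi>) \<in> maximal_atlas M" and O: "openin (mtop M) O'" "x \<in> O'" "O' \<subseteq> W"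
    and g: "\<And>j k. j < q \<Longrightarrow> Ck_on k d (\<phi> ` O') (\<lambda>y. g y j)"
    and surj: "surjective_derivative d q g (\<phi> x)"
    and S: "\<And>y. y \<in> O' \<Longrightarrow> y \<in> S \<longleftrightarrow> (\<forall>j<q. g (\<phi> y) j = 0)"
  shows "\<exists>k d W \<phi>. slice_chart M S k (d, W, \<phi>) \<and> x \<in> W"
proof -
  note co = maximal_chart_on[OF c]
  have inj: "inj_on \<phi> W" by (rule chart_onD(3)[OF co])
  have imO: "eopen d (\<phi> ` O')" using chart_onD(5)[OF co O(1)] O(3) by (simp add: Int_absorb1)
  have q: "q \<le> d" and "\<exists>U V G H. \<phi> x \<in> U \<and> U \<subseteq> \<phi> ` O' \<and> diffeo d U V G H \<and> (\<forall>y\<in>U. \<forall>j<q. G y (d - 1 - j) = g y j)"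
    using straighten[OF imO imageI[OF O(2)] g surj] by auto
  then obtain U V G H where U: "\<phi> x \<in> U" "U \<subseteq> \<phi> ` O'" "diffeo d U V G H"
    and Gg: "\<And>y j. y \<in> U \<Longrightarrow> j < q \<Longrightarrow> G y (d - 1 - j) = g y j" by blast
  have Uo: "eopen d U" and Vo: "eopen d V" and GU: "G ` U \<subseteq> V" and HV: "H ` V \<subseteq> U"
    and HG: "\<And>x. x \<in> U \<Longrightarrow> H (G x) = x" and GH: "\<And>y. y \<in> V \<Longrightarrow> G (H y) = y"
    and sG: "smooth_between d d U G" and sH: "smooth_between d d V H"
    using U(3) by (auto simp: diffeo_def)
  define W' where "W' = {w \<in> W. \<phi> w \<in> U}"
  define \<phi>' where "\<phi>' w = G (\<phi> w)" for w
  have W'o: "openin (mtop M) W'" unfolding W'_def by (rule chart_onD(6)[OF co Uo])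
  have W'O: "w \<in> O'" if "w \<in> W'" for w
    using that U(2) O(3) inj by (auto simp: W'_def dest!: inj_onD subsetD)
  have xW': "x \<in> W'" using O U(1) by (auto simp: W'_def)
  have inj': "inj_on \<phi>' W'"
  proof (rule inj_onI)
    fix a b assume ab: "a \<in> W'" "b \<in> W'" "\<phi>' a = \<phi>' b"
    then have "\<phi> a = \<phi> b" using HG by (metis (no_types, lifting) W'_def \<phi>'_def mem_Collect_eq)
    then show "a = b" using inj ab by (auto simp: W'_def dest: inj_onD)
  qed
  have im: "\<exists>w\<in>W'. \<phi>' w = y \<and> \<phi> w = H y" if "y \<in> V" for y
  proof -
    have "H y \<in> U" using that HV by blast
    then obtain w where "w \<in> O'" "\<phi> w = H y" using U(2) by force
    then show ?thesis using O(3) \<open>H y \<in> U\<close> GH[OF that] by (intro bexI[of _ w]) (auto simp: W'_def \<phi>'_def)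
  qed
  have im': "\<phi>' ` W' = V" using im GU by (force simp: W'_def \<phi>'_def)
  have Gcont: "continuous_on U G"
    using Ck_on_components_continuous[OF Uo, of G d 0] sG by (auto simp: smooth_between_iff simp del: Ck_on.simps)
  have c': "chart_on (mtop M) (d, W', \<phi>')"
  proof (rule chart_onI[OF W'o inj'])
    have "continuous_map (subtopology (mtop M) W') (subtopology (Euclidean_space d) U) \<phi>"
      using continuous_map_from_subtopology_mono[OF chart_onD(4)[OF co], of W'] by (auto simp: continuous_map_in_subtopology W'_def)
    moreover have "continuous_map (subtopology (Euclidean_space d) U) (Euclidean_space d) G"
      using Gcont sG eopen_subset[OF Uo] by (auto simp: cm_Euclidean_space_iff_continuous_on smooth_between_iff Int_absorb1)
    ultimately have "continuous_map (subtopology (mtop M) W') (Euclidean_space d) (G \<circ> \<phi>)"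
      by (rule continuous_map_compose)
    then show "continuous_map (subtopology (mtop M) W') (Euclidean_space d) \<phi>'"
      by (simp add: comp_def \<phi>'_def[abs_def])
    fix N assume N: "openin (mtop M) N" "N \<subseteq> W'"
    have "eopen d (\<phi> ` N)" using chart_onD(5)[OF co N(1)] N(2) by (simp add: Int_absorb1 W'_def subset_iff)
    then have "eopen d {y \<in> V. H y \<in> \<phi> ` N}" by (rule smooth_between_preimage[OF Vo _ sH])
    moreover have "{y \<in> V. H y \<in> \<phi> ` N} = \<phi>' ` N"
    proof (intro set_eqI iffI)
      fix y assume "y \<in> {y \<in> V. H y \<in> \<phi> ` N}"
      then obtain w where "w \<in> N" "H y = \<phi> w" "y \<in> V" by blast
      then show "y \<in> \<phi>' ` N" using GH[of y] by (intro image_eqI[of _ _ w]) (auto simp: \<phi>'_def)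
    next
      fix y assume "y \<in> \<phi>' ` N"
      then obtain w where w: "w \<in> N" "y = G (\<phi> w)" by (auto simp: \<phi>'_def)
      then have "\<phi> w \<in> U" using N(2) by (auto simp: W'_def)
      then show "y \<in> {y \<in> V. H y \<in> \<phi> ` N}" using w GU HG by auto
    qed
    ultimately show "eopen d (\<phi>' ` N)" by simp
  qed
  have c'm: "(d, W', \<phi>') \<in> maximal_atlas M"
  proof (rule maximal_atlasI[OF M c'])
    fix w assume w: "w \<in> W'"
    have V': "eopen d V" "\<phi>' w \<in> V" using Vo w im' by auto
    have "chart_smooth_at (d, W', \<phi>') (d, W, \<phi>) (\<lambda>x. x) w"
    proof (rule chart_smooth_atI[where U=V])
      have r: "\<phi> (inv_into W' \<phi>' y) = H y" if "y \<in> V" for y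
        using im[OF that] inj' by auto
      show "smooth_between d d V (\<lambda>y. \<phi> (inv_into W' \<phi>' y))"
        by (rule smooth_between_cong[OF Vo sH]) (simp add: r)
      show "\<exists>wa\<in>W'. wa \<in> W \<and> \<phi>' wa = y" if "y \<in> V" for y using im[OF that] by (auto simp: W'_def)
    qed (use w V' inj inj' in \<open>auto simp: W'_def\<close>)
    moreover have "chart_smooth_at (d, W, \<phi>) (d, W', \<phi>') (\<lambda>x. x) w"
    proof (rule chart_smooth_atI[where U=U])
      have r: "inv_into W \<phi> y \<in> W'" "\<phi> (inv_into W \<phi> y) = y" if y: "y \<in> U" for y
      proof -
        have "y \<in> \<phi> ` W" using y U(2) O(3) by blast
        then show "\<phi> (inv_into W \<phi> y) = y" "inv_into W \<phi> y \<in> W'"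
          using y inv_into_into[of y \<phi> W] by (auto simp: W'_def f_inv_into_f)
      qed
      show "smooth_between d d U (\<lambda>y. \<phi>' (inv_into W \<phi> y))"
        by (rule smooth_between_cong[OF Uo sG]) (simp add: r \<phi>'_def)
      show "\<exists>wa\<in>W. wa \<in> W' \<and> \<phi> wa = y" if "y \<in> U" for y
        using r[OF that] by (intro bexI[of _ "inv_into W \<phi> y"]) (auto simp: W'_def)
    qed (use w Uo inj inj' in \<open>auto simp: W'_def\<close>)
    ultimately show "\<exists>e V \<psi>. (e, V, \<psi>) \<in> maximal_atlas M \<and>
      chart_smooth_at (d, W', \<phi>') (e, V, \<psi>) (\<lambda>x. x) w \<and> chart_smooth_at (e, V, \<psi>) (d, W', \<phi>') (\<lambda>x. x) w"
      using c by blast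
  qed
  have mem: "w \<in> S \<longleftrightarrow> \<phi>' w \<in> EE (d - q)" if w: "w \<in> W'" for w
  proof -
    have wU: "\<phi> w \<in> U" using w by (simp add: W'_def)
    have E: "G (\<phi> w) \<in> EE d" using wU sG by (auto simp: smooth_between_iff)
    have "w \<in> S \<longleftrightarrow> (\<forall>j<q. G (\<phi> w) (d - 1 - j) = 0)"
      using S[OF W'O[OF w]] Gg[OF wU] by simp
    also have "\<dots> \<longleftrightarrow> G (\<phi> w) \<in> EE (d - q)"
    proof
      assume z: "\<forall>j<q. G (\<phi> w) (d - 1 - j) = 0"
      show "G (\<phi> w) \<in> EE (d - q)"
        unfolding EE_iff
      proof (intro allI impI)
        fix i assume i: "d - q \<le> i"
        show "G (\<phi> w) i = 0"
        proof (cases "i < d")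
          case True
          then have "d - 1 - i < q" "d - 1 - (d - 1 - i) = i" using i q by auto
          then show ?thesis using z by metis
        next
          case False then show ?thesis using E by (simp add: EE_iff)
        qed
      qed
    next
      assume "G (\<phi> w) \<in> EE (d - q)"
      then show "\<forall>j<q. G (\<phi> w) (d - 1 - j) = 0" using q by (auto simp: EE_iff)
    qed
    finally show ?thesis by (simp add: \<phi>'_def)
  qed
  have "slice_chart M S (d - q) (d, W', \<phi>')"
    unfolding slice_chart_iff using c'm mem by auto
  then show ?thesis using xW' by blast
qed

section \<open>Submersivity at a point: independence of charts and openness\<close>

text \<open>A chart-free reformulation of submersivity at a point: one pair of charts suffices, by
  \<open>submersive_atD\<close> below.\<close>

definition submersive_at :: "'a mfd \<Rightarrow> 'b mfd \<Rightarrow> 'b set \<Rightarrow> ('a \<Rightarrow> 'b) \<Rightarrow> 'a \<Rightarrow> bool" where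
  "submersive_at M A S f x \<longleftrightarrow> (\<exists>d W \<phi> e V \<psi> k.
     (d, W, \<phi>) \<in> maximal_atlas M \<and> slice_chart A S k (e, V, \<psi>) \<and>
     chart_smooth_at (d, W, \<phi>) (e, V, \<psi>) f x \<and>
     (\<forall>w\<in>EE k. \<exists>v\<in>EE d. tangent_map (d, W, \<phi>) (e, V, \<psi>) f x v = w))"

text \<open>On \<open>S\<close> the coordinates of the second chart vanish from \<open>k2\<close>
  on, and a derivative in a direction of \<open>EE k1\<close> only sees points of
  \<open>S\<close>.\<close>

lemma slice_tangent:
  assumes A: "charted A" and s1: "slice_chart A S k1 (e1, V1, \<psi>1)" and s2: "slice_chart A S k2 (e2, V2, \<psi>2)"
    and z: "z \<in> V1" "z \<in> V2" "z \<in> S" and w: "w \<in> EE k1"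
  shows "tangent_map (e1, V1, \<psi>1) (e2, V2, \<psi>2) (\<lambda>x. x) z w \<in> EE k2"
proof -
  have m: "(e1, V1, \<psi>1) \<in> maximal_atlas A" "(e2, V2, \<psi>2) \<in> maximal_atlas A" "k1 \<le> e1" "k2 \<le> e2"
    using s1 s2 by (auto simp: slice_chart_iff)
  obtain U where U: "eopen e1 U" "\<psi>1 z \<in> U"
    "\<And>y. y \<in> U \<Longrightarrow> inv_into V1 \<psi>1 y \<in> V1 \<and> inv_into V1 \<psi>1 y \<in> V2 \<and> \<psi>1 (inv_into V1 \<psi>1 y) = y"
    using chart_smooth_atE[OF maximal_charts_smooth[OF A m(1,2) z(1,2)]] by metis
  have zk: "\<psi>1 z \<in> EE k1" using slice_chart_mem[OF s1 z(1)] z(3) by simp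
  have "Dv e1 (\<lambda>y. \<psi>2 (inv_into V1 \<psi>1 y) l) (\<psi>1 z) w = 0" if l: "l \<ge> k2" for l
  proof -
    have "Dv e1 (\<lambda>y. \<psi>2 (inv_into V1 \<psi>1 y) l) (\<psi>1 z) w = Dv e1 (\<lambda>y. 0) (\<psi>1 z) w"
    proof (rule Dv_cong_subspace[OF U(1,2) zk w])
      fix y assume y: "y \<in> U" "y \<in> EE k1"
      then have "inv_into V1 \<psi>1 y \<in> S" using slice_chart_mem[OF s1] U(3)[OF y(1)] by metis
      then have "\<psi>2 (inv_into V1 \<psi>1 y) \<in> EE k2" using slice_chart_mem[OF s2] U(3)[OF y(1)] by blast
      then show "\<psi>2 (inv_into V1 \<psi>1 y) l = 0" using l by (simp add: EE_iff)
    qed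
    then show ?thesis by (simp add: Dv_def partial_deriv_def)
  qed
  then show ?thesis by (simp add: tangent_map_apply EE_iff)
qed

text \<open>A vector \<open>w\<close> tangent to \<open>S\<close> is carried to the witnessing slice
  chart, where \<open>slice_tangent\<close> keeps it tangent to \<open>S\<close>, lifted there, and
  carried back on the source side. Transition maps are invertible on tangent vectors.\<close>

lemma submersive_atD:
  assumes M: "charted M" and A: "charted A" and f: "submersive_at M A S f x" and fS: "f x \<in> S"
    and c: "(d, W, \<phi>) \<in> maximal_atlas M" "x \<in> W" and s: "slice_chart A S k (e, V, \<psi>)" "f x \<in> V"
  shows "chart_smooth_at (d, W, \<phi>) (e, V, \<psi>) f x"
    "\<And>w. w \<in> EE k \<Longrightarrow> \<exists>v\<in>EE d. tangent_map (d, W, \<phi>) (e, V, \<psi>) f x v = w"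
proof -
  obtain d1 W1 \<phi>1 e1 V1 \<psi>1 k1 where 1: "(d1, W1, \<phi>1) \<in> maximal_atlas M" "slice_chart A S k1 (e1, V1, \<psi>1)"
    "chart_smooth_at (d1, W1, \<phi>1) (e1, V1, \<psi>1) f x"
    "\<And>w. w \<in> EE k1 \<Longrightarrow> \<exists>v\<in>EE d1. tangent_map (d1, W1, \<phi>1) (e1, V1, \<psi>1) f x v = w"
    using f unfolding submersive_at_def by blast
  note p = chart_smooth_at_points[OF 1(3)]
  have m: "(e1, V1, \<psi>1) \<in> maximal_atlas A" "(e, V, \<psi>) \<in> maximal_atlas A" "k1 \<le> e1" "k \<le> e"
    using 1(2) s by (auto simp: slice_chart_iff)
  note c1 = maximal_charts_smooth[OF M c(1) 1(1) c(2) p(1)]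
  note c2 = maximal_charts_smooth[OF A m(1,2) p(2) s(2)]
  note cf = chart_smooth_at_compose[OF c1 1(3)]
  show "chart_smooth_at (d, W, \<phi>) (e, V, \<psi>) f x"
    by (rule chart_smooth_at_compose[OF cf c2])
  show "\<exists>v\<in>EE d. tangent_map (d, W, \<phi>) (e, V, \<psi>) f x v = w" if w: "w \<in> EE k" for w
  proof -
    define w1 where "w1 = tangent_map (e, V, \<psi>) (e1, V1, \<psi>1) (\<lambda>x. x) (f x) w"
    have "w1 \<in> EE k1" unfolding w1_def by (rule slice_tangent[OF A s(1) 1(2) s(2) p(2) fS w])
    then obtain v1 where v1: "v1 \<in> EE d1" "tangent_map (d1, W1, \<phi>1) (e1, V1, \<psi>1) f x v1 = w1" using 1(4) by blast
    define v where "v = tangent_map (d1, W1, \<phi>1) (d, W, \<phi>) (\<lambda>x. x) x v1"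
    have vE: "v \<in> EE d" unfolding v_def by (rule tangent_map_EE)
    have wE: "w \<in> EE e" using w m(4) by (auto simp: EE_iff)
    have "tangent_map (d, W, \<phi>) (d1, W1, \<phi>1) (\<lambda>x. x) x v = v1"
      unfolding v_def by (rule tangent_map_inverse[OF M 1(1) c(1) p(1) c(2) v1(1)])
    then have "tangent_map (d, W, \<phi>) (e1, V1, \<psi>1) f x v = w1"
      using tangent_map_compose[OF c1 1(3), of v] v1(2) by simp
    then have "tangent_map (d, W, \<phi>) (e, V, \<psi>) f x v = tangent_map (e1, V1, \<psi>1) (e, V, \<psi>) (\<lambda>x. x) (f x) w1"
      using tangent_map_compose[OF cf c2, of v] by simp
    also have "\<dots> = w"
      unfolding w1_def by (rule tangent_map_inverse[OF A m(2,1) s(2) p(2) wE])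
    finally show ?thesis using vE by (rule bexI)
  qed
qed

text \<open>As \<open>f\<close> takes values in \<open>S\<close>, only its first \<open>k\<close>
  components in the slice chart matter. Straightening them at \<open>x\<close> turns them into
  coordinates on a whole neighborhood, where their derivative is then surjective as well.\<close>

lemma openin_submersive_at:
  assumes M: "charted M" and A: "charted A" and O: "openin (mtop M) O'"
    and f: "smooth_map (open_submanifold M O') A f" and fS: "f ` O' \<subseteq> S"
  shows "openin (mtop M) {x \<in> O'. submersive_at M A S f x}"
proof (subst openin_subopen, intro ballI)
  fix x assume x: "x \<in> {x \<in> O'. submersive_at M A S f x}"
  note MO = charted_open_submanifold[OF M O]
  have xM: "x \<in> points (open_submanifold M O')" using x openin_subset[OF O] by auto
  obtain d W \<phi> where c: "(d, W, \<phi>) \<in> atlas (open_submanifold M O')" "x \<in> W" using chart_at[OF MO xM] by blast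
  have cm1: "(d, W, \<phi>) \<in> maximal_atlas (open_submanifold M O')" using c(1) atlas_subset_maximal[OF MO] by blast
  note cm = open_submanifold_maximal_atlas[OF M O cm1]
  have WO: "W \<subseteq> O'" using c(1) by auto
  from x obtain d0 W0 \<phi>0 e V \<psi> k where s0: "slice_chart A S k (e, V, \<psi>)" "chart_smooth_at (d0, W0, \<phi>0) (e, V, \<psi>) f x"
    unfolding submersive_at_def by blast
  note s = s0(1) chart_smooth_at_points(2)[OF s0(2)]
  have sm: "(e, V, \<psi>) \<in> maximal_atlas A" "k \<le> e" using s by (auto simp: slice_chart_iff)
  have fx: "f x \<in> S" using x fS by blast
  have sub: "submersive_at M A S f x" using x by blast
  note D = submersive_atD[OF M A sub fx cm c(2) s]
  obtain U where U: "inj_on \<phi> W" "eopen d U" "\<phi> x \<in> U"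
    "\<And>y. y \<in> U \<Longrightarrow> inv_into W \<phi> y \<in> W \<and> f (inv_into W \<phi> y) \<in> V \<and> \<phi> (inv_into W \<phi> y) = y"
    "smooth_between d e U (\<lambda>y. \<psi> (f (inv_into W \<phi> y)))"
    using chart_smooth_atE[OF D(1)] by metis
  define F where "F = (\<lambda>y. \<psi> (f (inv_into W \<phi> y)))"
  have Fk: "Ck_on i d U (\<lambda>y. F y j)" if "j < k" for i j
    using U(5) that sm(2) by (simp add: smooth_between_iff F_def)
  have "surjective_derivative d k F (\<phi> x)"
    unfolding surjective_derivative_iff
  proof
    fix w assume "w \<in> EE k"
    then obtain v where v: "v \<in> EE d" "tangent_map (d, W, \<phi>) (e, V, \<psi>) f x v = w" using D(2) by blast
    have "Dv d (\<lambda>y. F y j) (\<phi> x) v = w j" if "j < k" for j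
      using fun_cong[OF v(2), of j] that sm(2) by (simp add: tangent_map_apply F_def)
    then show "\<exists>v\<in>EE d. \<forall>j<k. Dv d (\<lambda>y. F y j) (\<phi> x) v = w j" using v(1) by blast
  qed
  from straighten[OF U(2,3) Fk this] obtain U' V' G H where k: "k \<le> d"
    and U': "\<phi> x \<in> U'" "U' \<subseteq> U" "diffeo d U' V' G H"
    and GF: "\<And>y j. y \<in> U' \<Longrightarrow> j < k \<Longrightarrow> G y (d - 1 - j) = F y j" by blast
  define N where "N = {w \<in> W. \<phi> w \<in> U'}"
  have "openin (mtop M) N"
    unfolding N_def using U'(3) by (intro chart_onD(6)[OF maximal_chart_on[OF cm]]) (simp add: diffeo_def)
  moreover have "x \<in> N" using c(2) U'(1) by (simp add: N_def)
  moreover have "N \<subseteq> {x \<in> O'. submersive_at M A S f x}"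
  proof
    fix z assume z: "z \<in> N"
    then have zW: "z \<in> W" "\<phi> z \<in> U'" by (auto simp: N_def)
    have zO: "z \<in> O'" using zW WO by blast
    have fzV: "f z \<in> V" using U(4)[of "\<phi> z"] zW U'(2) U(1) by (auto simp: subset_iff)
    have cs: "chart_smooth_at (d, W, \<phi>) (e, V, \<psi>) f z"
      by (rule smooth_map_chart_smooth_at[OF MO A f cm1 sm(1) zW(1) fzV])
    have surj: "surjective_derivative d k F (\<phi> z)"
      by (rule straightened_surjective[OF U'(3) k _ GF zW(2)]) (use Fk Ck_on_subset U'(2) in blast)+
    \<comment> \<open>The components from \<open>k\<close> on vanish identically near
      \<open>z\<close>, because the values of \<open>f\<close> lie in \<open>S\<close>; hence so do
      their derivatives.\<close>
    have kz: "tangent_map (d, W, \<phi>) (e, V, \<psi>) f z v \<in> EE k" for v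
    proof -
      have "Dv d (\<lambda>y. F y l) (\<phi> z) v = 0" if l: "l \<ge> k" for l
      proof -
        have "F y l = 0" if y: "y \<in> U" for y
        proof -
          have "f (inv_into W \<phi> y) \<in> S" "f (inv_into W \<phi> y) \<in> V" using U(4)[OF y] WO fS by blast+
          then show ?thesis using slice_chart_mem[OF s(1)] l by (simp add: F_def EE_iff)
        qed
        then have "Dv d (\<lambda>y. F y l) (\<phi> z) v = Dv d (\<lambda>y. 0) (\<phi> z) v"
          using zW(2) U'(2) by (intro Dv_cong[OF U(2)]) auto
        then show ?thesis by (simp add: Dv_def partial_deriv_def)
      qed
      then show ?thesis by (simp add: tangent_map_apply EE_iff F_def)
    qed
    have "\<exists>v\<in>EE d. tangent_map (d, W, \<phi>) (e, V, \<psi>) f z v = w" if w: "w \<in> EE k" for w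
    proof -
      obtain v where v: "v \<in> EE d" "\<And>j. j < k \<Longrightarrow> Dv d (\<lambda>y. F y j) (\<phi> z) v = w j"
        using surj w unfolding surjective_derivative_iff by blast
      have "tangent_map (d, W, \<phi>) (e, V, \<psi>) f z v = w"
        by (rule EE_eqI[OF kz w]) (use v(2) sm(2) in \<open>simp add: tangent_map_apply F_def\<close>)
      then show ?thesis using v(1) by blast
    qed
    then show "z \<in> {x \<in> O'. submersive_at M A S f x}"
      using zO cm s(1) cs unfolding submersive_at_def by blast
  qed
  ultimately show "\<exists>T. openin (mtop M) T \<and> x \<in> T \<and> T \<subseteq> {x \<in> O'. submersive_at M A S f x}" by blast
qed

text \<open>A chart of \<open>submanifold A S\<close> is a slice chart with its dimension cut down
  to \<open>k\<close>. The discarded coordinates vanish on the image of \<open>f\<close>, so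
  smoothness and surjectivity pass to the shorter chart.\<close>

lemma submersionI:
  assumes M: "charted M" and A: "charted A" and f: "smooth_map M A f" and fS: "f ` points M \<subseteq> S"
    and sub: "\<And>x. x \<in> points M \<Longrightarrow> submersive_at M A S f x"
  shows "submersion M (submanifold A S) f"
proof -
  have main: "chart_smooth_at (d, W, \<phi>) (k, V \<inter> S, \<psi>) f x \<and>
      surjective_derivative d k (\<psi> \<circ> f \<circ> inv_into W \<phi>) (\<phi> x)"
    if c: "(d, W, \<phi>) \<in> atlas M" and s: "slice_chart A S k (e, V, \<psi>)" and x: "x \<in> W" "f x \<in> V" for d W \<phi> k e V \<psi> x
  proof -
    have cm: "(d, W, \<phi>) \<in> maximal_atlas M" using c atlas_subset_maximal[OF M] by blast
    have WM: "W \<subseteq> points M" using openin_subset[OF chart_onD(1)[OF maximal_chart_on[OF cm]]] .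
    have xS: "f x \<in> S" using x WM fS by blast
    have ke: "k \<le> e" using s by (simp add: slice_chart_iff)
    note D = submersive_atD[OF M A sub[OF subsetD[OF WM x(1)]] xS cm x(1) s x(2)]
    obtain U where U: "inj_on \<phi> W" "inj_on \<psi> V" "eopen d U" "\<phi> x \<in> U"
      "\<And>y. y \<in> U \<Longrightarrow> inv_into W \<phi> y \<in> W \<and> f (inv_into W \<phi> y) \<in> V \<and> \<phi> (inv_into W \<phi> y) = y"
      "smooth_between d e U (\<lambda>y. \<psi> (f (inv_into W \<phi> y)))"
      using chart_smooth_atE[OF D(1)] by metis
    have US: "f (inv_into W \<phi> y) \<in> S" if "y \<in> U" for y using U(5)[OF that] WM fS by blast
    have "chart_smooth_at (d, W, \<phi>) (k, V \<inter> S, \<psi>) f x"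
    proof (rule chart_smooth_atI[where U=U])
      show "x \<in> W" "f x \<in> V \<inter> S" "inj_on \<phi> W" "eopen d U" "\<phi> x \<in> U" using x xS U by auto
      show "inj_on \<psi> (V \<inter> S)" using U(2) by (rule inj_on_subset) simp
      show "\<exists>w\<in>W. f w \<in> V \<inter> S \<and> \<phi> w = y" if "y \<in> U" for y using U(5)[OF that] US[OF that] by blast
      have "\<psi> (f (inv_into W \<phi> y)) \<in> EE k" if "y \<in> U" for y
        using slice_chart_mem[OF s] U(5)[OF that] US[OF that] by blast
      then show "smooth_between d k U (\<lambda>y. \<psi> (f (inv_into W \<phi> y)))"
        using U(6) ke by (auto simp: smooth_between_iff)
    qed
    moreover have "surjective_derivative d k (\<psi> \<circ> f \<circ> inv_into W \<phi>) (\<phi> x)"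
      unfolding surjective_derivative_tangent_map[where V=V]
    proof
      fix w assume w: "w \<in> EE k"
      then obtain v where v: "v \<in> EE d" "tangent_map (d, W, \<phi>) (e, V, \<psi>) f x v = w" using D(2) by blast
      have "tangent_map (d, W, \<phi>) (k, V, \<psi>) f x v = w"
      proof (rule EE_eqI[OF tangent_map_EE w])
        fix i assume "i < k"
        then show "tangent_map (d, W, \<phi>) (k, V, \<psi>) f x v i = w i"
          using fun_cong[OF v(2), of i] ke by (simp add: tangent_map_apply)
      qed
      then show "\<exists>v\<in>EE d. tangent_map (d, W, \<phi>) (k, V, \<psi>) f x v = w" using v(1) by blast
    qed
    ultimately show ?thesis by blast
  qed
  have "continuous_map (mtop M) (mtop A) f" using f by (simp add: smooth_map_def)
  then have cont: "continuous_map (mtop M) (mtop (submanifold A S)) f"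
    using fS by (auto simp: submanifold_def continuous_map_in_subtopology)
  have atl: "\<exists>e V. slice_chart A S k (e, V, \<psi>) \<and> V' = V \<inter> S" if "(k, V', \<psi>) \<in> atlas (submanifold A S)" for k V' \<psi>
    using that by (auto simp: submanifold_def)
  have "smooth_map M (submanifold A S) f"
  proof (rule smooth_mapI[OF cont])
    fix d W \<phi> k V' \<psi> x assume h: "(d, W, \<phi>) \<in> atlas M" "(k, V', \<psi>) \<in> atlas (submanifold A S)" "x \<in> W" "f x \<in> V'"
    obtain e V where "slice_chart A S k (e, V, \<psi>)" "V' = V \<inter> S" using atl[OF h(2)] by blast
    then show "chart_smooth_at (d, W, \<phi>) (k, V', \<psi>) f x" using main[OF h(1) _ h(3)] h(4) by blast
  qed
  moreover have "surjective_derivative d k (\<psi> \<circ> f \<circ> inv_into W \<phi>) (\<phi> x)"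
    if h: "(d, W, \<phi>) \<in> atlas M" "(k, V', \<psi>) \<in> atlas (submanifold A S)" "x \<in> W" "f x \<in> V'" for d W \<phi> k V' \<psi> x
  proof -
    obtain e V where "slice_chart A S k (e, V, \<psi>)" "V' = V \<inter> S" using atl[OF h(2)] by blast
    then show ?thesis using main[OF h(1) _ h(3)] h(4) by blast
  qed
  ultimately show ?thesis unfolding submersion_def by auto
qed

section \<open>Fiber products along submersions\<close>

text \<open>The fiber product of \<open>q: S' \<rightarrow> S''\<close> along the submersion \<open>p: B \<rightarrow> S''\<close> is locally cut out by the equations
  of \<open>S'\<close> together with \<open>p = q\<close> read in the coordinates of \<open>S''\<close>.\<close>

lemma embedded_fiber_product:
  assumes A: "charted A" "charted A'" "charted A''" "charted B"
    and r: "smooth_map A A' r" and b: "smooth_map A B b" and q: "smooth_map A' A'' q" and p: "smooth_map B A'' p"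
    and S': "embedded_submanifold A' S'" and S'': "embedded_submanifold A'' S''"
    and qS: "q ` S' \<subseteq> S''" and pS: "p ` points B \<subseteq> S''"
    and sub: "\<And>y. y \<in> points B \<Longrightarrow> submersive_at B A'' S'' p y"
    and joint: "\<And>z. z \<in> points A \<Longrightarrow> \<exists>d W \<phi> d1 W1 \<phi>1 d2 W2 \<phi>2.
      (d, W, \<phi>) \<in> maximal_atlas A \<and> (d1, W1, \<phi>1) \<in> maximal_atlas A' \<and> (d2, W2, \<phi>2) \<in> maximal_atlas B \<and>
      z \<in> W \<and> r z \<in> W1 \<and> b z \<in> W2 \<and>
      (\<forall>u\<in>EE d1. \<forall>v\<in>EE d2. \<exists>t\<in>EE d. tangent_map (d, W, \<phi>) (d1, W1, \<phi>1) r z t = u \<and>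
        tangent_map (d, W, \<phi>) (d2, W2, \<phi>2) b z t = v)"
  shows "embedded_submanifold A {z \<in> points A. r z \<in> S' \<and> p (b z) = q (r z)}"
  unfolding embedded_submanifold_def
proof (intro conjI ballI)
  let ?S = "{z \<in> points A. r z \<in> S' \<and> p (b z) = q (r z)}"
  show "?S \<subseteq> points A" by blast
  fix z assume z: "z \<in> ?S"
  then have zA: "z \<in> points A" and zS: "r z \<in> S'" and zpq: "p (b z) = q (r z)" by auto
  obtain d W \<phi> d1 W1 \<phi>1 d2 W2 \<phi>2 where
    c: "(d, W, \<phi>) \<in> maximal_atlas A" "(d1, W1, \<phi>1) \<in> maximal_atlas A'" "(d2, W2, \<phi>2) \<in> maximal_atlas B"
      "z \<in> W" "r z \<in> W1" "b z \<in> W2"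
    and jt: "\<And>u v. u \<in> EE d1 \<Longrightarrow> v \<in> EE d2 \<Longrightarrow> \<exists>t\<in>EE d. tangent_map (d, W, \<phi>) (d1, W1, \<phi>1) r z t = u \<and>
        tangent_map (d, W, \<phi>) (d2, W2, \<phi>2) b z t = v"
    using joint[OF zA] by metis
  obtain k' e' V' \<psi>' where s': "slice_chart A' S' k' (e', V', \<psi>')" "r z \<in> V'"
    using S' zS unfolding embedded_submanifold_def by blast
  have qz: "q (r z) \<in> S''" using zS qS by blast
  obtain k'' e'' V'' \<psi>'' where s'': "slice_chart A'' S'' k'' (e'', V'', \<psi>'')" "q (r z) \<in> V''"
    using S'' qz unfolding embedded_submanifold_def by blast
  have m': "(e', V', \<psi>') \<in> maximal_atlas A'" "k' \<le> e'" and m'': "(e'', V'', \<psi>'') \<in> maximal_atlas A''" "k'' \<le> e''"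
    using s' s'' by (auto simp: slice_chart_iff)
  have cr: "continuous_map (mtop A) (mtop A') r" and cb: "continuous_map (mtop A) (mtop B) b"
    and cq: "continuous_map (mtop A') (mtop A'') q" and cp: "continuous_map (mtop B) (mtop A'') p"
    using r b q p by (auto simp: smooth_map_def)
  have bz: "b y \<in> points B" if "y \<in> points A" for y using cb that continuous_map_image_subset_topspace by blast
  have cqr: "continuous_map (mtop A) (mtop A'') (\<lambda>y. q (r y))" and cpb: "continuous_map (mtop A) (mtop A'') (\<lambda>y. p (b y))"
    using continuous_map_compose[OF cr cq] continuous_map_compose[OF cb cp] by (simp_all add: comp_def)
  have o'': "openin (mtop A'') V''" and o': "openin (mtop A') V'"
    using chart_onD(1) maximal_chart_on m' m'' by blast+
  have Wo: "openin (mtop A) W" using chart_onD(1) maximal_chart_on c(1) by blast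
  have WA: "W \<subseteq> points A" by (rule openin_subset[OF Wo])
  \<comment> \<open>Where the slice chart of \<open>S'\<close> is available at \<open>r y\<close>
    and that of \<open>S''\<close> at both \<open>q (r y)\<close> and
    \<open>p (b y)\<close>.\<close>
  define O' where "O' = W \<inter> {y \<in> points A. r y \<in> V'} \<inter> {y \<in> points A. q (r y) \<in> V''} \<inter> {y \<in> points A. p (b y) \<in> V''}"
  have O'o: "openin (mtop A) O'"
    unfolding O'_def by (intro openin_Int Wo openin_continuous_map_preimage[OF cr o'] openin_continuous_map_preimage[OF cqr o'']
        openin_continuous_map_preimage[OF cpb o''])
  have zO: "z \<in> O'" using zA c(4) s'(2) s''(2) zpq by (simp add: O'_def)
  have O'W: "O' \<subseteq> W" by (auto simp: O'_def)
  let ?c = "(d, W, \<phi>)"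
  have csr: "chart_smooth_at ?c (e', V', \<psi>') r y" if "y \<in> W" "r y \<in> V'" for y
    by (rule smooth_map_chart_smooth_at[OF A(1,2) r c(1) m'(1) that])
  have csqr: "chart_smooth_at ?c (e'', V'', \<psi>'') (\<lambda>y. q (r y)) y" if "y \<in> W" "q (r y) \<in> V''" for y
    by (rule smooth_map_chart_smooth_at[OF A(1,3) smooth_map_compose[OF A(1,2,3) r q] c(1) m''(1) that])
  have cspb: "chart_smooth_at ?c (e'', V'', \<psi>'') (\<lambda>y. p (b y)) y" if "y \<in> W" "p (b y) \<in> V''" for y
    by (rule smooth_map_chart_smooth_at[OF A(1,3) smooth_map_compose[OF A(1,4,3) b p] c(1) m''(1) that])
  define R where "R = (\<lambda>y. \<psi>' (r (inv_into W \<phi> y)))"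
  define Q where "Q = (\<lambda>y. \<psi>'' (q (r (inv_into W \<phi> y))))"
  define P where "P = (\<lambda>y. \<psi>'' (p (b (inv_into W \<phi> y))))"
  have inv: "inv_into W \<phi> (\<phi> y) = y" if "y \<in> W" for y using chart_onD(3)[OF maximal_chart_on[OF c(1)]] that by simp
  have O'im: "eopen d (\<phi> ` O')" using chart_onD(5)[OF maximal_chart_on[OF c(1)] O'o] O'W by (simp add: Int_absorb1)
  have sR: "smooth_between d e' (\<phi> ` O') R"
    by (rule smooth_between_subset[OF smooth_between_chart[OF csr, unfolded comp_def, folded R_def]]) (auto simp: O'_def)
  have sQ: "smooth_between d e'' (\<phi> ` O') Q"
    by (rule smooth_between_subset[OF smooth_between_chart[OF csqr, unfolded comp_def, folded Q_def]]) (auto simp: O'_def)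
  have sP: "smooth_between d e'' (\<phi> ` O') P"
    by (rule smooth_between_subset[OF smooth_between_chart[OF cspb, unfolded comp_def, folded P_def]]) (auto simp: O'_def)
  define n where "n = e' - k'"
  \<comment> \<open>The \<open>n\<close> normal coordinates of \<open>S'\<close>, followed by the
    differences of the \<open>k''\<close> coordinates along \<open>S''\<close>. Comparing all
    \<open>e''\<close> coordinates would spoil regularity, since \<open>p\<close> is submersive onto
    \<open>S''\<close> only.\<close>
  define g where "g y j = (if j < n then R y (k' + j) else P y (j - n) - Q y (j - n))" for y j
  show "\<exists>k d W \<phi>. slice_chart A ?S k (d, W, \<phi>) \<and> z \<in> W"
  proof (rule slice_chart_of_equations[OF A(1) c(1) O'o zO O'W, of "n + k''" g])
    fix j k assume j: "j < n + k''"
    show "Ck_on k d (\<phi> ` O') (\<lambda>y. g y j)"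
    proof (cases "j < n")
      case True
      then have "k' + j < e'" by (simp add: n_def)
      then show ?thesis using True sR by (simp add: g_def smooth_between_iff)
    next
      case False
      then have "j - n < e''" using j m''(2) by simp
      then show ?thesis using False sP sQ by (simp add: g_def smooth_between_iff Ck_on_diff[OF O'im])
    qed
  next
    fix y assume y: "y \<in> O'"
    then have yW: "y \<in> W" "r y \<in> V'" "q (r y) \<in> V''" "p (b y) \<in> V''" "y \<in> points A" by (auto simp: O'_def)
    have R0: "R (\<phi> y) = \<psi>' (r y)" and P0: "P (\<phi> y) = \<psi>'' (p (b y))" and Q0: "Q (\<phi> y) = \<psi>'' (q (r y))"
      using inv yW(1) by (auto simp: R_def P_def Q_def)
    have "r y \<in> S' \<longleftrightarrow> (\<forall>j<n. R (\<phi> y) (k' + j) = 0)"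
    proof -
      have E: "\<psi>' (r y) \<in> EE e'" by (rule chart_image_EE[OF maximal_chart_on[OF m'(1)] yW(2)])
      have "\<psi>' (r y) \<in> EE k' \<longleftrightarrow> (\<forall>j<n. \<psi>' (r y) (k' + j) = 0)"
      proof
        assume *: "\<forall>j<n. \<psi>' (r y) (k' + j) = 0"
        show "\<psi>' (r y) \<in> EE k'"
          unfolding EE_iff
        proof (intro allI impI)
          fix i assume i: "k' \<le> i"
          show "\<psi>' (r y) i = 0"
          proof (cases "i < e'")
            case True then show ?thesis using *[rule_format, of "i - k'"] i by (simp add: n_def)
          next
            case False then show ?thesis using E by (simp add: EE_iff)
          qed
        qed
      qed (simp add: EE_iff)
      then show ?thesis using slice_chart_mem[OF s'(1) yW(2)] R0 by simp
    qed
    \<comment> \<open>Off \<open>S'\<close> the map \<open>q\<close> may miss \<open>S''\<close>,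
      and the remaining coordinates could differ; but there the first \<open>n\<close> equations
      already fail.\<close>
    moreover have "p (b y) = q (r y) \<longleftrightarrow> (\<forall>j<k''. P (\<phi> y) j - Q (\<phi> y) j = 0)" if "r y \<in> S'"
    proof -
      have "q (r y) \<in> S''" "p (b y) \<in> S''" using that qS pS bz yW(5) by blast+
      then have E: "\<psi>'' (q (r y)) \<in> EE k''" "\<psi>'' (p (b y)) \<in> EE k''" using slice_chart_mem[OF s''(1)] yW by blast+
      have "p (b y) = q (r y) \<longleftrightarrow> \<psi>'' (p (b y)) = \<psi>'' (q (r y))"
        using chart_onD(3)[OF maximal_chart_on[OF m''(1)]] yW(3,4) by (auto dest: inj_onD)
      also have "\<dots> \<longleftrightarrow> (\<forall>j<k''. \<psi>'' (p (b y)) j = \<psi>'' (q (r y)) j)"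
        using EE_eqI[OF E(2,1)] by auto
      finally show ?thesis by (simp add: P0 Q0)
    qed
    moreover have "(\<forall>j<n + k''. g (\<phi> y) j = 0) \<longleftrightarrow>
        (\<forall>j<n. R (\<phi> y) (k' + j) = 0) \<and> (\<forall>j<k''. P (\<phi> y) j - Q (\<phi> y) j = 0)"
    proof (intro iffI conjI allI impI)
      fix j assume *: "\<forall>j<n + k''. g (\<phi> y) j = 0"
      show "R (\<phi> y) (k' + j) = 0" if "j < n" using *[rule_format, of j] that by (simp add: g_def)
      show "P (\<phi> y) j - Q (\<phi> y) j = 0" if "j < k''" using *[rule_format, of "n + j"] that by (simp add: g_def)
    next
      fix j assume "(\<forall>j<n. R (\<phi> y) (k' + j) = 0) \<and> (\<forall>j<k''. P (\<phi> y) j - Q (\<phi> y) j = 0)" "j < n + k''"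
      then show "g (\<phi> y) j = 0" by (simp add: g_def)
    qed
    ultimately show "y \<in> ?S \<longleftrightarrow> (\<forall>j<n + k''. g (\<phi> y) j = 0)" using yW(5) by blast
  next
    show "surjective_derivative d (n + k'') g (\<phi> z)"
      unfolding surjective_derivative_iff
    proof
      fix w assume w: "w \<in> EE (n + k'')"
      \<comment> \<open>Realizes the first \<open>n\<close> entries of \<open>w\<close> in the
        directions normal to \<open>S'\<close>.\<close>
      define v' where "v' = (\<lambda>i. if k' \<le> i \<and> i < e' then w (i - k') else 0)"
      have v'E: "v' \<in> EE e'" by (simp add: v'_def EE_iff)
      define qv where "qv = tangent_map (e', V', \<psi>') (e'', V'', \<psi>'') q (r z) v'"
      \<comment> \<open>The lift through \<open>p\<close> has to compensate what \<open>q\<close>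
        does to \<open>v'\<close>. As \<open>v'\<close> is not tangent to \<open>S'\<close>, the
        vector \<open>qv\<close> need not lie in \<open>EE k''\<close>; cutting it off keeps what
        the equations see and makes submersivity of \<open>p\<close> applicable.\<close>
      define w'' where "w'' = (\<lambda>j. if j < k'' then w (n + j) + qv j else 0)"
      have "w'' \<in> EE k''" by (simp add: w''_def EE_iff)
      then obtain u where u: "u \<in> EE d2" "tangent_map (d2, W2, \<phi>2) (e'', V'', \<psi>'') p (b z) u = w''"
        using submersive_atD(2)[OF A(4,3) sub[OF bz[OF zA]] _ c(3,6) s''(1)] zpq s''(2) qz by metis
      obtain t where t: "t \<in> EE d" "tangent_map ?c (d1, W1, \<phi>1) r z t = tangent_map (e', V', \<psi>') (d1, W1, \<phi>1) (\<lambda>x. x) (r z) v'"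
          "tangent_map ?c (d2, W2, \<phi>2) b z t = u"
        using jt[OF tangent_map_EE[where d=e' and W=V' and \<phi>=\<psi>' and f="\<lambda>x. x" and x="r z" and v=v'] u(1)] by blast
      have Tr: "tangent_map ?c (e', V', \<psi>') r z t = v'"
      proof -
        have "tangent_map ?c (e', V', \<psi>') r z t = tangent_map (d1, W1, \<phi>1) (e', V', \<psi>') (\<lambda>x. x) (r z) (tangent_map ?c (d1, W1, \<phi>1) r z t)"
          by (rule tangent_map_compose[OF smooth_map_chart_smooth_at[OF A(1,2) r c(1,2,4,5)]
              maximal_charts_smooth[OF A(2) c(2) m'(1) c(5) s'(2)]])
        then show ?thesis
          unfolding t(2) using tangent_map_inverse[OF A(2) m'(1) c(2) s'(2) c(5) v'E] by simp
      qed
      have Tqr: "tangent_map ?c (e'', V'', \<psi>'') (\<lambda>y. q (r y)) z t = qv"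
        unfolding qv_def Tr[symmetric]
        by (rule tangent_map_compose[OF csr[OF c(4) s'(2)] smooth_map_chart_smooth_at[OF A(2,3) q m'(1) m''(1) s'(2) s''(2)]])
      have Tpb: "tangent_map ?c (e'', V'', \<psi>'') (\<lambda>y. p (b y)) z t = w''"
      proof -
        have "p (b z) \<in> V''" using zpq s''(2) by simp
        from tangent_map_compose[OF smooth_map_chart_smooth_at[OF A(1,4) b c(1,3,4,6)]
            smooth_map_chart_smooth_at[OF A(4,3) p c(3) m''(1) c(6) this], of t]
        show ?thesis unfolding t(3) u(2) .
      qed
      have "Dv d (\<lambda>y. g y j) (\<phi> z) t = w j" if j: "j < n + k''" for j
      proof (cases "j < n")
        case True
        then have "k' + j < e'" by (simp add: n_def)
        then have "Dv d (\<lambda>y. R y (k' + j)) (\<phi> z) t = v' (k' + j)"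
          using fun_cong[OF Tr, of "k' + j"] by (simp add: tangent_map_apply R_def)
        then show ?thesis using True \<open>k' + j < e'\<close> by (simp add: g_def v'_def)
      next
        case False
        define i where "i = j - n"
        have i: "i < k''" "i < e''" using False j m''(2) by (auto simp: i_def)
        have "Dv d (\<lambda>y. P y i - Q y i) (\<phi> z) t = Dv d (\<lambda>y. P y i) (\<phi> z) t - Dv d (\<lambda>y. Q y i) (\<phi> z) t"
          by (rule Dv_diff[where U="\<phi> ` O'"]) (use sP sQ i zO in \<open>simp_all add: smooth_between_iff del: Ck_on.simps\<close>)
        also have "\<dots> = w'' i - qv i"
          using fun_cong[OF Tpb, of i] fun_cong[OF Tqr, of i] i by (simp add: tangent_map_apply P_def Q_def)
        also have "\<dots> = w j" using i(1) False by (simp add: w''_def i_def)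
        finally show ?thesis using False by (simp add: g_def i_def)
      qed
      then show "\<exists>v\<in>EE d. \<forall>j<n + k''. Dv d (\<lambda>y. g y j) (\<phi> z) v = w j" using t(1) by blast
    qed
  qed
qed

section \<open>Identities between maps carried over to tangent maps\<close>

text \<open>Functoriality of the tangent map, for transporting the simplicial identities to tangent
  spaces at base points.\<close>

lemma tangent_square:
  assumes M: "charted M" and N: "charted N" and N': "charted N'" and P: "charted P"
    and f: "smooth_map M N f" and g: "smooth_map N P g" and f': "smooth_map M N' f'" and g': "smooth_map N' P g'"
    and eq: "\<And>y. y \<in> points M \<Longrightarrow> g (f y) = g' (f' y)"
    and c: "(d, W, \<phi>) \<in> maximal_atlas M" "(e, V, \<psi>) \<in> maximal_atlas N" "(e', V', \<psi>') \<in> maximal_atlas N'"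
      "(h, Z, \<theta>) \<in> maximal_atlas P"
    and x: "x \<in> W" "f x \<in> V" "f' x \<in> V'" "g (f x) \<in> Z"
  shows "tangent_map (e, V, \<psi>) (h, Z, \<theta>) g (f x) (tangent_map (d, W, \<phi>) (e, V, \<psi>) f x v) =
    tangent_map (e', V', \<psi>') (h, Z, \<theta>) g' (f' x) (tangent_map (d, W, \<phi>) (e', V', \<psi>') f' x v)"
proof -
  have WM: "W \<subseteq> points M" using openin_subset[OF chart_onD(1)[OF maximal_chart_on[OF c(1)]]] .
  have x': "g' (f' x) \<in> Z" using eq x(1,4) WM by auto
  note 1 = smooth_map_chart_smooth_at[OF M N f c(1,2) x(1,2)] smooth_map_chart_smooth_at[OF N P g c(2,4) x(2,4)]
  note 2 = smooth_map_chart_smooth_at[OF M N' f' c(1,3) x(1,3)] smooth_map_chart_smooth_at[OF N' P g' c(3,4) x(3) x']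
  have "tangent_map (d, W, \<phi>) (h, Z, \<theta>) (\<lambda>y. g (f y)) x v = tangent_map (d, W, \<phi>) (h, Z, \<theta>) (\<lambda>y. g' (f' y)) x v"
    by (rule chart_smooth_at_cong(2)[OF chart_smooth_at_compose[OF 1]]) (use eq WM in blast)
  then show ?thesis using tangent_map_compose[OF 1, of v] tangent_map_compose[OF 2, of v] by simp
qed

lemma tangent_retraction:
  assumes M: "charted M" and N: "charted N" and f: "smooth_map M N f" and g: "smooth_map N M g"
    and eq: "\<And>y. y \<in> points M \<Longrightarrow> g (f y) = y"
    and c: "(d, W, \<phi>) \<in> maximal_atlas M" "(e, V, \<psi>) \<in> maximal_atlas N"
    and x: "x \<in> W" "f x \<in> V" and v: "v \<in> EE d"
  shows "tangent_map (e, V, \<psi>) (d, W, \<phi>) g (f x) (tangent_map (d, W, \<phi>) (e, V, \<psi>) f x v) = v"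
proof -
  have WM: "W \<subseteq> points M" using openin_subset[OF chart_onD(1)[OF maximal_chart_on[OF c(1)]]] .
  have x': "g (f x) \<in> W" using eq x(1) WM by auto
  note 1 = smooth_map_chart_smooth_at[OF M N f c(1,2) x(1,2)] smooth_map_chart_smooth_at[OF N M g c(2,1) x(2) x']
  have "tangent_map (d, W, \<phi>) (d, W, \<phi>) (\<lambda>y. g (f y)) x v = tangent_map (d, W, \<phi>) (d, W, \<phi>) (\<lambda>y. y) x v"
    by (rule chart_smooth_at_cong(2)[OF chart_smooth_at_compose[OF 1]]) (use eq WM in blast)
  then show ?thesis
    using tangent_map_compose[OF 1, of v] tangent_map_id[OF maximal_charts_smooth[OF M c(1,1) x(1,1)] v] by simp
qed

text \<open>The maps agree on \<open>S\<close> only, but \<open>w\<close> is tangent to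
  \<open>S\<close>. This differentiates the horn conditions, which hold nowhere but on the
  horn.\<close>

lemma tangent_map_eq_on_slice:
  assumes s: "slice_chart A S k (d, W, \<phi>)" and z: "z \<in> W" "z \<in> S" and w: "w \<in> EE k"
    and eq: "\<And>y. y \<in> W \<Longrightarrow> y \<in> S \<Longrightarrow> f y = g y"
  shows "tangent_map (d, W, \<phi>) (e, V, \<psi>) f z w = tangent_map (d, W, \<phi>) (e, V, \<psi>) g z w"
proof -
  have c: "chart_on (mtop A) (d, W, \<phi>)" "k \<le> d" using s maximal_chart_on by (auto simp: slice_chart_iff)
  have zk: "\<phi> z \<in> EE k" using slice_chart_mem[OF s z(1)] z(2) by simp
  have "Dv d (\<lambda>y. \<psi> (f (inv_into W \<phi> y)) l) (\<phi> z) w = Dv d (\<lambda>y. \<psi> (g (inv_into W \<phi> y)) l) (\<phi> z) w" for l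
  proof (rule Dv_cong_subspace[OF chart_onD(2)[OF c(1)] imageI[OF z(1)] zk w])
    fix y assume y: "y \<in> \<phi> ` W" "y \<in> EE k"
    then have "inv_into W \<phi> y \<in> W" "inv_into W \<phi> y \<in> S"
      using slice_chart_mem[OF s] inv_into_into[OF y(1)] f_inv_into_f[OF y(1)] by auto
    then show "\<psi> (f (inv_into W \<phi> y)) l = \<psi> (g (inv_into W \<phi> y)) l" using eq by simp
  qed
  then show ?thesis by (simp add: tangent_map_apply fun_eq_iff)
qed

section \<open>Linear horns\<close>

text \<open>Moore's algorithm: correct the faces \<open>0, \<dots>, i - 1\<close> in increasing order by \<open>S j\<close> of the defect, then
  the faces \<open>m, \<dots>, i + 1\<close> in decreasing order by \<open>S (j - 1)\<close> of the defect; the horn conditions ensure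
  that the faces corrected so far do not change.\<close>

lemma linear_horn_filler:
  fixes F :: "nat \<Rightarrow> 'c::ab_group_add \<Rightarrow> 'b::ab_group_add" and F' :: "nat \<Rightarrow> 'b \<Rightarrow> 'a::ab_group_add"
    and S :: "nat \<Rightarrow> 'b \<Rightarrow> 'c" and S' :: "nat \<Rightarrow> 'a \<Rightarrow> 'b"
  assumes F_add: "\<And>l x y. F l (x + y) = F l x + F l y" and F'_add: "\<And>l x y. F' l (x + y) = F' l x + F' l y"
    and S'_add: "\<And>l x y. S' l (x + y) = S' l x + S' l y"
    and C: "0 \<in> C" "\<And>x y. x \<in> C \<Longrightarrow> y \<in> C \<Longrightarrow> x + y \<in> C" and B: "\<And>x y. x \<in> B \<Longrightarrow> y \<in> B \<Longrightarrow> x - y \<in> B"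
    and FB: "\<And>l x. x \<in> C \<Longrightarrow> F l x \<in> B" and SC: "\<And>l x. x \<in> B \<Longrightarrow> S l x \<in> C"
    and same: "\<And>j x. j < n \<Longrightarrow> x \<in> B \<Longrightarrow> F j (S j x) = x" "\<And>j x. j < n \<Longrightarrow> x \<in> B \<Longrightarrow> F (Suc j) (S j x) = x"
    and less: "\<And>l j x. l < j \<Longrightarrow> j < n \<Longrightarrow> x \<in> B \<Longrightarrow> F l (S j x) = S' (j - 1) (F' l x)"
    and greater: "\<And>l j x. j + 1 < l \<Longrightarrow> l \<le> n \<Longrightarrow> x \<in> B \<Longrightarrow> F l (S j x) = S' j (F' (l - 1) x)"
    and J: "J = {0..m} - {i}" and im: "i \<le> m" "m \<le> n"
    and faces: "\<And>j1 j2 x. j1 \<in> J \<Longrightarrow> j2 \<in> J \<Longrightarrow> j1 < j2 \<Longrightarrow> x \<in> C \<Longrightarrow> F' j1 (F j2 x) = F' (j2 - 1) (F j1 x)"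
    and v: "\<And>j. j \<in> J \<Longrightarrow> v j \<in> B"
    and horn: "\<And>j1 j2. j1 \<in> J \<Longrightarrow> j2 \<in> J \<Longrightarrow> j1 < j2 \<Longrightarrow> F' j1 (v j2) = F' (j2 - 1) (v j1)"
  shows "\<exists>x\<in>C. \<forall>j\<in>J. F j x = v j"
proof -
  have S'0: "S' l 0 = 0" for l using S'_add[of l 0 0] by simp
  have F'_diff: "F' l (x - y) = F' l x - F' l y" for l x y using F'_add[of l "x - y" y] by (simp add: algebra_simps)
  \<comment> \<open>The faces below \<open>i\<close> are prescribed without a gap, so
    \<open>S r\<close> can correct face \<open>r\<close>.\<close>
  have asc: "\<exists>x\<in>C. \<forall>l<r. F l x = v l" if "r \<le> i" for r
    using that
  proof (induction r)
    case 0 then show ?case using C(1) by blast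
  next
    case (Suc r)
    then obtain x where x: "x \<in> C" "\<And>l. l < r \<Longrightarrow> F l x = v l" by auto
    have rJ: "r \<in> J" and rn: "r < n" using Suc.prems im J by auto
    define u where "u = v r - F r x"
    have uB: "u \<in> B" unfolding u_def by (rule B[OF v[OF rJ] FB[OF x(1)]])
    have "F l (x + S r u) = v l" if "l < Suc r" for l
    proof (cases "l = r")
      case True then show ?thesis using same(1)[OF rn uB] by (simp add: F_add u_def)
    next
      case False
      then have l: "l < r" "l \<in> J" using that Suc.prems im J by auto
      \<comment> \<open>Both \<open>v\<close> and the faces of \<open>x\<close> satisfy the matching
        condition for \<open>l\<close> and \<open>r\<close>, and they agree in face
        \<open>l\<close>; so the defect has zero \<open>l\<close>-th face and its degeneracy leaves
        face \<open>l\<close> of \<open>x\<close> alone.\<close>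
      have "F' l u = 0" using horn[OF l(2) rJ l(1)] faces[OF l(2) rJ l(1) x(1)] x(2)[OF l(1)] by (simp add: u_def F'_diff)
      then show ?thesis using less[OF l(1) rn uB] x(2)[OF l(1)] by (simp add: F_add S'0)
    qed
    then show ?case using C(2)[OF x(1) SC[OF uB]] by blast
  qed
  \<comment> \<open>Here \<open>r\<close> counts down from the top: the faces with index above
    \<open>m - r\<close> are done, and \<open>r = m - i\<close> reaches the gap.\<close>
  have desc: "\<exists>x\<in>C. \<forall>l\<in>J. l < i \<or> m - r < l \<longrightarrow> F l x = v l" if "r \<le> m - i" for r
    using that
  proof (induction r)
    case 0
    obtain x where "x \<in> C" "\<forall>l<i. F l x = v l" using asc[of i] by blast
    then show ?case using J by auto
  next
    case (Suc r)
    then obtain x where x: "x \<in> C" "\<And>l. l \<in> J \<Longrightarrow> l < i \<or> m - r < l \<Longrightarrow> F l x = v l" by auto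
    define j where "j = m - r"
    have j: "j \<in> J" "i < j" "j \<le> n" "j - 1 < n" "Suc (j - 1) = j" using Suc.prems im J by (auto simp: j_def)
    define u where "u = v j - F j x"
    have uB: "u \<in> B" unfolding u_def by (rule B[OF v[OF j(1)] FB[OF x(1)]])
    have "F l (x + S (j - 1) u) = v l" if l: "l \<in> J" "l < i \<or> m - Suc r < l" for l
    proof -
      have "l = j \<or> l < i \<or> j < l" using l(2) unfolding j_def by arith
      then consider "l = j" | "l < i" | "j < l" by blast
      then show ?thesis
      proof cases
        case 1 then show ?thesis using same(2)[OF j(4) uB] j(5) by (simp add: F_add u_def)
      next
        case 2
        \<comment> \<open>The missing index \<open>i\<close> lies strictly between \<open>l\<close>
          and \<open>j\<close>, which yields \<open>l < j - 1\<close>. Without the gap, face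
          \<open>j - 1\<close> would be disturbed by \<open>S (j - 1)\<close>.\<close>
        then have lj: "l < j" "l < j - 1" using j(2) by auto
        have xl: "F l x = v l" using x(2)[OF l(1)] 2 by blast
        have "F' l u = 0" using horn[OF l(1) j(1) lj(1)] faces[OF l(1) j(1) lj(1) x(1)] xl by (simp add: u_def F'_diff)
        then show ?thesis using less[OF lj(2) j(4) uB] xl by (simp add: F_add S'0)
      next
        case 3
        have xl: "F l x = v l" using x(2)[OF l(1)] 3 by (simp add: j_def)
        have ln: "l \<le> n" "j - 1 + 1 < l" using l(1) im J 3 j(5) by auto
        have "F' (l - 1) u = 0" using horn[OF j(1) l(1) 3] faces[OF j(1) l(1) 3 x(1)] xl by (simp add: u_def F'_diff)
        then show ?thesis using greater[OF ln(2,1) uB] xl by (simp add: F_add S'0)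
      qed
    qed
    then show ?case using C(2)[OF x(1) SC[OF uB]] by blast
  qed
  obtain x where x: "x \<in> C" "\<forall>l\<in>J. l < i \<or> m - (m - i) < l \<longrightarrow> F l x = v l"
    using desc[of "m - i", OF order_refl] by (elim bexE)
  have "F l x = v l" if "l \<in> J" for l
  proof -
    have "l < i \<or> m - (m - i) < l" using that im(1) J by auto
    then show ?thesis using x(2) that by blast
  qed
  then show ?thesis using x(1) by blast
qed

section \<open>Horns as iterated fiber products\<close>

lemma horn_indices: "m \<le> n \<Longrightarrow> {0..n} - ({i} \<union> {m+1..n}) = {0..m} - {i :: nat}"
  by auto

lemma horn_complement_nonempty:
  fixes m n i :: nat
  assumes "1 \<le> m" "m \<le> n" shows "{0..n} - ({i} \<union> {m+1..n}) \<noteq> {}"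
proof (cases "i = 0")
  case True
  then have "1 \<in> {0..n} - ({i} \<union> {m+1..n})" using assms by auto
  then show ?thesis by blast
next
  case False
  then have "0 \<in> {0..n} - ({i} \<union> {m+1..n})" by auto
  then show ?thesis by blast
qed

text \<open>The matching conditions come from \<open>X\<close>, and only the faces must lie in the
  possibly smaller \<open>Y (n - 1)\<close>. This serves open subsets before they are known to form
  a semisimplicial manifold.\<close>

lemma horn_projection_in_horn:
  assumes ss: "semisimplicial_manifold X d" and n: "1 \<le> n" and x: "x \<in> points (X n)"
    and Y: "\<And>j. j \<le> n \<Longrightarrow> d n j x \<in> points (Y (n - 1))"
  shows "horn_projection d n I x \<in> horn Y d n I"
proof -
  have "d (n - 1) j1 (d n j2 x) = d (n - 1) (j2 - 1) (d n j1 x)" if "n \<noteq> 1" "j1 < j2" "j2 \<le> n" for j1 j2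
    using semisimplicial_manifold.face_face[OF ss _ that(2,3) x] n that(1) by simp
  then show ?thesis using Y by (auto simp: horn_def horn_projection_def)
qed

text \<open>As \<open>t\<close> exceeds every index in \<open>J'\<close>, each condition involving
  \<open>t\<close> equates face \<open>j\<close> of \<open>z t\<close> with face
  \<open>t - 1\<close> of \<open>z j\<close>. Together these prescribe the horn projection of
  \<open>z t\<close> one degree lower, with the same index set \<open>J'\<close>.\<close>

lemma horn_split:
  assumes J: "{0..n} - I = insert t J'" "{0..n} - I' = J'" "{0..n - 1} - I'' = J'" and t: "\<And>j. j \<in> J' \<Longrightarrow> j < t"
    and n: "2 \<le> n"
  shows "horn X d n I = {z \<in> points (horn_ambient X n I). restrict z J' \<in> horn X d n I' \<and>
    horn_projection d (n - 1) I'' (z t) = (\<lambda>j\<in>J'. d (n - 1) (t - 1) (restrict z J' j))}"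
proof (rule set_eqI)
  fix z
  have n1: "n \<noteq> 1" using n by simp
  have tJ: "t \<notin> J'" using t by blast
  have p: "points (horn_ambient X n I) = (\<Pi>\<^sub>E j\<in>insert t J'. points (X (n - 1)))"
    by (simp add: horn_ambient_def J(1))
  have pr: "horn_projection d (n - 1) I'' (z t) = (\<lambda>j\<in>J'. d (n - 1) (t - 1) (restrict z J' j)) \<longleftrightarrow>
      (\<forall>j\<in>J'. d (n - 1) j (z t) = d (n - 1) (t - 1) (z j))"
    unfolding horn_projection_def J(3) by (auto simp: fun_eq_iff restrict_def)
  have "z \<in> horn X d n I \<longleftrightarrow> z \<in> (\<Pi>\<^sub>E j\<in>insert t J'. points (X (n - 1))) \<and>
      (\<forall>j1\<in>J'. \<forall>j2\<in>J'. j1 < j2 \<longrightarrow> d (n - 1) j1 (z j2) = d (n - 1) (j2 - 1) (z j1)) \<and>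
      (\<forall>j\<in>J'. d (n - 1) j (z t) = d (n - 1) (t - 1) (z j))"
    unfolding horn_def J(1) using t n1 by (auto dest: less_asym)
  moreover have "restrict z J' \<in> horn X d n I' \<longleftrightarrow>
      (\<forall>j1\<in>J'. \<forall>j2\<in>J'. j1 < j2 \<longrightarrow> d (n - 1) j1 (z j2) = d (n - 1) (j2 - 1) (z j1))"
    if "z \<in> (\<Pi>\<^sub>E j\<in>insert t J'. points (X (n - 1)))"
    using that n1 unfolding horn_def J(2) by auto
  ultimately show "z \<in> horn X d n I \<longleftrightarrow> z \<in> {z \<in> points (horn_ambient X n I). restrict z J' \<in> horn X d n I' \<and>
    horn_projection d (n - 1) I'' (z t) = (\<lambda>j\<in>J'. d (n - 1) (t - 1) (restrict z J' j))}"
    unfolding mem_Collect_eq p pr by blast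
qed

text \<open>For \<open>j1 < j2 < t\<close> the face \<open>t - 1\<close> lies above both
  \<open>j1\<close> and \<open>j2 - 1\<close>, so taking it commutes with the two sides of the
  matching condition.\<close>

lemma shifted_horn:
  assumes ss: "semisimplicial_manifold X d" and J: "{0..n} - I' = J'" "{0..n - 1} - I'' = J'"
    and t: "\<And>j. j \<in> J' \<Longrightarrow> j < t" "t \<le> n" and n: "2 \<le> n" and y: "y \<in> horn X d n I'"
  shows "(\<lambda>j\<in>J'. d (n - 1) (t - 1) (y j)) \<in> horn X d (n - 1) I''"
proof -
  interpret semisimplicial_manifold X d by fact
  have yp: "y j \<in> points (X (n - 1))" if "j \<in> J'" for j using y that unfolding horn_def J by auto
  have yc: "d (n - 1) j1 (y j2) = d (n - 1) (j2 - 1) (y j1)" if "j1 \<in> J'" "j2 \<in> J'" "j1 < j2" for j1 j2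
    using y that n unfolding horn_def J by auto
  have "d (n - 1) (t - 1) (y j) \<in> points (X (n - 1 - 1))" if "j \<in> J'" for j
    using smooth_map_points[OF face_smooth[of "n - 1" "t - 1"] yp[OF that]] n t(2) by simp
  moreover have "d (n - 1 - 1) j1 (d (n - 1) (t - 1) (y j2)) = d (n - 1 - 1) (j2 - 1) (d (n - 1) (t - 1) (y j1))"
    if h: "n - 1 \<noteq> 1" "j1 \<in> J'" "j2 \<in> J'" "j1 < j2" for j1 j2
  proof -
    have j: "j1 < t - 1" "j2 - 1 < t - 1" "t - 1 \<le> n - 1" "2 \<le> n - 1" using t(1)[OF h(3)] h(1,4) t(2) n by auto
    have "d (n - 1 - 1) j1 (d (n - 1) (t - 1) (y j2)) = d (n - 1 - 1) (t - 1 - 1) (d (n - 1) j1 (y j2))"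
      by (rule face_face[OF j(4,1,3) yp[OF h(3)]])
    also have "\<dots> = d (n - 1 - 1) (t - 1 - 1) (d (n - 1) (j2 - 1) (y j1))" using yc[OF h(2-4)] by simp
    also have "\<dots> = d (n - 1 - 1) (j2 - 1) (d (n - 1) (t - 1) (y j1))"
      by (rule face_face[OF j(4,2,3) yp[OF h(2)], symmetric])
    finally show ?thesis .
  qed
  ultimately show ?thesis unfolding horn_def J by auto
qed

text \<open>Provides the hypothesis \<open>joint\<close> of \<open>embedded_fiber_product\<close>:
  the components of a tangent vector at \<open>t\<close> and over \<open>J'\<close> can be chosen
  independently.\<close>

lemma restriction_projection_tangent:
  assumes fin: "finite J'" and J': "J' \<noteq> {}" and tJ: "t \<notin> J'" and M: "charted M" and z: "z \<in> (\<Pi>\<^sub>E j\<in>insert t J'. points M)"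
  shows "\<exists>d W \<phi> d1 W1 \<phi>1 d2 W2 \<phi>2.
      (d, W, \<phi>) \<in> maximal_atlas (product_manifold (insert t J') (\<lambda>_. M)) \<and>
      (d1, W1, \<phi>1) \<in> maximal_atlas (product_manifold J' (\<lambda>_. M)) \<and> (d2, W2, \<phi>2) \<in> maximal_atlas M \<and>
      z \<in> W \<and> restrict z J' \<in> W1 \<and> z t \<in> W2 \<and>
      (\<forall>u\<in>EE d1. \<forall>v\<in>EE d2. \<exists>x\<in>EE d. tangent_map (d, W, \<phi>) (d1, W1, \<phi>1) (\<lambda>z. restrict z J') z x = u \<and>
        tangent_map (d, W, \<phi>) (d2, W2, \<phi>2) (\<lambda>z. z t) z x = v)"
proof -
  let ?J = "insert t J'"
  have finJ: "finite ?J" and J: "?J \<noteq> {}" and MJ: "\<forall>j\<in>?J. charted M" "\<forall>j\<in>J'. charted M" using fin M by auto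
  obtain D W \<phi> where c: "\<forall>j\<in>?J. (D j, W j, \<phi> j) \<in> atlas M" "z \<in> Pi\<^sub>E ?J W"
    using product_chart_at[OF finJ MJ(1) z] by blast
  have c': "\<forall>j\<in>J'. (D j, W j, \<phi> j) \<in> atlas M" and z': "restrict z J' \<in> Pi\<^sub>E J' W" using c by auto
  let ?C = "product_chart ?J D W \<phi>" and ?C' = "product_chart J' D W \<phi>"
  have mC: "?C \<in> maximal_atlas (product_manifold ?J (\<lambda>_. M))" by (rule product_chart_maximal[OF finJ J MJ(1) c(1)])
  have mC': "?C' \<in> maximal_atlas (product_manifold J' (\<lambda>_. M))" by (rule product_chart_maximal[OF fin J' MJ(2) c'])
  have mt: "(D t, W t, \<phi> t) \<in> maximal_atlas M" using c(1) atlas_subset_maximal[OF M] by blast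
  interpret C: chart_family ?J "\<lambda>_. mtop M" D W \<phi> by (rule product_chart_family[OF finJ MJ(1) c(1)])
  interpret C': chart_family J' "\<lambda>_. mtop M" D W \<phi> by (rule product_chart_family[OF fin MJ(2) c'])
  have cs: "chart_smooth_at ?C ?C' (\<lambda>z. restrict z J') z"
    by (rule C'.tuple_in_charts[OF J']) (rule C.projection_in_charts(1)[OF c(2)], simp)
  have "\<exists>x\<in>EE (sum D ?J). tangent_map ?C ?C' (\<lambda>z. restrict z J') z x = u \<and>
        tangent_map ?C (D t, W t, \<phi> t) (\<lambda>z. z t) z x = v" if u: "u \<in> EE (sum D J')" and v: "v \<in> EE (D t)" for u v
  proof -
    define a where "a j = (if j = t then v else block J' D j u)" for j
    have aE: "a j \<in> EE (D j)" for j using v by (simp add: a_def block_EE)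
    obtain x where x: "x \<in> EE (sum D ?J)" "\<And>j. j \<in> ?J \<Longrightarrow> tangent_map ?C (D j, W j, \<phi> j) (\<lambda>x. x j) z x = a j"
      using product_tangent(2)[OF finJ J MJ(1) c(1) c(2) mC c(2), of a] aE by blast
    have "tangent_map ?C ?C' (\<lambda>z. restrict z J') z x = u"
    proof (rule block_inject[OF fin tangent_map_EE u])
      fix j assume j: "j \<in> J'"
      have "block J' D j (tangent_map ?C ?C' (\<lambda>z. restrict z J') z x) =
          tangent_map ?C' (D j, W j, \<phi> j) (\<lambda>x. x j) (restrict z J') (tangent_map ?C ?C' (\<lambda>z. restrict z J') z x)"
        by (rule C'.projection_in_charts(2)[OF z' j tangent_map_EE, symmetric])
      also have "\<dots> = tangent_map ?C (D j, W j, \<phi> j) (\<lambda>x. restrict x J' j) z x"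
        by (rule tangent_map_compose[where f="\<lambda>z. restrict z J'" and g="\<lambda>x. x j", OF cs C'.projection_in_charts(1)[OF z' j], symmetric])
      also have "\<dots> = a j" using x(2)[of j] j by simp
      also have "\<dots> = block J' D j u" using j tJ by (auto simp: a_def)
      finally show "block J' D j (tangent_map ?C ?C' (\<lambda>z. restrict z J') z x) = block J' D j u" .
    qed
    moreover have "tangent_map ?C (D t, W t, \<phi> t) (\<lambda>z. z t) z x = v" using x(2)[of t] by (simp add: a_def)
    ultimately show ?thesis using x(1) by blast
  qed
  then show ?thesis
    using mC mC' mt c(2) z' by (intro exI conjI ballI) auto
qed

text \<open>Adding the face of largest index \<open>t\<close> to a horn amounts to a fiber product over a horn one degree lower.\<close>

lemma horn_embedded:
  assumes ss: "semisimplicial_manifold X d" and n: "1 \<le> n" and mi: "1 \<le> m" "m \<le> n" "i \<le> m"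
    and emb: "\<And>m i. 2 \<le> n \<Longrightarrow> 1 \<le> m \<Longrightarrow> m \<le> n - 1 \<Longrightarrow> i \<le> m \<Longrightarrow>
      embedded_submanifold (horn_ambient X (n - 1) ({i} \<union> {m+1..n - 1})) (horn X d (n - 1) ({i} \<union> {m+1..n - 1}))"
    and sub: "\<And>m i y. 2 \<le> n \<Longrightarrow> 1 \<le> m \<Longrightarrow> m \<le> n - 1 \<Longrightarrow> i \<le> m \<Longrightarrow> y \<in> points (X (n - 1)) \<Longrightarrow>
      submersive_at (X (n - 1)) (horn_ambient X (n - 1) ({i} \<union> {m+1..n - 1})) (horn X d (n - 1) ({i} \<union> {m+1..n - 1}))
        (horn_projection d (n - 1) ({i} \<union> {m+1..n - 1})) y"
  shows "embedded_submanifold (horn_ambient X n ({i} \<union> {m+1..n})) (horn X d n ({i} \<union> {m+1..n}))"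
  using mi
proof (induction m arbitrary: i rule: nat_induct_at_least)
  case base
  interpret semisimplicial_manifold X d by fact
  have ch: "charted (X k)" for k by (rule smooth_manifold_charted[OF manifold])
  define I where "I = {i} \<union> {1+1..n}"
  have J: "{0..n} - I = {1 - i}" using base n by (cases "i = 0") (auto simp: I_def)
  \<comment> \<open>Only the face \<open>1 - i\<close> is prescribed, and a single face has nothing
    to match.\<close>
  have "horn X d n I = points (horn_ambient X n I)"
    unfolding horn_def horn_ambient_def J by auto
  moreover have "charted (horn_ambient X n I)"
    unfolding horn_ambient_def J by (rule charted_product_manifold) (auto simp: ch)
  ultimately show ?case using embedded_points by (simp add: I_def)
next
  case (Suc m')
  interpret semisimplicial_manifold X d by fact
  have ch: "charted (X k)" for k by (rule smooth_manifold_charted[OF manifold])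
  \<comment> \<open>If the missing index is the top one, \<open>Suc m'\<close>, the largest
    prescribed face is \<open>m'\<close>, and removing it makes \<open>m'\<close> the missing index
    of the smaller horn. Otherwise \<open>Suc m'\<close> is removed and the missing index
    stays.\<close>
  define i' where "i' = min i m'"
  define t where "t = (if i = Suc m' then m' else Suc m')"
  define J' where "J' = {0..m'} - {i'}"
  define I where "I = {i} \<union> {Suc m'+1..n}"
  define I' where "I' = {i'} \<union> {m'+1..n}"
  define I'' where "I'' = {i'} \<union> {m'+1..n - 1}"
  have n2: "2 \<le> n" using Suc.hyps Suc.prems by simp
  have J: "{0..n} - I = insert t J'" "{0..n} - I' = J'" "{0..n - 1} - I'' = J'"
    using Suc.hyps Suc.prems by (auto simp: I_def I'_def I''_def J'_def t_def i'_def)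
  have tJ: "j < t" if "j \<in> J'" for j using that Suc.prems by (auto simp: J'_def t_def i'_def split: if_splits)
  have tn: "t \<le> n" using Suc.prems by (auto simp: t_def)
  have fin: "finite J'" by (simp add: J'_def)
  have J'ne: "J' \<noteq> {}"
    unfolding J(2)[symmetric] I'_def by (rule horn_complement_nonempty) (use Suc.hyps Suc.prems in auto)
  let ?B = "X (n - 1)"
  let ?A = "horn_ambient X n I" and ?A' = "horn_ambient X n I'" and ?A'' = "horn_ambient X (n - 1) I''"
  have A: "?A = product_manifold (insert t J') (\<lambda>_. ?B)" "?A' = product_manifold J' (\<lambda>_. ?B)"
    "?A'' = product_manifold J' (\<lambda>_. X (n - 1 - 1))"
    unfolding horn_ambient_def J by (rule refl)+
  have chA: "charted ?A" "charted ?A'" "charted ?A''"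
    unfolding A using fin J'ne by (auto intro!: charted_product_manifold ch)
  have pr: "smooth_map ?A ?B (\<lambda>z. z j)" if "j \<in> insert t J'" for j
    unfolding A using smooth_map_projection[of "insert t J'" "\<lambda>_. ?B" j] fin ch that by simp
  have pr': "smooth_map ?A' ?B (\<lambda>z. z j)" if "j \<in> J'" for j
    unfolding A using smooth_map_projection[of "J'" "\<lambda>_. ?B" j] fin ch that by simp
  have face: "smooth_map ?B (X (n - 1 - 1)) (d (n - 1) j)" if "j \<le> n - 1" for j
    by (rule face_smooth) (use n2 that in auto)
  have "embedded_submanifold ?A {z \<in> points ?A. restrict z J' \<in> horn X d n I' \<and>
      horn_projection d (n - 1) I'' (z t) = (\<lambda>j\<in>J'. d (n - 1) (t - 1) (restrict z J' j))}"
  proof (rule embedded_fiber_product[where A'="?A'" and A''="?A''" and B="?B" and S''="horn X d (n - 1) I''"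
        and b="\<lambda>z. z t" and r="\<lambda>z. restrict z J'" and q="\<lambda>y. \<lambda>j\<in>J'. d (n - 1) (t - 1) (y j)"])
    show "charted ?A" "charted ?A'" "charted ?A''" "charted ?B" by (fact chA ch)+
    show "smooth_map ?A ?A' (\<lambda>z. restrict z J')"
      unfolding A(2) by (rule smooth_map_tuple[OF fin J'ne _ chA(1)]) (use pr ch in auto)
    show "smooth_map ?A ?B (\<lambda>z. z t)" by (rule pr) simp
    show "smooth_map ?A' ?A'' (\<lambda>y. \<lambda>j\<in>J'. d (n - 1) (t - 1) (y j))"
      unfolding A(3)
    proof (rule smooth_map_tuple[OF fin J'ne _ chA(2)])
      show "smooth_map ?A' (X (n - 1 - 1)) (\<lambda>y. d (n - 1) (t - 1) (y j))" if "j \<in> J'" for j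
        by (rule smooth_map_compose[OF chA(2) ch ch pr'[OF that] face]) (use tn in simp)
    qed (simp add: ch)
    have "j \<le> n - 1" if "j \<in> J'" for j using tJ[OF that] tn by simp
    then show "smooth_map ?B ?A'' (horn_projection d (n - 1) I'')"
      unfolding A(3) horn_projection_def[abs_def] J
      by (intro smooth_map_tuple[OF fin J'ne _ ch] face) (simp_all add: ch)
    show "embedded_submanifold ?A' (horn X d n I')"
      unfolding I'_def using Suc.IH[of i'] Suc.prems by (simp add: i'_def)
    show "embedded_submanifold ?A'' (horn X d (n - 1) I'')"
      unfolding I''_def by (rule emb[OF n2]) (use Suc.hyps Suc.prems in \<open>auto simp: i'_def\<close>)
    show "(\<lambda>y. \<lambda>j\<in>J'. d (n - 1) (t - 1) (y j)) ` horn X d n I' \<subseteq> horn X d (n - 1) I''"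
      using shifted_horn[OF ss J(2,3) tJ tn n2] by blast
    show "horn_projection d (n - 1) I'' ` points ?B \<subseteq> horn X d (n - 1) I''"
      using horn_projection_in_horn[OF ss, of "n - 1" _ X] smooth_map_points[OF face] n2 by auto
    show "submersive_at ?B ?A'' (horn X d (n - 1) I'') (horn_projection d (n - 1) I'') y" if "y \<in> points ?B" for y
      unfolding I''_def by (rule sub[OF n2]) (use Suc.hyps Suc.prems that in \<open>auto simp: i'_def\<close>)
    fix z assume "z \<in> points ?A"
    then have z: "z \<in> (\<Pi>\<^sub>E j\<in>insert t J'. points ?B)" unfolding A by simp
    have tJ': "t \<notin> J'" using tJ by blast
    show "\<exists>d W \<phi> d1 W1 \<phi>1 d2 W2 \<phi>2. (d, W, \<phi>) \<in> maximal_atlas ?A \<and> (d1, W1, \<phi>1) \<in> maximal_atlas ?A' \<and>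
      (d2, W2, \<phi>2) \<in> maximal_atlas ?B \<and> z \<in> W \<and> restrict z J' \<in> W1 \<and> z t \<in> W2 \<and>
      (\<forall>u\<in>EE d1. \<forall>v\<in>EE d2. \<exists>x\<in>EE d. tangent_map (d, W, \<phi>) (d1, W1, \<phi>1) (\<lambda>z. restrict z J') z x = u \<and>
        tangent_map (d, W, \<phi>) (d2, W2, \<phi>2) (\<lambda>z. z t) z x = v)"
      unfolding A by (rule restriction_projection_tangent[OF fin J'ne tJ' ch z])
  qed
  then have "embedded_submanifold ?A (horn X d n I)"
    by (subst horn_split[OF J tJ n2])
  then show ?case by (simp only: I_def)
qed

lemma EE_closed: "0 \<in> EE d" "x \<in> EE d \<Longrightarrow> y \<in> EE d \<Longrightarrow> x + y \<in> EE d" "x \<in> EE d \<Longrightarrow> y \<in> EE d \<Longrightarrow> x - y \<in> EE d"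
  by (simp_all add: EE_iff)

section \<open>Base points\<close>

context simplicial_manifold
begin

lemma base_embedding_points: "x \<in> points (X 0) \<Longrightarrow> base_embedding s n x \<in> points (X n)"
proof (induction n)
  case (Suc n)
  then show ?case using smooth_map_points[OF degen_smooth[of 0 n]] by simp
qed simp

text \<open>All degeneracies of a totally degenerate simplex coincide: \<open>degen_degen\<close>
  with outer index 0 turns index \<open>k + 1\<close> into index \<open>k\<close> one degree
  lower.\<close>

lemma degen_base: "x \<in> points (X 0) \<Longrightarrow> j \<le> n \<Longrightarrow> s n j (base_embedding s n x) = base_embedding s (Suc n) x"
proof (induction n arbitrary: j)
  case (Suc n)
  show ?case
  proof (cases j)
    case (Suc k)
    then have k: "k \<le> n" using Suc.prems by simp
    show ?thesis
      using degen_degen[OF _ k base_embedding_points[OF Suc.prems(1)], of 0] Suc.IH[OF Suc.prems(1) k] Suc by simp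
  qed simp
qed simp

lemma face_base:
  assumes "x \<in> points (X 0)" "1 \<le> n" "j \<le> n"
  shows "d n j (base_embedding s n x) = base_embedding s (n - 1) x"
proof -
  obtain k where k: "n = Suc k" using assms(2) by (cases n) auto
  \<comment> \<open>Every face map undoes some degeneracy: the one of its own index, and for the top
    face \<open>k + 1\<close> the one of index \<open>k\<close>.\<close>
  have *: "j = min j k \<or> j = min j k + 1" "min j k \<le> k" using assms(3) k by auto
  have "d (k + 1) j (s k (min j k) (base_embedding s k x)) = base_embedding s k x"
    by (rule face_degen_same[OF * base_embedding_points[OF assms(1)]])
  then show ?thesis using degen_base[OF assms(1) *(2)] k by simp
qed

text \<open>The tangent spaces at the degenerate simplices over a base point form a simplicial vector space,
  whose horns can be filled.\<close>

lemma submersive_at_base: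
  assumes n: "1 \<le> n" and mi: "1 \<le> m" "m \<le> n" "i \<le> m" and x: "x \<in> points (X 0)"
    and V: "openin (mtop (X (n - 1))) V" "base_embedding s (n - 1) x \<in> V" and Y: "Y (n - 1) = open_submanifold (X (n - 1)) V"
    and O: "openin (mtop (X n)) O'" "base_embedding s n x \<in> O'" and dO: "\<And>j. j \<le> n \<Longrightarrow> d n j ` O' \<subseteq> V"
    and I: "I = {i} \<union> {m+1..n}"
    and emb: "embedded_submanifold (horn_ambient Y n I) (horn Y d n I)"
  shows "submersive_at (X n) (horn_ambient Y n I) (horn Y d n I) (horn_projection d n I) (base_embedding s n x)"
proof -
  have ss: "semisimplicial_manifold X d" by unfold_locales
  have ch: "charted (X k)" for k by (rule smooth_manifold_charted[OF manifold])
  let ?b = "base_embedding s n x" and ?b1 = "base_embedding s (n - 1) x"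
  let ?p = "horn_projection d n I"
  let ?N = "open_submanifold (X (n - 1)) V" and ?O = "open_submanifold (X n) O'"
  let ?A = "horn_ambient Y n I"
  define J where "J = {0..m} - {i}"
  have IJ: "{0..n} - I = J" unfolding I J_def by (rule horn_indices[OF mi(2)])
  have fin: "finite J" by (simp add: J_def)
  have Jne: "J \<noteq> {}" unfolding IJ[symmetric] I by (rule horn_complement_nonempty[OF mi(1,2)])
  have Jn: "j \<le> n" if "j \<in> J" for j using that mi by (auto simp: J_def)
  have chN: "charted ?N" and chO: "charted ?O" by (rule charted_open_submanifold[OF ch V(1)], rule charted_open_submanifold[OF ch O(1)])
  have A: "?A = product_manifold J (\<lambda>_. ?N)" unfolding horn_ambient_def IJ Y by (rule refl)
  have chNJ: "\<forall>j\<in>J. charted ?N" using chN by simp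
  have chA: "charted ?A" unfolding A by (rule charted_product_manifold[OF fin Jne chNJ])
  have p: "?p = (\<lambda>x. \<lambda>j\<in>J. d n j x)" by (simp add: horn_projection_def[abs_def] IJ)
  have face: "smooth_map (X n) (X (n - 1)) (d n j)" if "j \<le> n" for j by (rule face_smooth[OF n that])
  have degen: "smooth_map (X (n - 1)) (X n) (s (n - 1) j)" if "j < n" for j
    using degen_smooth[of j "n - 1"] that by simp
  have faceO: "smooth_map ?O ?N (d n j)" if "j \<le> n" for j
    by (rule smooth_map_open_submanifold[OF ch ch O(1) V(1) face[OF that] dO[OF that]])
  have ps: "smooth_map ?O ?A ?p" unfolding A p by (rule smooth_map_tuple[OF fin Jne chNJ chO]) (use faceO Jn in blast)
  have b: "?b \<in> points (X n)" and b1: "?b1 \<in> points (X (n - 1))" using base_embedding_points[OF x] by auto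
  have db: "d n j ?b = ?b1" if "j \<le> n" for j by (rule face_base[OF x n that])
  have sb: "s (n - 1) j ?b1 = ?b" if "j < n" for j using degen_base[OF x, of j "n - 1"] that by simp
  have pH: "?p ?b \<in> horn Y d n I"
    by (rule horn_projection_in_horn[OF ss n b]) (use db V(2) b1 Y in auto)
  have pb: "?p ?b = (\<lambda>j\<in>J. ?b1)" unfolding p using db Jn by auto
  have "?b \<in> points ?O" "?b1 \<in> points ?N" using b O(2) b1 V(2) by simp_all
  \<comment> \<open>The charts are chosen inside \<open>O'\<close> and \<open>V\<close>, where the
    horn lives, but they are charts of \<open>X n\<close> and \<open>X (n - 1)\<close> too. The
    latter is used for the degeneracies, which need not map \<open>V\<close> into
    \<open>O'\<close>.\<close>
  then obtain dn Wn \<phi>n d1 W1 \<phi>1 where cn0: "(dn, Wn, \<phi>n) \<in> atlas ?O" "?b \<in> Wn"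
      and c1: "(d1, W1, \<phi>1) \<in> atlas ?N" "?b1 \<in> W1"
    using chart_at[OF chO] chart_at[OF chN] by metis
  have cnO: "(dn, Wn, \<phi>n) \<in> maximal_atlas ?O" using cn0(1) atlas_subset_maximal[OF chO] by blast
  have cn: "(dn, Wn, \<phi>n) \<in> maximal_atlas (X n)" by (rule open_submanifold_maximal_atlas[OF ch O(1) cnO])
  have c1N: "(d1, W1, \<phi>1) \<in> maximal_atlas ?N" using c1(1) atlas_subset_maximal[OF chN] by blast
  have c1m: "(d1, W1, \<phi>1) \<in> maximal_atlas (X (n - 1))" by (rule open_submanifold_maximal_atlas[OF ch V(1) c1N])
  obtain k e Z \<theta> where sl: "slice_chart ?A (horn Y d n I) k (e, Z, \<theta>)" "?p ?b \<in> Z"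
    using emb pH unfolding embedded_submanifold_def by blast
  have cz: "(e, Z, \<theta>) \<in> maximal_atlas ?A" "k \<le> e" using sl by (auto simp: slice_chart_iff)
  let ?cn = "(dn, Wn, \<phi>n)" and ?c1 = "(d1, W1, \<phi>1)" and ?cz = "(e, Z, \<theta>)"
  have csp: "chart_smooth_at ?cn ?cz ?p ?b" by (rule smooth_map_chart_smooth_at[OF chO chA ps cnO cz(1) cn0(2) sl(2)])
  have pr: "smooth_map ?A ?N (\<lambda>z. z j)" if "j \<in> J" for j unfolding A by (rule smooth_map_projection[OF fin chNJ that])
  have prb: "?p ?b j = ?b1" if "j \<in> J" for j using pb that by simp
  have cspr: "chart_smooth_at ?cz ?c1 (\<lambda>z. z j) (?p ?b)" if "j \<in> J" for j
    by (rule smooth_map_chart_smooth_at[OF chA chN pr[OF that] cz(1) c1N sl(2)]) (use prb[OF that] c1(2) in simp)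
  have c1J: "\<forall>j\<in>J. (d1, W1, \<phi>1) \<in> atlas ?N" "?p ?b \<in> (\<Pi>\<^sub>E j\<in>J. W1)" using c1 pb by auto
  have "\<exists>v\<in>EE dn. tangent_map ?cn ?cz ?p ?b v = w" if w: "w \<in> EE k" for w
  proof -
    \<comment> \<open>The faces of the tangent vector \<open>w\<close> of the horn space. Lifting
      \<open>w\<close> through the horn projection is the linear problem of finding a vector with
      these faces.\<close>
    define v where "v j = tangent_map ?cz ?c1 (\<lambda>z. z j) (?p ?b) w" for j
    have wE: "w \<in> EE e" using w cz(2) by (auto simp: EE_iff)
    define F where "F j = tangent_map ?cn ?c1 (d n j) ?b" for j
    define S where "S j = tangent_map ?c1 ?cn (s (n - 1) j) ?b1" for j
    have retr: "F j (S j y) = y" "F (Suc j) (S j y) = y" if "j < n" "y \<in> EE d1" for j y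
      unfolding F_def S_def sb[OF that(1), symmetric]
      by (rule tangent_retraction[OF ch ch degen[OF that(1)] face _ c1m cn c1(2) _ that(2)];
        use that sb cn0(2) face_degen_same[of _ j "n - 1"] in simp)+
    have "\<exists>y\<in>EE dn. \<forall>j\<in>J. F j y = v j"
    proof (cases "n = 1")
      case True
      \<comment> \<open>For \<open>n = 1\<close> there is no degree \<open>n - 2\<close>. At most
        one face is prescribed, every condition involving the lower maps is vacuous, and zero maps
        take their place.\<close>
      have sub: "j1 = j2" if "j1 \<in> J" "j2 \<in> J" for j1 j2 using that mi True by (auto simp: J_def)
      show ?thesis
      proof (rule linear_horn_filler[where F'="\<lambda>_ _. 0" and S'="\<lambda>_ _. 0" and B="EE d1" and S=S and n=n and m=m and i=i])
        show "F j (S j y) = y" "F (Suc j) (S j y) = y" if "j < n" "y \<in> EE d1" for j y by (fact retr[OF that])+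
      qed (use J_def mi True sub in \<open>auto simp: F_def S_def v_def tangent_map_add tangent_map_EE EE_closed\<close>)
    next
      case False
      then have n2: "2 \<le> n" using n by simp
      then have nn: "n - 1 - 1 + 1 = n - 1" "Suc (n - 1 - 1) = n - 1" by simp_all
      let ?b2 = "base_embedding s (n - 1 - 1) x"
      have b2: "?b2 \<in> points (X (n - 1 - 1))" by (rule base_embedding_points[OF x])
      obtain d2 W2 \<phi>2 where c2: "(d2, W2, \<phi>2) \<in> atlas (X (n - 1 - 1))" "?b2 \<in> W2" using chart_at[OF ch b2] by blast
      have c2m: "(d2, W2, \<phi>2) \<in> maximal_atlas (X (n - 1 - 1))" using c2(1) atlas_subset_maximal[OF ch] by blast
      let ?c2 = "(d2, W2, \<phi>2)"
      have face1: "smooth_map (X (n - 1)) (X (n - 1 - 1)) (d (n - 1) j)" if "j \<le> n - 1" for j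
        by (rule face_smooth) (use n2 that in auto)
      have degen1: "smooth_map (X (n - 1 - 1)) (X (n - 1)) (s (n - 1 - 1) j)" if "j < n - 1" for j
        using degen_smooth[of j "n - 1 - 1", unfolded nn] that by simp
      have db1: "d (n - 1) j ?b1 = ?b2" if "j \<le> n - 1" for j using face_base[OF x, of "n - 1" j] n2 that by simp
      have sb1: "s (n - 1 - 1) j ?b2 = ?b1" if "j < n - 1" for j
        using degen_base[OF x, of j "n - 1 - 1", unfolded nn] that by simp
      define F' where "F' j = tangent_map ?c1 ?c2 (d (n - 1) j) ?b1" for j
      define S' where "S' j = tangent_map ?c2 ?c1 (s (n - 1 - 1) j) ?b2" for j
      show ?thesis
      proof (rule linear_horn_filler[where F'=F' and S'=S' and B="EE d1" and S=S and n=n and m=m and i=i])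
        show "F j (S j y) = y" "F (Suc j) (S j y) = y" if "j < n" "y \<in> EE d1" for j y by (fact retr[OF that])+
        show "F l (S j y) = S' (j - 1) (F' l y)" if h: "l < j" "j < n" "y \<in> EE d1" for l j y
        proof -
          have l: "l \<le> n" "l \<le> n - 1" "j - 1 < n - 1" using h by auto
          have "tangent_map ?cn ?c1 (d n l) (s (n - 1) j ?b1) (tangent_map ?c1 ?cn (s (n - 1) j) ?b1 y) =
              tangent_map ?c2 ?c1 (s (n - 1 - 1) (j - 1)) (d (n - 1) l ?b1) (tangent_map ?c1 ?c2 (d (n - 1) l) ?b1 y)"
          proof (rule tangent_square[OF ch ch ch ch degen[OF h(2)] face[OF l(1)] face1[OF l(2)] degen1[OF l(3)] _ c1m cn c2m c1m c1(2)])
            show "d n l (s (n - 1) j y) = s (n - 1 - 1) (j - 1) (d (n - 1) l y)" if "y \<in> points (X (n - 1))" for y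
              using face_degen_less[OF h(1) _ that] h(2) n by simp
          qed (use sb[OF h(2)] db1[OF l(2)] db[OF l(1)] cn0(2) c1(2) c2(2) in simp_all)
          then show ?thesis unfolding F_def S_def F'_def S'_def sb[OF h(2)] db1[OF l(2)] .
        qed
        show "F l (S j y) = S' j (F' (l - 1) y)" if h: "j + 1 < l" "l \<le> n" "y \<in> EE d1" for l j y
        proof -
          have l: "j < n" "l - 1 \<le> n - 1" "j < n - 1" using h by auto
          have "tangent_map ?cn ?c1 (d n l) (s (n - 1) j ?b1) (tangent_map ?c1 ?cn (s (n - 1) j) ?b1 y) =
              tangent_map ?c2 ?c1 (s (n - 1 - 1) j) (d (n - 1) (l - 1) ?b1) (tangent_map ?c1 ?c2 (d (n - 1) (l - 1)) ?b1 y)"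
          proof (rule tangent_square[OF ch ch ch ch degen[OF l(1)] face[OF h(2)] face1[OF l(2)] degen1[OF l(3)] _ c1m cn c2m c1m c1(2)])
            show "d n l (s (n - 1) j y) = s (n - 1 - 1) j (d (n - 1) (l - 1) y)" if "y \<in> points (X (n - 1))" for y
              using face_degen_greater[OF h(1) _ that] h(2) n by simp
          qed (use sb[OF l(1)] db1[OF l(2)] db[OF h(2)] cn0(2) c1(2) c2(2) in simp_all)
          then show ?thesis unfolding F_def S_def F'_def S'_def sb[OF l(1)] db1[OF l(2)] .
        qed
        show "F' j1 (F j2 y) = F' (j2 - 1) (F j1 y)" if h: "j1 \<in> J" "j2 \<in> J" "j1 < j2" "y \<in> EE dn" for j1 j2 y
        proof -
          have l: "j1 \<le> n" "j2 \<le> n" "j1 \<le> n - 1" "j2 - 1 \<le> n - 1" using h(3) Jn[OF h(1)] Jn[OF h(2)] by auto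
          have "tangent_map ?c1 ?c2 (d (n - 1) j1) (d n j2 ?b) (tangent_map ?cn ?c1 (d n j2) ?b y) =
              tangent_map ?c1 ?c2 (d (n - 1) (j2 - 1)) (d n j1 ?b) (tangent_map ?cn ?c1 (d n j1) ?b y)"
          proof (rule tangent_square[OF ch ch ch ch face[OF l(2)] face1[OF l(3)] face[OF l(1)] face1[OF l(4)] _ cn c1m c1m c2m cn0(2)])
            show "d (n - 1) j1 (d n j2 y) = d (n - 1) (j2 - 1) (d n j1 y)" if "y \<in> points (X n)" for y
              by (rule face_face[OF n2 h(3) l(2) that])
          qed (use db[OF l(1)] db[OF l(2)] db1[OF l(3)] c1(2) c2(2) in simp_all)
          then show ?thesis unfolding F_def F'_def db[OF l(1)] db[OF l(2)] .
        qed
        \<comment> \<open>The derivative of the horn condition along \<open>w\<close>, legitimate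
          because \<open>w\<close> is tangent to the horn.\<close>
        show "F' j1 (v j2) = F' (j2 - 1) (v j1)" if h: "j1 \<in> J" "j2 \<in> J" "j1 < j2" for j1 j2
        proof -
          have l: "j1 \<le> n - 1" "j2 - 1 \<le> n - 1" using h(3) Jn[OF h(1)] Jn[OF h(2)] by auto
          have cs: "chart_smooth_at ?c1 ?c2 (d (n - 1) j) (?p ?b j')" if "j \<le> n - 1" "j' \<in> J" for j j'
            unfolding prb[OF that(2)]
            by (rule smooth_map_chart_smooth_at[OF ch ch face1[OF that(1)] c1m c2m c1(2)]) (use db1[OF that(1)] c2(2) in simp)
          have comp: "F' j (v j') = tangent_map ?cz ?c2 (\<lambda>z. d (n - 1) j (z j')) (?p ?b) w" if "j \<le> n - 1" "j' \<in> J" for j j'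
            unfolding F'_def v_def
            using tangent_map_compose[where f="\<lambda>z. z j'" and g="d (n - 1) j", OF cspr[OF that(2)] cs[OF that], of w] prb[OF that(2)]
            by simp
          show ?thesis
            unfolding comp[OF l(1) h(2)] comp[OF l(2) h(1)]
          proof (rule tangent_map_eq_on_slice[OF sl pH w])
            fix y assume "y \<in> horn Y d n I"
            then show "d (n - 1) j1 (y j2) = d (n - 1) (j2 - 1) (y j1)"
              using h False unfolding horn_def IJ by blast
          qed
        qed
      qed (use J_def mi in \<open>auto simp: F_def S_def F'_def S'_def v_def tangent_map_add tangent_map_EE EE_closed\<close>)
    qed
    then obtain y where y: "y \<in> EE dn" "\<And>j. j \<in> J \<Longrightarrow> F j y = v j" by blast
    have "tangent_map ?cn ?cz ?p ?b y = w"
    \<comment> \<open>Vectors of the ambient product are determined by their components, so it is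
      enough to compare faces.\<close>
    proof (rule product_tangent(1)[OF fin Jne chNJ c1J cz(1)[unfolded A] sl(2) tangent_map_EE wE])
      fix j assume j: "j \<in> J"
      have "tangent_map ?cz ?c1 (\<lambda>z. z j) (?p ?b) (tangent_map ?cn ?cz ?p ?b y) = tangent_map ?cn ?c1 (\<lambda>z. ?p z j) ?b y"
        by (rule tangent_map_compose[where f="?p" and g="\<lambda>z. z j", OF csp cspr[OF j], symmetric])
      also have "(\<lambda>z. ?p z j) = d n j" using j by (simp add: p fun_eq_iff)
      also have "tangent_map ?cn ?c1 (d n j) ?b y = v j" using y(2)[OF j] by (simp add: F_def)
      finally show "tangent_map ?cz ?c1 (\<lambda>z. z j) (?p ?b) (tangent_map ?cn ?cz ?p ?b y) = tangent_map ?cz ?c1 (\<lambda>z. z j) (?p ?b) w"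
        by (simp add: v_def)
    qed
    then show ?thesis using y(1) by blast
  qed
  then show ?thesis
    unfolding submersive_at_def using cn sl(1) csp by blast
qed

end

section \<open>The neighborhoods\<close>

text \<open>The definition of \<open>U n\<close> only mentions horns of degree \<open>n\<close> in \<open>U (n - 1)\<close>, hence the constant family of manifolds.\<close>

primrec horn_nbhd :: "(nat \<Rightarrow> 'a mfd) \<Rightarrow> (nat \<Rightarrow> nat \<Rightarrow> 'a \<Rightarrow> 'a) \<Rightarrow> nat \<Rightarrow> 'a set" where
  "horn_nbhd X d 0 = points (X 0)"
| "horn_nbhd X d (Suc n) = (let Y = (\<lambda>_::nat. open_submanifold (X n) (horn_nbhd X d n)) in
     {x \<in> points (X (Suc n)). (\<forall>j\<le>Suc n. d (Suc n) j x \<in> horn_nbhd X d n) \<and>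
       (\<forall>m i. 1 \<le> m \<and> m \<le> Suc n \<and> i \<le> m \<longrightarrow>
         submersive_at (X (Suc n)) (horn_ambient Y (Suc n) ({i} \<union> {m+1..Suc n})) (horn Y d (Suc n) ({i} \<union> {m+1..Suc n}))
           (horn_projection d (Suc n) ({i} \<union> {m+1..Suc n})) x)})"

text \<open>The neighborhoods are cut out by submersivity on \<open>X n\<close>; this moves it to
  the manifold \<open>U n\<close> itself.\<close>

lemma submersive_at_open_submanifold:
  assumes M: "charted M" and A: "charted A" and U: "openin (mtop M) U" and x: "x \<in> U"
    and f: "submersive_at M A S f x" and fS: "f x \<in> S"
  shows "submersive_at (open_submanifold M U) A S f x"
proof -
  note MU = charted_open_submanifold[OF M U]
  have "x \<in> points (open_submanifold M U)" using x openin_subset[OF U] by auto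
  then obtain d W \<phi> where c: "(d, W, \<phi>) \<in> atlas (open_submanifold M U)" "x \<in> W" using chart_at[OF MU] by blast
  have cU: "(d, W, \<phi>) \<in> maximal_atlas (open_submanifold M U)" using c(1) atlas_subset_maximal[OF MU] by blast
  from f obtain d0 W0 \<phi>0 e V \<psi> k where s: "slice_chart A S k (e, V, \<psi>)" "chart_smooth_at (d0, W0, \<phi>0) (e, V, \<psi>) f x"
    unfolding submersive_at_def by blast
  note D = submersive_atD[OF M A f fS open_submanifold_maximal_atlas[OF M U cU] c(2) s(1) chart_smooth_at_points(2)[OF s(2)]]
  show ?thesis unfolding submersive_at_def using cU s(1) D by blast
qed

text \<open>The source \<open>M\<close> is left open because two are needed: the domain on which
  submersivity is tested, and the resulting neighborhood.\<close>

lemma smooth_horn_projection: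
  assumes M: "charted M" and Y: "charted (Y (n - 1))" and I: "{0..n} - I \<noteq> {}"
    and f: "\<And>j. j \<le> n \<Longrightarrow> smooth_map M (Y (n - 1)) (d n j)"
  shows "charted (horn_ambient Y n I)" "smooth_map M (horn_ambient Y n I) (horn_projection d n I)"
  unfolding horn_ambient_def horn_projection_def[abs_def]
  using Y by (intro charted_product_manifold smooth_map_tuple I M f; simp)+

theorem theorem3p1:
  fixes X :: "nat \<Rightarrow> 'a mfd"
    and d s :: "nat \<Rightarrow> nat \<Rightarrow> 'a \<Rightarrow> 'a"
  assumes "simplicial_manifold X d s"
  shows "\<exists>U :: nat \<Rightarrow> 'a set.
    (\<forall>n. openin (mtop (X n)) (U n) \<and> base_embedding s n ` points (X 0) \<subseteq> U n) \<and>
    (\<forall>n\<ge>1. \<forall>j\<le>n. d n j ` U n \<subseteq> U (n - 1)) \<and>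
    semisimplicial_manifold (\<lambda>n. open_submanifold (X n) (U n)) d \<and>
    (\<forall>n\<ge>1.
      (\<forall>i\<le>n. horn_submersive (\<lambda>n. open_submanifold (X n) (U n)) d n {i}) \<and>
      (\<forall>m i. 1 \<le> m \<and> m < n \<and> i \<le> m \<longrightarrow>
         horn_submersive (\<lambda>n. open_submanifold (X n) (U n)) d n ({i} \<union> {m+1..n})))"
proof -
  interpret simplicial_manifold X d s by fact
  have ss: "semisimplicial_manifold X d" by unfold_locales
  have ch: "charted (X k)" for k by (rule smooth_manifold_charted[OF manifold])
  define U where "U = horn_nbhd X d"
  define N where "N n = open_submanifold (X n) (U n)" for n
  define I where "I n m i = {i} \<union> {m+1..n}" for n m i :: nat
  define A where "A n m i = horn_ambient N n (I n m i)" for n m i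
  define H where "H n m i = horn N d n (I n m i)" for n m i
  define p where "p n m i = horn_projection d n (I n m i)" for n m i
  \<comment> \<open>Horns of degree \<open>n + 1\<close> involve \<open>N n\<close> only, so the
    recursion with its constant family agrees with the family \<open>N\<close>.\<close>
  have const: "horn_ambient N (Suc n) K = horn_ambient (\<lambda>_. N n) (Suc n) K"
    "horn N d (Suc n) K = horn (\<lambda>_. N n) d (Suc n) K" for n K
    by (simp_all add: horn_ambient_def horn_def)
  \<comment> \<open>The domain on which the horn projections into horns of \<open>U (n - 1)\<close>
    are defined; submersivity is an open condition on it.\<close>
  define O' where "O' n = {x \<in> points (X n). \<forall>j\<le>n. d n j x \<in> U (n - 1)}" for n
  have U_Suc: "U (Suc n) = {x \<in> O' (Suc n). \<forall>m i. 1 \<le> m \<and> m \<le> Suc n \<and> i \<le> m \<longrightarrow>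
      submersive_at (X (Suc n)) (A (Suc n) m i) (H (Suc n) m i) (p (Suc n) m i) x}" for n
    unfolding U_def O'_def A_def H_def p_def I_def const N_def by (auto simp: Let_def)
  have UM: "U n \<subseteq> points (X n)" for n by (cases n) (auto simp: U_def Let_def)
  have I_ne: "{0..n} - I n m i \<noteq> {}" if "1 \<le> m" "m \<le> n" for n m i
    unfolding I_def by (rule horn_complement_nonempty[OF that])
  have Nch0: "charted (N n)" if "openin (mtop (X n)) (U n)" for n
    unfolding N_def by (rule charted_open_submanifold[OF ch that])
  have step: "openin (mtop (X (Suc n))) (O' (Suc n)) \<and> openin (mtop (X (Suc n))) (U (Suc n))"
    if Un: "openin (mtop (X n)) (U n)" for n
  proof -
    have cont: "continuous_map (mtop (X (Suc n))) (mtop (X n)) (d (Suc n) j)" if "j \<le> Suc n" for j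
      using face_smooth[OF _ that] by (simp add: smooth_map_def)
    have "O' (Suc n) = (\<Inter>j\<in>{..Suc n}. {x \<in> points (X (Suc n)). d (Suc n) j x \<in> U n})"
      by (auto simp: O'_def)
    also have "openin (mtop (X (Suc n))) \<dots>"
      by (intro openin_INT2) (auto intro: openin_continuous_map_preimage[OF cont Un])
    finally have Oo: "openin (mtop (X (Suc n))) (O' (Suc n))" .
    have faceO: "smooth_map (open_submanifold (X (Suc n)) (O' (Suc n))) (N n) (d (Suc n) j)" if "j \<le> Suc n" for j
      unfolding N_def using that face_smooth[of "Suc n" j]
      by (intro smooth_map_open_submanifold[OF ch ch Oo Un]) (auto simp: O'_def)
    have o1: "openin (mtop (X (Suc n))) {x \<in> O' (Suc n). submersive_at (X (Suc n)) (A (Suc n) m i) (H (Suc n) m i) (p (Suc n) m i) x}"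
      if mi: "1 \<le> m" "m \<le> Suc n" for m i
    proof (rule openin_submersive_at[OF ch _ Oo])
      show "charted (A (Suc n) m i)"
        "smooth_map (open_submanifold (X (Suc n)) (O' (Suc n))) (A (Suc n) m i) (p (Suc n) m i)"
        unfolding A_def p_def
        using smooth_horn_projection[OF charted_open_submanifold[OF ch Oo] _ I_ne[OF mi], of N d] Nch0[OF Un] faceO by simp_all
      show "p (Suc n) m i ` O' (Suc n) \<subseteq> H (Suc n) m i"
      proof
        fix y assume "y \<in> p (Suc n) m i ` O' (Suc n)"
        then obtain x where x: "x \<in> O' (Suc n)" "y = p (Suc n) m i x" by blast
        then have "d (Suc n) j x \<in> points (N (Suc n - 1))" if "j \<le> Suc n" for j
          using subsetD[OF UM[of n]] that by (simp add: O'_def N_def)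
        then show "y \<in> H (Suc n) m i"
          unfolding x(2) p_def H_def using x(1) by (intro horn_projection_in_horn[OF ss]) (simp_all add: O'_def)
      qed
    qed
    let ?P = "{(m, i). 1 \<le> m \<and> m \<le> Suc n \<and> i \<le> m}"
    let ?G = "\<lambda>q. {x \<in> O' (Suc n). submersive_at (X (Suc n)) (A (Suc n) (fst q) (snd q)) (H (Suc n) (fst q) (snd q))
      (p (Suc n) (fst q) (snd q)) x}"
    have "openin (mtop (X (Suc n))) (\<Inter>q\<in>?P. ?G q)"
    proof (rule openin_INT2)
      show "finite ?P" by (rule finite_subset[of _ "{..Suc n} \<times> {..Suc n}"]) auto
      show "?P \<noteq> {}" by auto
      show "openin (mtop (X (Suc n))) (?G q)" if "q \<in> ?P" for q
        by (rule o1) (use that in auto)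
    qed
    moreover have "(\<Inter>q\<in>?P. ?G q) = U (Suc n)"
    proof (intro set_eqI iffI)
      fix x assume x: "x \<in> (\<Inter>q\<in>?P. ?G q)"
      have "x \<in> ?G (m, i)" if "1 \<le> m" "m \<le> Suc n" "i \<le> m" for m i
        using that by (intro INT_D[OF x]) simp
      \<comment> \<open>The pair \<open>(1, 0)\<close> is admissible in every degree and yields
        membership in \<open>O' (Suc n)\<close>.\<close>
      from this[of 1 0] this show "x \<in> U (Suc n)" unfolding U_Suc by simp
    next
      fix x assume "x \<in> U (Suc n)"
      then show "x \<in> (\<Inter>q\<in>?P. ?G q)" unfolding U_Suc by auto
    qed
    ultimately have "openin (mtop (X (Suc n))) (U (Suc n))" by simp
    then show ?thesis using Oo by blast
  qed
  have Uo: "openin (mtop (X n)) (U n)" for n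
    by (induction n) (use step in \<open>auto simp: U_def\<close>)
  have dU: "d n j ` U n \<subseteq> U (n - 1)" if "1 \<le> n" "j \<le> n" for n j
    using that U_Suc[of "n - 1"] by (auto simp: O'_def)
  have face_N: "smooth_map (N n) (N (n - 1)) (d n j)" if "1 \<le> n" "j \<le> n" for n j
    unfolding N_def by (rule smooth_map_open_submanifold[OF ch ch Uo Uo face_smooth[OF that] dU[OF that]])
  have N_ss: "semisimplicial_manifold N d"
  proof
    show "smooth_manifold (N n)" for n unfolding N_def by (rule smooth_manifold_open_submanifold[OF manifold Uo])
    show "smooth_map (N n) (N (n - 1)) (d n j)" if "1 \<le> n" "j \<le> n" for n j by (rule face_N[OF that])
    show "d (n - 1) i (d n j x) = d (n - 1) (j - 1) (d n i x)" if "2 \<le> n" "i < j" "j \<le> n" "x \<in> points (N n)" for n i j x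
      using face_face[OF that(1-3)] that(4) by (simp add: N_def)
  qed
  have Nch: "charted (N n)" for n by (rule Nch0[OF Uo])
  have A_ch: "charted (A n m i)" and p_smooth: "smooth_map (N n) (A n m i) (p n m i)" if "1 \<le> n" "1 \<le> m" "m \<le> n" for n m i
    unfolding A_def p_def using smooth_horn_projection[where Y=N and d=d and n=n, OF Nch Nch I_ne[OF that(2,3)] face_N[OF that(1)]]
    by simp_all
  have pH: "p n m i x \<in> H n m i" if "1 \<le> n" "x \<in> points (N n)" for n m i x
    unfolding p_def H_def using smooth_map_points[OF face_N[OF that(1)] that(2)]
    by (rule horn_projection_in_horn[OF N_ss that])
  \<comment> \<open>Valid on all of \<open>U n\<close> by construction, not merely near the base;
    embeddedness of the whole horn space in the next degree depends on it.\<close>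
  have sub: "submersive_at (N n) (A n m i) (H n m i) (p n m i) x"
    if h: "1 \<le> n" "1 \<le> m" "m \<le> n" "i \<le> m" "x \<in> points (N n)" for n m i x
    unfolding N_def
  proof (rule submersive_at_open_submanifold)
    show "charted (X n)" "charted (A n m i)" "openin (mtop (X n)) (U n)" "p n m i x \<in> H n m i"
      by (fact ch A_ch[OF h(1-3)] Uo pH[OF h(1,5)])+
    show xU: "x \<in> U n" using h(5) by (simp add: N_def)
    show "submersive_at (X n) (A n m i) (H n m i) (p n m i) x"
      using xU h(1-4) U_Suc[of "n - 1"] by simp
  qed
  \<comment> \<open>Degree \<open>n\<close> calls only on degree \<open>n - 1\<close>, through
    embeddedness there and \<open>sub\<close>. Base points play no part, so the result is available
    when they are treated next.\<close>
  have emb: "embedded_submanifold (A n m i) (H n m i)" if "1 \<le> n" "1 \<le> m" "m \<le> n" "i \<le> m" for n m i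
    using that
  proof (induction n arbitrary: m i rule: less_induct)
    case (less n)
    show ?case
      unfolding A_def H_def I_def
    proof (rule horn_embedded[OF N_ss less.prems])
      fix m i assume h: "2 \<le> n" "1 \<le> m" "m \<le> n - 1" "i \<le> m"
      then show "embedded_submanifold (horn_ambient N (n - 1) ({i} \<union> {m+1..n - 1})) (horn N d (n - 1) ({i} \<union> {m+1..n - 1}))"
        using less.IH[of "n - 1" m i] by (simp add: A_def H_def I_def)
      fix y assume "y \<in> points (N (n - 1))"
      then show "submersive_at (N (n - 1)) (horn_ambient N (n - 1) ({i} \<union> {m+1..n - 1})) (horn N d (n - 1) ({i} \<union> {m+1..n - 1}))
        (horn_projection d (n - 1) ({i} \<union> {m+1..n - 1})) y"
        using sub[of "n - 1" m i y] h by (simp add: A_def H_def p_def I_def)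
    qed
  qed
  have base: "base_embedding s n x \<in> U n" if x: "x \<in> points (X 0)" for n x
  proof (induction n)
    case 0 then show ?case using x by (simp add: U_def)
  next
    case (Suc n)
    have bO: "base_embedding s (Suc n) x \<in> O' (Suc n)"
      using base_embedding_points[OF x, of "Suc n"] face_base[OF x, of "Suc n"] Suc by (simp add: O'_def)
    have Oo: "openin (mtop (X (Suc n))) (O' (Suc n))" using step[OF Uo] by blast
    have "submersive_at (X (Suc n)) (A (Suc n) m i) (H (Suc n) m i) (p (Suc n) m i) (base_embedding s (Suc n) x)"
      if h: "1 \<le> m" "m \<le> Suc n" "i \<le> m" for m i
      unfolding A_def H_def p_def
    proof (rule submersive_at_base[OF _ h x, where V="U n" and O'="O' (Suc n)"])
      show "openin (mtop (X (Suc n - 1))) (U n)" "base_embedding s (Suc n - 1) x \<in> U n"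
        "N (Suc n - 1) = open_submanifold (X (Suc n - 1)) (U n)" using Uo Suc by (simp_all add: N_def)
      show "openin (mtop (X (Suc n))) (O' (Suc n))" "base_embedding s (Suc n) x \<in> O' (Suc n)" by (fact Oo bO)+
      show "d (Suc n) j ` O' (Suc n) \<subseteq> U n" if "j \<le> Suc n" for j using that by (auto simp: O'_def)
      show "I (Suc n) m i = {i} \<union> {m+1..Suc n}" by (simp add: I_def)
      show "embedded_submanifold (horn_ambient N (Suc n) (I (Suc n) m i)) (horn N d (Suc n) (I (Suc n) m i))"
        using emb[of "Suc n" m i] h by (simp add: A_def H_def)
    qed simp
    then show ?case unfolding U_Suc using bO by blast
  qed
  have hs: "horn_submersive N d n ({i} \<union> {m+1..n})" if h: "1 \<le> n" "1 \<le> m" "m \<le> n" "i \<le> m" for n m i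
  proof -
    have "submersion (N n) (submanifold (A n m i) (H n m i)) (p n m i)"
      by (rule submersionI[OF Nch A_ch[OF h(1-3)] p_smooth[OF h(1-3)] _ sub[OF h]]) (use pH[OF h(1)] in blast)
    then show ?thesis using emb[OF h] by (simp add: horn_submersive_def A_def H_def p_def I_def)
  qed
  \<comment> \<open>For \<open>m = n\<close> the interval \<open>{m+1..n}\<close> is empty, which
    leaves the horn missing just face \<open>i\<close>.\<close>
  have hs1: "horn_submersive N d n {i}" if "1 \<le> n" "i \<le> n" for n i
    using hs[OF that(1,1) order_refl that(2)] by simp
  have N: "(\<lambda>n. open_submanifold (X n) (U n)) = N" by (simp add: N_def fun_eq_iff)
  show ?thesis
    by (rule exI[of _ U], unfold N) (use Uo base dU N_ss hs hs1 in \<open>auto simp: image_subset_iff\<close>)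
qed

end
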